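(* Let $\mathcal T$ be a simple quadrilateral tiling of a closed, connected, orientable surface of positive genus, let $\mathbb D$ be a division ring, and let $n$ satisfy $n\ge\max_{v\in W(\mathcal T)}\deg v-1$, where $W(\mathcal T)$ is the set of white vertices of $\mathcal T$. Then the incidence theorem in $\mathbb P^n(\mathbb D)$ associated with $\mathcal T$ holds if and only if $\mathbb D$ is commutative.
   Context: A polygonal subdivision of a closed surface is a cellular decomposition in which the closure of every $2$-cell is an embedded polygon with at least two vertices. A quadrilateral tiling is a polygonal subdivision in which all faces (tiles) are quadrilaterals and vertices are colored black and white so that every edge joins vertices of different colors; it is simple if no two edges join the same pair of vertices. $\mathbb P^n(\mathbb D)$ is the left projective space over $\mathbb D$, with hyperplanes the rank-$n$ left submodules of $\mathbb D^{n+1}$. A realization of $\mathcal T$ assigns a point to each black vertex and a hyperplane to each white vertex such that for every edge the point and hyperplane at its endpoints are not incident. A tile with black-vertex points $A_1,A_2$ and white-vertex hyperplanes $\ell_1,\ell_2$ is coherent if $A_1=A_2$, or $\ell_1=\ell_2$, or the line $A_1A_2$ meets the codimension-$2$ subspace $\ell_1\cap\ell_2$. The incidence theorem associated with $\mathcal T$ is: for every realization of $\mathcal T$ in $\mathbb P^n(\mathbb D)$, if all tiles except one are coherent, then the remaining tile is coherent. *)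

theory Defs
  imports "HOL-Analysis.Analysis" "HOL-Complex_Analysis.Complex_Analysis"
begin

section \<open>Closed surfaces\<close>

definition chart :: "'a topology \<Rightarrow> 'a set \<Rightarrow> ('a \<Rightarrow> complex) \<Rightarrow> bool" where
  "chart X U \<phi> \<longleftrightarrow>
     openin X U \<and> open (\<phi> ` U) \<and>
     homeomorphic_map (subtopology X U) (top_of_set (\<phi> ` U)) \<phi>"

text \<open>Second countability is automatic: it follows from compactness and the existence of charts.\<close>

definition closed_connected_surface :: "'a topology \<Rightarrow> bool" where
  "closed_connected_surface X \<longleftrightarrow>
     topspace X \<noteq> {} \<and> compact_space X \<and> connected_space X \<and> Hausdorff_space X \<and>
     (\<forall>x\<in>topspace X. \<exists>U \<phi>. chart X U \<phi> \<and> x \<in> U)"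

text \<open>A homeomorphism between open subsets of the plane preserves orientation if its local degree
  is \<open>+1\<close> everywhere, i.e. if the image of a small positively oriented circle around \<open>z\<close>
  winds once, positively, around \<open>f z\<close>.  (In general the winding number is \<open>1\<close> or \<open>-1\<close>.)\<close>

definition orientation_preserving_on :: "complex set \<Rightarrow> (complex \<Rightarrow> complex) \<Rightarrow> bool" where
  "orientation_preserving_on S f \<longleftrightarrow>
     (\<forall>z r. 0 < r \<longrightarrow> cball z r \<subseteq> S \<longrightarrow> winding_number (f \<circ> circlepath z r) (f z) = 1)"

definition orientable :: "'a topology \<Rightarrow> bool" where
  "orientable X \<longleftrightarrow>
     (\<exists>\<A>. (\<forall>(U, \<phi>)\<in>\<A>. chart X U \<phi>) \<and>
          (\<Union>(U, \<phi>)\<in>\<A>. U) = topspace X \<and>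
          (\<forall>(U, \<phi>)\<in>\<A>. \<forall>(V, \<psi>)\<in>\<A>.
             orientation_preserving_on (\<phi> ` (U \<inter> V)) (\<psi> \<circ> inv_into U \<phi>)))"


section \<open>Polygonal subdivisions and quadrilateral tilings\<close>

text \<open>Edges and faces are represented by the open cells, as sets of points of the surface.\<close>

record 'a cell_complex =
  surface :: "'a topology"
  vertices :: "'a set"
  edges :: "'a set set"
  faces :: "'a set set"

definition cellular_decomposition :: "('a, 'b) cell_complex_scheme \<Rightarrow> bool" where
  "cellular_decomposition T \<longleftrightarrow>
     finite (vertices T) \<and> finite (edges T) \<and> finite (faces T) \<and>
     vertices T \<union> \<Union>(edges T) \<union> \<Union>(faces T) = topspace (surface T) \<and>
     disjoint (edges T) \<and> disjoint (faces T) \<and>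
     vertices T \<inter> \<Union>(edges T) = {} \<and> vertices T \<inter> \<Union>(faces T) = {} \<and>
     \<Union>(edges T) \<inter> \<Union>(faces T) = {} \<and>
     (\<forall>e\<in>edges T. \<exists>g::real \<Rightarrow> 'a.
        continuous_map (top_of_set {0..1}) (surface T) g \<and>
        homeomorphic_map (top_of_set {0<..<1}) (subtopology (surface T) e) g \<and>
        g 0 \<in> vertices T \<and> g 1 \<in> vertices T) \<and>
     (\<forall>f\<in>faces T. \<exists>h::complex \<Rightarrow> 'a.
        continuous_map (top_of_set (cball 0 1)) (surface T) h \<and>
        homeomorphic_map (top_of_set (ball 0 1)) (subtopology (surface T) f) h \<and>
        h ` sphere 0 1 \<subseteq> vertices T \<union> \<Union>(edges T))"

text \<open>The closure of the face \<open>f\<close> is an embedded \<open>k\<close>-gon.  The model polygon is the closed unit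
  disc with the \<open>k\<close>-th roots of unity as vertices and the circular arcs between consecutive
  ones as sides; this also makes sense for \<open>k = 2\<close>.\<close>

definition embedded_polygon :: "('a, 'b) cell_complex_scheme \<Rightarrow> nat \<Rightarrow> 'a set \<Rightarrow> bool" where
  "embedded_polygon T k f \<longleftrightarrow>
     (\<exists>h::complex \<Rightarrow> 'a.
        homeomorphic_map (top_of_set (cball 0 1))
          (subtopology (surface T) (surface T closure_of f)) h \<and>
        h ` ball 0 1 = f \<and>
        (\<forall>j<k. h (cis (2 * pi * real j / real k)) \<in> vertices T \<and>
               h ` (cis ` {2 * pi * real j / real k <..< 2 * pi * real (Suc j) / real k})
                 \<in> edges T))"

definition polygonal_subdivision :: "('a, 'b) cell_complex_scheme \<Rightarrow> bool" where
  "polygonal_subdivision T \<longleftrightarrow>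
     closed_connected_surface (surface T) \<and> cellular_decomposition T \<and>
     (\<forall>f\<in>faces T. \<exists>k\<ge>2. embedded_polygon T k f)"

text \<open>The genus of a closed connected orientable surface, by Euler's formula \<open>\<chi> = 2 - 2 g\<close>; the
  Euler characteristic may be read off from any cellular decomposition of the surface.\<close>

definition euler_characteristic :: "('a, 'b) cell_complex_scheme \<Rightarrow> int" where
  "euler_characteristic T =
     int (card (vertices T)) - int (card (edges T)) + int (card (faces T))"

definition has_genus :: "('a, 'b) cell_complex_scheme \<Rightarrow> nat \<Rightarrow> bool" where
  "has_genus T g \<longleftrightarrow> euler_characteristic T = 2 - 2 * int g"

definition vertices_of :: "('a, 'b) cell_complex_scheme \<Rightarrow> 'a set \<Rightarrow> 'a set" where
  "vertices_of T c = vertices T \<inter> (surface T closure_of c)"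

text \<open>There are no loops in the tilings below, so counting incident edges is the degree.\<close>

definition degree_of :: "('a, 'b) cell_complex_scheme \<Rightarrow> 'a \<Rightarrow> nat" where
  "degree_of T v = card {e \<in> edges T. v \<in> vertices_of T e}"

record 'a tiling = "'a cell_complex" +
  black :: "'a set"
  white :: "'a set"

definition quadrilateral_tiling :: "'a tiling \<Rightarrow> bool" where
  "quadrilateral_tiling T \<longleftrightarrow>
     polygonal_subdivision T \<and> (\<forall>f\<in>faces T. embedded_polygon T 4 f) \<and>
     black T \<union> white T = vertices T \<and> black T \<inter> white T = {} \<and>
     (\<forall>e\<in>edges T. \<exists>b\<in>black T. \<exists>w\<in>white T. vertices_of T e = {b, w})"

definition simple_tiling :: "'a tiling \<Rightarrow> bool" where
  "simple_tiling T \<longleftrightarrow>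
     (\<forall>e\<in>edges T. \<forall>e'\<in>edges T. vertices_of T e = vertices_of T e' \<longrightarrow> e = e')"


section \<open>Left projective spaces over a division ring\<close>

text \<open>The library's module theory assumes commutative scalars, hence these definitions.  The
  vectors of \<open>'d ^ 'm\<close> are multiplied by scalars on the left, \<open>(c *s x) $ i = c * x $ i\<close>.
  The projective space \<open>P^n\<close> over \<open>'d\<close> arises from \<open>'d ^ 'm\<close> with \<open>CARD('m) = n + 1\<close>; its
  subspaces are left submodules.\<close>

definition left_submodule :: "('d::division_ring ^ 'm) set \<Rightarrow> bool" where
  "left_submodule M \<longleftrightarrow>
     0 \<in> M \<and> (\<forall>x\<in>M. \<forall>y\<in>M. x + y \<in> M) \<and> (\<forall>c. \<forall>x\<in>M. c *s x \<in> M)"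

definition left_span :: "('d::division_ring ^ 'm) set \<Rightarrow> ('d ^ 'm) set" where
  "left_span S = left_submodule hull S"

definition left_basis :: "('d::division_ring ^ 'm) set \<Rightarrow> ('d ^ 'm) set \<Rightarrow> bool" where
  "left_basis B M \<longleftrightarrow>
     finite B \<and> left_span B = M \<and>
     (\<forall>c. (\<Sum>v\<in>B. c v *s v) = 0 \<longrightarrow> (\<forall>v\<in>B. c v = 0))"

definition has_rank :: "('d::division_ring ^ 'm) set \<Rightarrow> nat \<Rightarrow> bool" where
  "has_rank M k \<longleftrightarrow> left_submodule M \<and> (\<exists>B. left_basis B M \<and> card B = k)"

definition proj_point :: "('d::division_ring ^ 'm) set \<Rightarrow> bool" where
  "proj_point A \<longleftrightarrow> has_rank A 1"

definition proj_hyperplane :: "('d::division_ring ^ 'm) set \<Rightarrow> bool" where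
  "proj_hyperplane L \<longleftrightarrow> has_rank L (CARD('m) - 1)"

definition proj_join :: "('d::division_ring ^ 'm) set \<Rightarrow> ('d ^ 'm) set \<Rightarrow> ('d ^ 'm) set" where
  "proj_join A B = left_span (A \<union> B)"

definition proj_meets :: "('d::division_ring ^ 'm) set \<Rightarrow> ('d ^ 'm) set \<Rightarrow> bool" where
  "proj_meets K L \<longleftrightarrow> (\<exists>A. proj_point A \<and> A \<subseteq> K \<and> A \<subseteq> L)"


section \<open>The incidence theorem of a tiling\<close>

text \<open>A point \<open>A\<close> is incident to a hyperplane \<open>L\<close> iff \<open>A \<subseteq> L\<close>.\<close>

definition realization ::
  "'a tiling \<Rightarrow> ('a \<Rightarrow> ('d::division_ring ^ 'm) set) \<Rightarrow> ('a \<Rightarrow> ('d ^ 'm) set) \<Rightarrow> bool" where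
  "realization T P L \<longleftrightarrow>
     (\<forall>b\<in>black T. proj_point (P b)) \<and> (\<forall>w\<in>white T. proj_hyperplane (L w)) \<and>
     (\<forall>e\<in>edges T. \<forall>b\<in>black T. \<forall>w\<in>white T. vertices_of T e = {b, w} \<longrightarrow> \<not> P b \<subseteq> L w)"

definition coherent_tile ::
  "'a tiling \<Rightarrow> ('a \<Rightarrow> ('d::division_ring ^ 'm) set) \<Rightarrow> ('a \<Rightarrow> ('d ^ 'm) set) \<Rightarrow> 'a set \<Rightarrow> bool"
  where
  "coherent_tile T P L f \<longleftrightarrow>
     (\<exists>b\<^sub>1 b\<^sub>2 w\<^sub>1 w\<^sub>2.
        vertices_of T f \<inter> black T = {b\<^sub>1, b\<^sub>2} \<and> vertices_of T f \<inter> white T = {w\<^sub>1, w\<^sub>2} \<and>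
        (P b\<^sub>1 = P b\<^sub>2 \<or> L w\<^sub>1 = L w\<^sub>2 \<or>
         proj_meets (proj_join (P b\<^sub>1) (P b\<^sub>2)) (L w\<^sub>1 \<inter> L w\<^sub>2)))"

text \<open>The type argument \<open>'d ^ 'm\<close> carries the division ring and the dimension.\<close>

definition incidence_theorem :: "('d::division_ring ^ 'm) itself \<Rightarrow> 'a tiling \<Rightarrow> bool" where
  "incidence_theorem _ T \<longleftrightarrow>
     (\<forall>(P :: 'a \<Rightarrow> ('d ^ 'm) set) L. realization T P L \<longrightarrow>
        (\<forall>f\<in>faces T. (\<forall>f'\<in>faces T - {f}. coherent_tile T P L f') \<longrightarrow> coherent_tile T P L f))"

end

theory Submission
  imports Defs "HOL-Library.Z2"
begin

text \<open>Write points as spans of row vectors \<open>a\<^sub>b\<close> and hyperplanes as kernels of column vectors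
  \<open>l\<^sub>w\<close>, and label the edge \<open>bw\<close>, directed from black to white, with \<open>a\<^sub>b l\<^sub>w\<close>, and the reversed
  edge with the inverse.  A tile is coherent iff the product of the labels along its boundary is
  \<open>1\<close>.  On an oriented surface every directed edge lies on the boundary of exactly one tile, so if
  the ring is commutative, the product over all tiles is \<open>1\<close>, and the last tile is coherent.

  Conversely, let \<open>x y \<noteq> y x\<close>.  Merging tiles across common edges leaves one polygon whose sides
  are glued in pairs.  If two pairs of sides interleave, label them with \<open>x\<close> and \<open>y\<close> and all other
  sides with \<open>1\<close>; unfolding the merger yields labels for which only one tile fails to be
  coherent, its product being conjugate to a commutator.  If no pairs interleave, the polygon folds
  up to a tree, so every closed labelling with values in the field of two elements is exact; counting
  these labellings shows that the Euler characteristic is positive.  All labellings are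
  realized by points in general position: each white vertex imposes at most \<open>n + 1\<close> conditions
  on \<open>l\<^sub>w\<close>.  General position needs an infinite ring, hence Wedderburn's theorem.

  The topological input is invariance of domain: it shows that an edge has exactly two
  sides, and the constancy of the local degree of a map gluing two tiles along an edge shows that
  positively oriented tiles traverse this edge in opposite directions.\<close>

section \<open>Wedderburn's little theorem\<close>

text \<open>The closed labellings take values in the field of two elements because there an edge has
  the same value in both directions, and counting functions can replace dimension theory. Potentials
  are attached to directed sides, not to vertices, since vertices of merged polygons are never
  formed. Hence no boundary word may become empty in a merger; the even length of all words prevents
  this. The prescribed exceptional tile is the seed into which neighbours are merged one at a time,
  so that the failure can be placed on any tile.

  Orientability is given only through winding numbers in charts, while the combinatorics needs
  opposite directions along edges. Parametrizing a tile by the left half-plane through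
  \<open>exp\<close> makes its sides vertical segments, so that two tiles can be glued by reflecting
  the real part; this reflection is the source of the sign. Links of vertices have to be connected
  as well: this makes a potential on directed sides descend to vertices, and excludes tiles that
  hang together at vertices only.\<close>

definition int_coeffs :: "complex poly \<Rightarrow> bool" where
  "int_coeffs p \<longleftrightarrow> (\<forall>i. coeff p i \<in> \<int>)"

lemma int_coeffs_mult: "int_coeffs p \<Longrightarrow> int_coeffs q \<Longrightarrow> int_coeffs (p * q)"
  unfolding int_coeffs_def coeff_mult by (auto intro!: Ints_sum Ints_mult)

lemma int_coeffs_prod: "(\<And>i. i \<in> A \<Longrightarrow> int_coeffs (f i)) \<Longrightarrow> int_coeffs (prod f A)"
proof (induction A rule: infinite_finite_induct)
  case (insert x F)
  then show ?case by (auto intro: int_coeffs_mult)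
qed (auto simp: int_coeffs_def coeff_1)

text \<open>As \<open>p\<close> is monic, the coefficient of index \<open>N + j\<close> in
  \<open>p * s\<close> expresses \<open>coeff s j\<close> through integers and higher coefficients
  of \<open>s\<close>. The recursion runs downwards from the degree of \<open>s\<close>;
  \<open>k\<close> bounds how far \<open>j\<close> lies below the range where the coefficients
  vanish.\<close>

lemma int_coeffs_cofactor:
  assumes p: "int_coeffs p" "lead_coeff p = 1" and ps: "int_coeffs (p * s)"
  shows "int_coeffs s"
proof -
  define N where "N = degree p"
  have "coeff s j \<in> \<int>" if "degree s < j + k" for j k
    using that
  proof (induction k arbitrary: j)
    case 0
    then show ?case by (simp add: coeff_eq_0)
  next
    case (Suc k)
    have "coeff (p * s) (N + j) = (\<Sum>i\<le>N + j. coeff p i * coeff s (N + j - i))"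
      by (simp add: coeff_mult)
    also have "\<dots> = (\<Sum>i\<in>{..<N} \<union> {N} \<union> {N<..N + j}. coeff p i * coeff s (N + j - i))"
      by (rule sum.cong) auto
    also have "\<dots> = (\<Sum>i<N. coeff p i * coeff s (N + j - i)) + coeff p N * coeff s j
        + (\<Sum>i\<in>{N<..N + j}. coeff p i * coeff s (N + j - i))"
      by (subst sum.union_disjoint; auto)
    also have "(\<Sum>i\<in>{N<..N + j}. coeff p i * coeff s (N + j - i)) = 0"
      by (rule sum.neutral) (auto simp: N_def coeff_eq_0)
    finally have "coeff s j = coeff (p * s) (N + j) - (\<Sum>i<N. coeff p i * coeff s (N + j - i))"
      using p(2) by (simp add: N_def)
    moreover have "coeff s (N + j - i) \<in> \<int>" if "i < N" for i
      using Suc.IH[of "N + j - i"] Suc.prems that by simp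
    ultimately show ?case
      using p(1) ps unfolding int_coeffs_def by (auto intro!: Ints_diff Ints_sum Ints_mult)
  qed
  from this[of _ "Suc (degree s)"] show ?thesis
    unfolding int_coeffs_def by simp
qed

section \<open>Cyclotomic polynomials and their values at integers\<close>

definition primitive_roots :: "nat \<Rightarrow> complex set" where
  "primitive_roots n = {z. z ^ n = 1 \<and> (\<forall>k. 0 < k \<and> k < n \<longrightarrow> z ^ k \<noteq> 1)}"

definition cyclotomic :: "nat \<Rightarrow> complex poly" where
  "cyclotomic n = (\<Prod>z\<in>primitive_roots n. [:-z, 1:])"

lemma finite_primitive_roots: "n > 0 \<Longrightarrow> finite (primitive_roots n)"
  by (rule finite_subset[of _ "{z. z ^ n = 1}"])
    (auto simp: primitive_roots_def intro: finite_roots_unity)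

lemma primitive_roots_disjoint:
  assumes "m > 0" "n > 0" "m \<noteq> n"
  shows "primitive_roots m \<inter> primitive_roots n = {}"
  using assms unfolding primitive_roots_def by (auto dest: nat_neq_iff[THEN iffD1])

text \<open>Each root of unity is filed under its order \<open>d\<close>; the remainder of
  \<open>n\<close> modulo \<open>d\<close> must vanish by minimality of the order.\<close>

lemma roots_unity_eq_UN:
  assumes "n > 0"
  shows "{z::complex. z ^ n = 1} = (\<Union>d\<in>{d. d dvd n}. primitive_roots d)"
proof safe
  fix z :: complex assume z: "z ^ n = 1"
  define d where "d = (LEAST d. d > 0 \<and> z ^ d = 1)"
  have d: "d > 0" "z ^ d = 1"
    using LeastI[of "\<lambda>d. d > 0 \<and> z ^ d = 1" n] assms z by (auto simp: d_def)
  have min: "z ^ k \<noteq> 1" if "0 < k" "k < d" for k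
    using not_less_Least[of k "\<lambda>d. d > 0 \<and> z ^ d = 1"] that by (auto simp: d_def)
  have "z ^ n = z ^ (d * (n div d)) * z ^ (n mod d)"
    by (simp flip: power_add)
  then have "z ^ (n mod d) = 1"
    using z d by (simp add: power_mult)
  then have "n mod d = 0"
    using min[of "n mod d"] d by fastforce
  then show "z \<in> (\<Union>d\<in>{d. d dvd n}. primitive_roots d)"
    using d min by (auto simp: primitive_roots_def)
qed (auto simp: primitive_roots_def power_mult elim!: dvdE)

lemma prod_linear_monic:
  fixes S :: "complex set"
  shows "degree (\<Prod>z\<in>S. [:-z, 1:]) = card S \<and> lead_coeff (\<Prod>z\<in>S. [:-z, 1:]) = 1"
proof (induction S rule: infinite_finite_induct)
  case (insert x F)
  then have P0: "(\<Prod>z\<in>F. [:-z, 1:]) \<noteq> 0" by force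
  have "(\<Prod>z\<in>insert x F. [:-z, 1:]) = [:-x, 1:] * (\<Prod>z\<in>F. [:-z, 1:])"
    using insert by simp
  moreover have "degree ([:-x, 1:] * (\<Prod>z\<in>F. [:-z, 1:])) = card (insert x F)"
    using insert P0 by (subst degree_mult_eq) auto
  moreover have "lead_coeff ([:-x, 1:] * (\<Prod>z\<in>F. [:-z, 1:])) = 1"
    using insert by (subst lead_coeff_mult) auto
  ultimately show ?case by (simp only: simp_thms)
qed auto

text \<open>Both sides are monic of degree \<open>n\<close>, so a nonzero difference
  \<open>D\<close> would have degree below \<open>n\<close> and still vanish at all \<open>n\<close>
  roots of unity.\<close>

lemma prod_roots_unity:
  assumes "n > 0"
  shows "(\<Prod>z\<in>{z::complex. z ^ n = 1}. [:-z, 1:]) = monom 1 n - 1"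
proof (rule ccontr)
  define S where "S = {z::complex. z ^ n = 1}"
  define P where "P = (\<Prod>z\<in>S. [:-z, 1:])"
  define D where "D = P - (monom 1 n - 1)"
  assume "\<not> ?thesis"
  then have D0: "D \<noteq> 0" by (simp add: D_def P_def S_def)
  have S: "finite S" "card S = n"
    using assms card_roots_unity_eq[of n] by (auto simp: S_def intro: finite_roots_unity)
  have P: "degree P = n" "coeff P n = 1"
    using prod_linear_monic[of S] S by (auto simp: P_def)
  have "degree D \<le> n"
    unfolding D_def using P
    by (intro degree_diff_le order.trans[OF degree_monom_le]) auto
  moreover have "coeff D n = 0"
    using P assms by (simp add: D_def coeff_1)
  moreover have "degree D \<noteq> n"
  proof
    assume "degree D = n"
    with \<open>coeff D n = 0\<close> have "lead_coeff D = 0" by (simp only:)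
    then show False using D0 leading_coeff_neq_0 by blast
  qed
  ultimately have "degree D < n" by linarith
  moreover have "card S \<le> degree D"
  proof -
    have "poly D z = 0" if "z \<in> S" for z
    proof -
      have "poly P z = 0"
        using S(1) that unfolding P_def poly_prod by (intro prod_zero) auto
      then show ?thesis
        using that by (simp add: D_def S_def poly_monom)
    qed
    then have "card S \<le> card {z. poly D z = 0}"
      by (intro card_mono poly_roots_finite[OF D0]) blast
    then show ?thesis using card_poly_roots_bound[OF D0] by (rule order.trans)
  qed
  ultimately show False using S(2) by linarith
qed

lemma prod_cyclotomic:
  assumes "n > 0"
  shows "(\<Prod>d\<in>{d. d dvd n}. cyclotomic d) = monom 1 n - 1"
proof -
  have pos: "d dvd n \<Longrightarrow> d > 0" for d using assms by (auto intro: Nat.gr0I)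
  have "(\<Prod>z\<in>(\<Union>d\<in>{d. d dvd n}. primitive_roots d). [:-z, 1:]) = (\<Prod>d\<in>{d. d dvd n}. cyclotomic d)"
    unfolding cyclotomic_def using assms
    by (intro prod.UNION_disjoint) (auto simp: pos finite_primitive_roots primitive_roots_disjoint)
  then show ?thesis
    using prod_roots_unity[OF assms] roots_unity_eq_UN[OF assms] by simp
qed

text \<open>The cyclotomic polynomials of the proper divisors are integral by induction and monic,
  and \<open>cyclotomic n\<close> is the cofactor of their product in an integral
  polynomial.\<close>

lemma int_coeffs_cyclotomic: "n > 0 \<Longrightarrow> int_coeffs (cyclotomic n)"
proof (induction n rule: less_induct)
  case (less n)
  define R where "R = (\<Prod>d\<in>{d. d dvd n} - {n}. cyclotomic d)"
  have R: "int_coeffs R"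
    unfolding R_def
  proof (rule int_coeffs_prod)
    fix d assume "d \<in> {d. d dvd n} - {n}"
    then show "int_coeffs (cyclotomic d)"
      using less by (metis DiffE dvd_imp_le dvd_0_left mem_Collect_eq nat_less_le neq0_conv singletonI)
  qed
  have "lead_coeff R = 1"
    unfolding R_def lead_coeff_prod cyclotomic_def prod_linear_monic[THEN conjunct2] by simp
  moreover have "R * cyclotomic n = monom 1 n - 1"
    using prod.remove[of "{d. d dvd n}" n cyclotomic] less.prems prod_cyclotomic[of n]
    by (simp add: R_def mult.commute)
  moreover have "int_coeffs (monom 1 n - 1)"
    by (auto simp: int_coeffs_def coeff_1)
  ultimately show ?case
    using int_coeffs_cofactor[OF R] by metis
qed

lemma poly_int_coeffs: "int_coeffs p \<Longrightarrow> x \<in> \<int> \<Longrightarrow> poly p x \<in> \<int>"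
  unfolding poly_altdef int_coeffs_def by (auto intro!: Ints_sum Ints_mult)

text \<open>The witness \<open>a\<close> is the absolute value of the \<open>n\<close>-th cyclotomic polynomial at \<open>q\<close>.\<close>

lemma cyclotomic_divisor:
  fixes q n :: nat
  assumes q: "q \<ge> 2" and n: "n > 1"
  obtains a :: nat where "a > q - 1" "a dvd q ^ n - 1"
    "\<And>d. d dvd n \<Longrightarrow> d < n \<Longrightarrow> \<exists>b. q ^ n - 1 = (q ^ d - 1) * (a * b)"
proof -
  define A where "A = poly (cyclotomic n) (of_nat q)"
  have "A \<in> \<int>"
    unfolding A_def using n by (intro poly_int_coeffs int_coeffs_cyclotomic) auto
  then obtain c where c: "A = of_int c" by (rule Ints_cases)
  have A: "A = (\<Prod>z\<in>primitive_roots n. of_nat q - z)"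
    by (simp add: A_def cyclotomic_def poly_prod)
  have z1: "norm z = 1 \<and> z \<noteq> 1" if "z \<in> primitive_roots n" for z
    using that n power_eq_1_iff[of z n] unfolding primitive_roots_def
    by (auto dest: spec[of _ 1])
  have gt: "norm (of_nat q - z) > real q - 1" if "z \<in> primitive_roots n" for z
  proof (rule ccontr)
    assume "\<not> ?thesis"
    then have le: "norm (of_nat q - z) \<le> real q - 1" by simp
    have "real q - Re z \<le> norm (of_nat q - z)"
      using complex_Re_le_cmod[of "of_nat q - z"] by simp
    then have "Re z \<ge> 1" using le by simp
    moreover have "Re z ^ 2 + Im z ^ 2 = 1"
      using z1[OF that] by (simp add: cmod_def)
    moreover have "(Re z)\<^sup>2 \<ge> Re z" using \<open>Re z \<ge> 1\<close> by (simp add: power2_eq_square)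
    ultimately have "Re z = 1" "(Im z)\<^sup>2 = 0"
      using zero_le_power2[of "Im z"] by linarith+
    then show False using z1[OF that] by (simp add: complex_eq_iff)
  qed
  \<comment> \<open>An explicit primitive root is needed: it supplies one factor of \<open>A\<close>
    greater than \<open>q - 1\<close>, and the remaining factors have absolute value at least
    1.\<close>
  define z0 where "z0 = cis (2 * pi / real n)"
  have z0: "z0 \<in> primitive_roots n"
  proof -
    have "z0 ^ k \<noteq> 1" if k: "0 < k" "k < n" for k
    proof
      assume "z0 ^ k = 1"
      then have "cis (real k * (2 * pi / real n)) = 1"
        unfolding z0_def Complex.DeMoivre .
      then have "cis (2 * pi * real k / real n) = cis (2 * pi * real 0 / real n)"
        by (simp add: mult.commute)
      moreover have "inj_on (\<lambda>k. cis (2 * pi * real k / real n)) {..<n}"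
        using Complex.bij_betw_roots_unity[of n] n by (simp add: bij_betw_def)
      ultimately have "k = 0" using k by (metis (no_types, lifting) inj_onD lessThan_iff less_trans)
      then show False using k by simp
    qed
    moreover have "z0 ^ n = 1"
      using n unfolding z0_def Complex.DeMoivre by simp
    ultimately show ?thesis by (auto simp: primitive_roots_def)
  qed
  have fin: "finite (primitive_roots n)" using finite_primitive_roots n by simp
  have "norm A = norm (of_nat q - z0) * (\<Prod>z\<in>primitive_roots n - {z0}. norm (of_nat q - z))"
    unfolding A prod_norm[symmetric] using prod.remove[OF fin z0] by simp
  moreover have "(\<Prod>z\<in>primitive_roots n - {z0}. norm (of_nat q - z)) \<ge> 1"
  proof (rule prod_ge_1)
    fix z assume "z \<in> primitive_roots n - {z0}"
    then show "1 \<le> norm (of_nat q - z)" using gt[of z] q by simp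
  qed
  ultimately have "norm A > real q - 1"
    using gt[OF z0] mult_left_mono[of 1 "(\<Prod>z\<in>primitive_roots n - {z0}. norm (of_nat q - z))" "norm (of_nat q - z0)"]
    by simp
  then have "real_of_int \<bar>c\<bar> > real_of_int (int q - 1)" by (simp add: c)
  then have ca: "\<bar>c\<bar> > int q - 1" by linarith
  define a where "a = nat \<bar>c\<bar>"
  have a1: "a > q - 1" using ca q unfolding a_def by linarith
  have fact: "\<exists>b. q ^ n - 1 = (q ^ d - 1) * (a * b)" if d: "d dvd n" "d < n" for d
  proof -
    have d0: "d > 0" using d n dvd_pos_nat[of n d] by simp
    \<comment> \<open>\<open>R\<close> collects the divisors of \<open>n\<close> that are neither
      \<open>n\<close> nor divisors of \<open>d\<close>, so that \<open>cyclotomic n * R\<close> is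
      the quotient of \<open>monom 1 n - 1\<close> by \<open>monom 1 d - 1\<close>.\<close>
    define R where "R = (\<Prod>e\<in>{e. e dvd n} - {n} - {e. e dvd d}. cyclotomic e)"
    have "int_coeffs R"
      unfolding R_def using n
      by (intro int_coeffs_prod int_coeffs_cyclotomic) (use dvd_pos_nat[of n] in auto)
    then have "poly R (of_nat q) \<in> \<int>" by (intro poly_int_coeffs) auto
    then obtain b where b: "poly R (of_nat q) = of_int b" by (rule Ints_cases)
    have "{e. e dvd n} = {e. e dvd d} \<union> insert n ({e. e dvd n} - {n} - {e. e dvd d})"
    proof -
      have "e dvd n" if "e dvd d" for e using dvd_trans[OF that d(1)] .
      then show ?thesis by auto
    qed
    then have "(monom 1 n - 1 :: complex poly)
        = (\<Prod>e\<in>{e. e dvd d} \<union> insert n ({e. e dvd n} - {n} - {e. e dvd d}). cyclotomic e)"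
      using prod_cyclotomic[of n] n by simp
    also have "\<dots> = (\<Prod>e\<in>{e. e dvd d}. cyclotomic e) * (cyclotomic n * R)"
    proof -
      have "finite {e. e dvd d}" "finite {e. e dvd n}" using n d0 by simp_all
      moreover have "\<not> n dvd d" using d d0 by (rule_tac nat_dvd_not_less)
      ultimately show ?thesis unfolding R_def by (subst prod.union_disjoint) auto
    qed
    also have "\<dots> = (monom 1 d - 1) * (cyclotomic n * R)"
      using prod_cyclotomic[OF d0] by simp
    finally have "poly (monom 1 n - 1) (of_nat q :: complex) = poly ((monom 1 d - 1) * (cyclotomic n * R)) (of_nat q)"
      by simp
    then have "(of_nat q ^ n - 1 :: complex) = (of_nat q ^ d - 1) * (of_int c * of_int b)"
      by (simp add: poly_monom b c[unfolded A_def])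
    then have "of_int (int q ^ n - 1) = (of_int ((int q ^ d - 1) * (c * b)) :: complex)"
      by simp
    then have eq: "int q ^ n - 1 = (int q ^ d - 1) * (c * b)"
      unfolding of_int_eq_iff .
    have ge: "q ^ k \<ge> 1" for k using q by simp
    have "int (q ^ k - 1) = \<bar>int q ^ k - 1\<bar>" for k
      using ge[of k] q by (simp add: of_nat_diff)
    then have "int (q ^ n - 1) = int (q ^ d - 1) * (int a * int (nat \<bar>b\<bar>))"
      using eq by (simp add: a_def abs_mult)
    then have "q ^ n - 1 = (q ^ d - 1) * (a * nat \<bar>b\<bar>)"
      unfolding of_nat_mult[symmetric] of_nat_eq_iff .
    then show ?thesis by blast
  qed
  obtain b where "q ^ n - 1 = (q ^ 1 - 1) * (a * b)"
    using fact[OF one_dvd n] by (elim exE)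
  then have "a dvd q ^ n - 1"
    by (simp only: dvd_mult dvd_triv_left)
  from that[OF a1 this fact] show thesis .
qed

text \<open>In place of a basis, take a subspace \<open>W\<close> of maximal size among those whose
  size is a power of \<open>card K\<close>. A vector \<open>v\<close> outside \<open>W\<close> would
  produce the larger subspace \<open>W + K v\<close>, of size
  \<open>card W * card K\<close>.\<close>

lemma card_left_space_power:
  fixes K V :: "'d::division_ring set"
  assumes fin: "finite (UNIV :: 'd set)"
    and K: "0 \<in> K" "1 \<in> K" "\<And>x y. x \<in> K \<Longrightarrow> y \<in> K \<Longrightarrow> x - y \<in> K"
      "\<And>x y. x \<in> K \<Longrightarrow> y \<in> K \<Longrightarrow> x * y \<in> K" "\<And>x. x \<in> K \<Longrightarrow> inverse x \<in> K"
    and V: "0 \<in> V" "\<And>x y. x \<in> V \<Longrightarrow> y \<in> V \<Longrightarrow> x - y \<in> V"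
      "\<And>k x. k \<in> K \<Longrightarrow> x \<in> V \<Longrightarrow> k * x \<in> V"
  shows "\<exists>m. card V = card K ^ m"
proof -
  define good where "good W \<longleftrightarrow> W \<subseteq> V \<and> 0 \<in> W \<and> (\<forall>x\<in>W. \<forall>y\<in>W. x - y \<in> W) \<and>
      (\<forall>k\<in>K. \<forall>x\<in>W. k * x \<in> W) \<and> (\<exists>m. card W = card K ^ m)" for W
  have finS: "finite S" for S :: "'d set" by (rule finite_subset[OF subset_UNIV fin])
  have "good {0}" using V unfolding good_def by (simp add: exI[of _ 0])
  moreover have "\<forall>W. good W \<longrightarrow> card W < Suc (card (UNIV::'d set))"
    using card_mono[OF fin subset_UNIV] by (simp add: less_Suc_eq_le)
  ultimately obtain W where W: "good W" and max: "\<And>W'. good W' \<Longrightarrow> card W' \<le> card W"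
    using ex_has_greatest_nat[of good "{0}" card "Suc (card (UNIV::'d set))"] by metis
  have "W = V"
  proof (rule ccontr)
    assume "W \<noteq> V"
    then obtain v where v: "v \<in> V" "v \<notin> W" using W by (auto simp: good_def)
    define f where "f = (\<lambda>(w, k). w - k * v)"
    have "inj_on f (W \<times> K)"
    proof (rule inj_onI, clarify)
      fix w k w' k'
      assume a: "w \<in> W" "k \<in> K" "w' \<in> W" "k' \<in> K" "f (w, k) = f (w', k')"
      then have e: "w - w' = (k - k') * v" by (simp add: f_def algebra_simps)
      have "w - w' \<in> W" "k - k' \<in> K" using a W K by (auto simp: good_def)
      have "k = k'"
      proof (rule ccontr)
        assume "k \<noteq> k'"
        then have "v = inverse (k - k') * (w - w')"
          by (simp add: e mult.assoc[symmetric])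
        then show False
          using v W K(5)[OF \<open>k - k' \<in> K\<close>] \<open>w - w' \<in> W\<close> by (auto simp: good_def)
      qed
      then show "w = w' \<and> k = k'" using e by simp
    qed
    then have card: "card (f ` (W \<times> K)) = card W * card K"
      by (simp add: card_image card_cartesian_product)
    have "good (f ` (W \<times> K))"
      unfolding good_def
    proof (intro conjI ballI)
      show "f ` (W \<times> K) \<subseteq> V"
        using W v(1) V by (auto simp: good_def f_def)
      show "0 \<in> f ` (W \<times> K)"
        using W K(1) by (auto simp: good_def f_def image_iff intro!: bexI[of _ "(0,0)"])
      fix x assume x: "x \<in> f ` (W \<times> K)"
      then obtain w k where wk: "x = w - k * v" "w \<in> W" "k \<in> K" by (auto simp: f_def)
      {
        fix y assume "y \<in> f ` (W \<times> K)"
        then obtain w' k' where wk': "y = w' - k' * v" "w' \<in> W" "k' \<in> K" by (auto simp: f_def)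
        have "x - y = f (w - w', k - k')" by (simp add: f_def wk wk' algebra_simps)
        then show "x - y \<in> f ` (W \<times> K)" using W K wk wk' by (auto simp: good_def)
      }
      fix l assume "l \<in> K"
      have "l * x = f (l * w, l * k)" by (simp add: f_def wk algebra_simps)
      then show "l * x \<in> f ` (W \<times> K)" using W K wk \<open>l \<in> K\<close> by (auto simp: good_def)
    next
      obtain m where "card W = card K ^ m" using W by (auto simp: good_def)
      then show "\<exists>m. card (f ` (W \<times> K)) = card K ^ m"
        by (intro exI[of _ "Suc m"]) (simp add: card)
    qed
    moreover have "v = f (0, - 1)" by (simp add: f_def)
    ultimately have "card W * card K \<le> card W" using max card by metis
    moreover have "card W > 0" using W finS by (auto simp: good_def card_gt_0_iff)
    ultimately have "card K \<le> 1" by simp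
    moreover have "card {0, 1 :: 'd} \<le> card K" using K(1,2) finS by (intro card_mono) auto
    ultimately show False by simp
  qed
  then show ?thesis using W by (auto simp: good_def)
qed

text \<open>Witt's argument: in the class equation of the multiplicative group, the order of the
  group and the size of every noncentral class are divisible by the cyclotomic value
  \<open>a\<close>. Hence \<open>a\<close> divides \<open>q - 1\<close>, the number of nonzero
  central elements, although \<open>a > q - 1\<close>.\<close>

theorem wedderburn:
  fixes x y :: "'d::division_ring"
  assumes fin: "finite (UNIV :: 'd set)"
  shows "x * y = y * x"
proof -
  define C where "C x = {y :: 'd. x * y = y * x}" for x
  define Z where "Z = {z :: 'd. \<forall>y. z * y = y * z}"
  have finS: "finite S" for S :: "'d set" by (rule finite_subset[OF subset_UNIV fin])
  have inv_comm: "inverse b * a = a * inverse b" if "b * a = a * b" for a b :: 'd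
    using mult_commute_imp_mult_inverse_commute[OF that] .
  have mult_comm: "(a * b) * c = c * (a * b)" if "a * c = c * a" "b * c = c * b" for a b c :: 'd
    using that by (metis mult.assoc)
  have Z: "0 \<in> Z" "1 \<in> Z" "\<And>x y. x \<in> Z \<Longrightarrow> y \<in> Z \<Longrightarrow> x - y \<in> Z"
      "\<And>x y. x \<in> Z \<Longrightarrow> y \<in> Z \<Longrightarrow> x * y \<in> Z" "\<And>x. x \<in> Z \<Longrightarrow> inverse x \<in> Z"
    unfolding Z_def mem_Collect_eq
    by (simp, simp, simp add: left_diff_distrib right_diff_distrib, blast intro: mult_comm, blast intro: inv_comm)
  have C': "C x = {y. y * x = x * y}" for x by (auto simp: C_def)
  have C: "0 \<in> C w" "1 \<in> C w" "\<And>a b. a \<in> C w \<Longrightarrow> b \<in> C w \<Longrightarrow> a - b \<in> C w"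
      "\<And>a b. a \<in> C w \<Longrightarrow> b \<in> C w \<Longrightarrow> a * b \<in> C w" "\<And>a. a \<in> C w \<Longrightarrow> inverse a \<in> C w" for w
    unfolding C' mem_Collect_eq
    by (simp, simp, simp add: left_diff_distrib right_diff_distrib, blast intro: mult_comm, blast intro: inv_comm)
  have ZC: "Z \<subseteq> C x" for x by (auto simp: Z_def C_def)
  define q where "q = card Z"
  have "card {0, 1 :: 'd} \<le> card Z" using Z(1,2) finS by (intro card_mono) auto
  then have q: "q \<ge> 2" by (simp add: q_def)
  obtain n where n: "card (UNIV :: 'd set) = q ^ n"
    using card_left_space_power[OF fin Z, of UNIV] by (auto simp: q_def)
  \<comment> \<open>The whole ring is a left space over the centralizer, and the centralizer one
    over the centre; comparing powers of \<open>q\<close> gives the divisibility of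
    exponents.\<close>
  have Cd: "\<exists>d. d dvd n \<and> card (C x) = q ^ d" for x
  proof -
    have Cx: "0 \<in> C x" "1 \<in> C x" "\<And>a b. a \<in> C x \<Longrightarrow> b \<in> C x \<Longrightarrow> a - b \<in> C x"
      "\<And>a b. a \<in> C x \<Longrightarrow> b \<in> C x \<Longrightarrow> a * b \<in> C x" "\<And>a. a \<in> C x \<Longrightarrow> inverse a \<in> C x"
      by (fact C)+
    obtain d where d: "card (C x) = q ^ d"
      using card_left_space_power[OF fin Z Cx(1,3)] Cx(4) ZC[of x] unfolding q_def by blast
    obtain m where "card (UNIV :: 'd set) = card (C x) ^ m"
      using card_left_space_power[OF fin Cx, of UNIV] by auto
    then have "q ^ n = q ^ (d * m)" by (simp add: n d power_mult)
    then have "n = d * m" using q by simp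
    then show ?thesis using d by (intro exI[of _ d]) simp
  qed
  show ?thesis
  proof (cases "n \<le> 1")
    case True
    then have "card (UNIV :: 'd set) \<le> card Z" using n q by (cases n) (auto simp: q_def)
    then have "Z = UNIV" using fin by (metis card_seteq subset_UNIV)
    then show ?thesis by (auto simp: Z_def)
  next
    case False
    then obtain a where a: "a > q - 1" "a dvd q ^ n - 1"
      and div: "\<And>d. d dvd n \<Longrightarrow> d < n \<Longrightarrow> \<exists>b. q ^ n - 1 = (q ^ d - 1) * (a * b)"
      using cyclotomic_divisor[OF q, of n] by (metis not_le)
    define cl where "cl x = (\<lambda>g. g * x * inverse g) ` (- {0})" for x :: 'd
    \<comment> \<open>Orbit-stabilizer: the elements that conjugate \<open>x\<close> to
      \<open>h * x * inverse h\<close> are the products of \<open>h\<close> with nonzero elements of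
      the centralizer.\<close>
    have ccl: "card (cl x) * card (C x - {0}) = card (- {0 :: 'd})" for x
    proof -
      have "card {g \<in> - {0}. g * x * inverse g = y} = card (C x - {0})" if y: "y \<in> cl x" for y
      proof -
        obtain h where h: "h \<noteq> 0" "y = h * x * inverse h" using y by (auto simp: cl_def)
        have "{g \<in> - {0}. g * x * inverse g = y} = (\<lambda>c. h * c) ` (C x - {0})"
        proof (intro equalityI subsetI)
          fix g assume "g \<in> {g \<in> - {0}. g * x * inverse g = y}"
          then have g: "g \<noteq> 0" "y = g * x * inverse g" by auto
          have "x * (inverse h * g) = inverse h * (h * x * inverse h) * g"
            using h(1) by (simp add: mult.assoc[symmetric])
          also have "\<dots> = inverse h * (g * x * inverse g) * g" using g h by simp
          also have "\<dots> = inverse h * g * x" using g(1) by (simp add: mult.assoc)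
          finally have "inverse h * g \<in> C x - {0}" using g h by (simp add: C_def mult.assoc)
          then show "g \<in> (\<lambda>c. h * c) ` (C x - {0})"
            using h(1) by (intro image_eqI[of _ _ "inverse h * g"]) (auto simp: mult.assoc[symmetric])
        next
          fix g assume "g \<in> (\<lambda>c. h * c) ` (C x - {0})"
          then obtain c where gc: "g = h * c" and c: "c \<in> C x" "c \<noteq> 0" by auto
          have "h * c * x * inverse (h * c) = h * (c * x) * inverse c * inverse h"
            using h c by (simp add: nonzero_inverse_mult_distrib mult.assoc)
          also have "c * x = x * c" using c by (simp add: C_def)
          also have "h * (x * c) * inverse c * inverse h = h * x * (c * inverse c) * inverse h"
            by (simp only: mult.assoc)
          finally show "g \<in> {g \<in> - {0}. g * x * inverse g = y}" using c h gc by simp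
        qed
        moreover have "inj_on (\<lambda>c. h * c) (C x - {0})" using h by (auto simp: inj_on_def)
        ultimately show ?thesis by (simp add: card_image)
      qed
      then have "(\<Sum>y\<in>cl x. card {g \<in> - {0}. g * x * inverse g = y}) = card (cl x) * card (C x - {0})"
        by simp
      then show ?thesis
        using sum.image_gen[of "- {0 :: 'd}" "\<lambda>_. 1::nat" "\<lambda>g. g * x * inverse g"] finS
        by (simp add: cl_def)
    qed
    have c1: "card (- {0 :: 'd}) = q ^ n - 1"
      using card_Diff_singleton[of 0 "UNIV :: 'd set"] n by (simp add: Compl_eq_Diff_UNIV)
    have dvdcl: "a dvd card (cl x)" if "x \<notin> Z" for x
    proof -
      obtain d where d: "d dvd n" "card (C x) = q ^ d" using Cd by blast
      have "C x \<noteq> UNIV" using that by (auto simp: C_def Z_def)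
      then have "card (C x) < card (UNIV :: 'd set)" using fin by (metis psubset_card_mono psubsetI subset_UNIV)
      then have "d < n" using d n q by simp
      then obtain b where b: "q ^ n - 1 = (q ^ d - 1) * (a * b)" using div d by blast
      have "d > 0" using d \<open>d < n\<close> by (auto intro: Nat.gr0I)
      then have "q ^ d > 1" using q by (intro one_less_power) auto
      moreover have "card (C x - {0}) = q ^ d - 1" using d C(1) by (simp add: card_Diff_singleton)
      ultimately have "card (cl x) = a * b" using ccl[of x] b c1 by simp
      then show ?thesis by simp
    qed
    define N where "N = - Z"
    have cl_eq: "cl y = cl x" if y: "y \<in> cl x" for x y
    proof -
      obtain h where h: "h \<noteq> 0" "y = h * x * inverse h" using y by (auto simp: cl_def)
      have "g * y * inverse g \<in> cl x" if "g \<noteq> 0" for g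
        using that h unfolding cl_def
        by (intro image_eqI[of _ _ "g * h"]) (auto simp: nonzero_inverse_mult_distrib mult.assoc)
      moreover have "g * x * inverse g \<in> cl y" if "g \<noteq> 0" for g
        using that h unfolding cl_def
        by (intro image_eqI[of _ _ "g * inverse h"])
          (auto simp: nonzero_inverse_mult_distrib mult.assoc, simp add: mult.assoc[symmetric])
      ultimately show ?thesis by (auto simp: cl_def)
    qed
    have self: "x \<in> cl x" for x unfolding cl_def by (intro image_eqI[of _ _ 1]) auto
    have clN: "cl x \<subseteq> N" if "x \<in> N" for x
    proof
      fix y assume y: "y \<in> cl x"
      show "y \<in> N"
      proof (rule ccontr)
        assume "y \<notin> N"
        then have "g * y = y * g" for g by (simp add: N_def Z_def)
        then have "g * y * inverse g = y" if "g \<noteq> 0" for g using that by (simp add: mult.assoc)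
        then have "cl y \<subseteq> {y}" by (auto simp: cl_def)
        then have "x = y" using cl_eq[OF y] self by auto
        then show False using that \<open>y \<notin> N\<close> by simp
      qed
    qed
    have "a dvd card (\<Union>(cl ` N))"
    proof (rule dvd_partition)
      show "\<forall>c\<in>cl ` N. a dvd card c" using dvdcl by (auto simp: N_def)
      show "\<forall>c1\<in>cl ` N. \<forall>c2\<in>cl ` N. c1 \<noteq> c2 \<longrightarrow> c1 \<inter> c2 = {}"
        using cl_eq by blast
    qed (rule finS)
    moreover have "\<Union>(cl ` N) = N" using self clN by blast
    moreover have "card (- {0 :: 'd}) = card (Z - {0}) + card N"
    proof -
      have "- {0} = (Z - {0}) \<union> N" using Z(1) by (auto simp: N_def)
      moreover have "(Z - {0}) \<inter> N = {}" by (auto simp: N_def)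
      ultimately show ?thesis using card_Un_disjoint[OF finS finS, of "Z - {0}" N] by (simp only:)
    qed
    moreover have "card (Z - {0}) = q - 1" using Z(1) by (simp add: q_def card_Diff_singleton)
    ultimately have "a dvd q - 1" using a(2) c1 by (metis dvd_add_left_iff)
    then show ?thesis using a(1) q by (auto dest: dvd_imp_le)
  qed
qed

section \<open>Points and hyperplanes over a division ring\<close>

text \<open>The multiplication is a parameter so that the lemma applies to a division ring and to its
  opposite.\<close>

lemma homogeneous_system_solution:
  fixes m :: "'d::division_ring \<Rightarrow> 'd \<Rightarrow> 'd" and c :: "'n \<Rightarrow> 'i \<Rightarrow> 'd"
  assumes m: "m = (*) \<or> m = (\<lambda>x y. y * x)"
    and "finite N" "finite I" "card N < card I"
  shows "\<exists>y. (\<exists>i\<in>I. y i \<noteq> 0) \<and> (\<forall>i. i \<notin> I \<longrightarrow> y i = 0) \<and> (\<forall>b\<in>N. (\<Sum>i\<in>I. m (c b i) (y i)) = 0)"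
  using assms(2-4)
proof (induction N arbitrary: I c rule: finite_induct)
  case empty
  then obtain i where "i \<in> I" by (metis card.empty card_gt_0_iff ex_in_conv)
  then show ?case by (intro exI[of _ "\<lambda>j. if j = i then 1 else 0"]) auto
next
  case (insert b N)
  have m0 [simp]: "m x 0 = 0" "m 0 x = 0" for x using m by auto
  have madd: "m x (y + z) = m x y + m x z" "m (x - y) z = m x z - m y z" for x y z
    using m by (auto simp: algebra_simps)
  have massoc: "m (m x y) z = m x (m y z)" for x y z using m by (auto simp: mult.assoc)
  have minv: "m x (m (inverse x) y) = y" if "x \<noteq> 0" for x y
    using m that by (auto simp: mult.assoc[symmetric]) (auto simp: mult.assoc)
  have mneg: "m x (- y) = - m x y" for x y using m by auto
  have msum: "m x (sum f J) = (\<Sum>j\<in>J. m x (f j))" for x and f :: "'i \<Rightarrow> 'd" and J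
    using m by (auto simp: sum_distrib_left sum_distrib_right)
  show ?case
  proof (cases "\<forall>i\<in>I. c b i = 0")
    case True
    have "card N < card I" using insert by simp
    from insert.IH[OF insert.prems(1) this, of c] obtain y where
      y: "\<exists>i\<in>I. y i \<noteq> 0" "\<forall>i. i \<notin> I \<longrightarrow> y i = 0" "\<forall>b\<in>N. (\<Sum>i\<in>I. m (c b i) (y i)) = 0" by blast
    have "(\<Sum>i\<in>I. m (c b i) (y i)) = 0" using True by simp
    then show ?thesis using y by (intro exI[of _ y]) simp
  next
    case False
    then obtain k where k: "k \<in> I" "c b k \<noteq> 0" by blast
    \<comment> \<open>Gaussian elimination with pivot \<open>c b k\<close>. Row \<open>b\<close> is
      multiplied on the side away from the unknowns, so that \<open>massoc\<close> applies for both
      choices of \<open>m\<close>.\<close>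
    define c' where "c' a i = c a i - m (m (c a k) (inverse (c b k))) (c b i)" for a i
    have "card N < card (I - {k})" using insert k by simp
    from insert.IH[OF _ this, of c'] insert.prems(1) obtain y where
      y: "\<exists>i\<in>I-{k}. y i \<noteq> 0" "\<forall>i. i \<notin> I-{k} \<longrightarrow> y i = 0" "\<forall>b\<in>N. (\<Sum>i\<in>I-{k}. m (c' b i) (y i)) = 0"
      by blast
    define s where "s = (\<Sum>i\<in>I-{k}. m (c b i) (y i))"
    define z where "z = y(k := - m (inverse (c b k)) s)"
    have z: "(\<Sum>i\<in>I. m (c a i) (z i)) = (\<Sum>i\<in>I-{k}. m (c a i) (y i)) - m (c a k) (m (inverse (c b k)) s)" for a
    proof -
      have "(\<Sum>i\<in>I. m (c a i) (z i)) = m (c a k) (z k) + (\<Sum>i\<in>I-{k}. m (c a i) (z i))"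
        using k insert.prems(1) by (simp add: sum.remove)
      also have "(\<Sum>i\<in>I-{k}. m (c a i) (z i)) = (\<Sum>i\<in>I-{k}. m (c a i) (y i))"
        by (rule sum.cong) (auto simp: z_def)
      finally show ?thesis by (simp add: z_def mneg)
    qed
    have "(\<Sum>i\<in>I. m (c a i) (z i)) = 0" if "a \<in> insert b N" for a
    proof (cases "a = b")
      case True
      then show ?thesis unfolding z using k by (simp add: minv s_def)
    next
      case False
      then have "0 = (\<Sum>i\<in>I-{k}. m (c' a i) (y i))" using y(3) that by simp
      also have "\<dots> = (\<Sum>i\<in>I-{k}. m (c a i) (y i)) - m (c a k) (m (inverse (c b k)) s)"
        unfolding s_def msum sum_subtractf[symmetric] by (simp add: c'_def madd massoc)
      finally show ?thesis unfolding z by simp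
    qed
    moreover have "\<exists>i\<in>I. z i \<noteq> 0" using y(1) by (auto simp: z_def)
    moreover have "\<forall>i. i \<notin> I \<longrightarrow> z i = 0" using y(2) k by (auto simp: z_def)
    ultimately show ?thesis by blast
  qed
qed

text \<open>A hyperplane is the kernel of \<open>v \<mapsto> pair v l\<close> for a column vector \<open>l\<close>, which is determined
  up to multiplication by scalars on the right.\<close>

definition pair :: "'d::division_ring ^ 'm \<Rightarrow> 'd ^ 'm \<Rightarrow> 'd" where
  "pair v l = (\<Sum>i\<in>UNIV. v $ i * l $ i)"

lemma pair_simps [simp]:
  fixes v w l :: "'d::division_ring ^ 'm::finite"
  shows "pair (v + w) l = pair v l + pair w l" "pair (v - w) l = pair v l - pair w l"
    "pair (c *s v) l = c * pair v l" "pair 0 l = 0" "pair v 0 = 0" "pair (- v) l = - pair v l"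
    "pair (sum f A) l = (\<Sum>x\<in>A. pair (f x) l)"
    "pair v (k + l) = pair v k + pair v l"
  by (simp_all add: pair_def sum.distrib algebra_simps sum_subtractf sum_distrib_left sum_negf
      sum_distrib_right) (rule sum.swap)

lemma pair_scale_right: "pair v (\<chi> i. l $ i * c) = pair v l * c"
  for v l :: "'d::division_ring ^ 'm::finite"
  by (simp add: pair_def sum_distrib_right mult.assoc)

lemma pair_axis: "pair (axis i c) l = c * l $ i" for l :: "'d::division_ring ^ 'm::finite"
proof -
  have "(\<Sum>j\<in>UNIV. axis i c $ j * l $ j) = (\<Sum>j\<in>UNIV. if j = i then c * l $ j else 0)"
    by (rule sum.cong) (auto simp: axis_def)
  then show ?thesis by (simp add: pair_def)
qed

lemma exists_annihilator:
  fixes N :: "('d::division_ring ^ 'm::finite) set"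
  assumes "finite N" "card N < CARD('m)"
  shows "\<exists>l. l \<noteq> 0 \<and> (\<forall>v\<in>N. pair v l = 0)"
proof -
  obtain y where y: "\<exists>i. y i \<noteq> 0" "\<forall>v\<in>N. (\<Sum>i\<in>UNIV. v $ i * y i) = 0"
    using homogeneous_system_solution[of "(*)" N "UNIV :: 'm set" "vec_nth"] assms by auto
  show ?thesis
    using y by (intro exI[of _ "\<chi> i. y i"]) (auto simp: pair_def vec_eq_iff)
qed

text \<open>The unknown coefficients stand on the left of the vectors here, so the system is solved
  over the opposite ring.\<close>

lemma exists_dependence:
  fixes B :: "('d::division_ring ^ 'm::finite) set"
  assumes "finite B" "CARD('m) < card B"
  shows "\<exists>c. (\<exists>v\<in>B. c v \<noteq> 0) \<and> (\<Sum>v\<in>B. c v *s v) = 0"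
proof -
  obtain y where y: "\<exists>v\<in>B. y v \<noteq> 0" "\<forall>i\<in>(UNIV::'m set). (\<Sum>v\<in>B. y v * v $ i) = 0"
    using homogeneous_system_solution[of "\<lambda>x y. y * x" "UNIV :: 'm set" B "\<lambda>i v. vec_nth v i"] assms by auto
  then show ?thesis by (intro exI[of _ y]) (auto simp: vec_eq_iff)
qed

lemma left_submodule_sum:
  assumes "left_submodule M" "\<And>x. x \<in> A \<Longrightarrow> f x \<in> M"
  shows "(\<Sum>x\<in>A. c x *s f x) \<in> M"
  using assms(2)
proof (induction A rule: infinite_finite_induct)
  case (insert x F)
  then have "c x *s f x \<in> M" "(\<Sum>x\<in>F. c x *s f x) \<in> M"
    using assms(1) unfolding left_submodule_def by auto
  then show ?case using insert assms(1) unfolding left_submodule_def by simp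
qed (use assms(1) in \<open>auto simp: left_submodule_def\<close>)

lemma left_submodule_left_span: "left_submodule (left_span S)"
proof -
  have "left_submodule (\<Inter>A)" if "\<forall>M\<in>A. left_submodule M" for A
    using that unfolding left_submodule_def by blast
  from this[of "{M. left_submodule M \<and> S \<subseteq> M}"] show ?thesis
    unfolding left_span_def hull_def by blast
qed

lemma left_span_superset: "S \<subseteq> left_span S"
  unfolding left_span_def by (rule hull_subset)

lemma left_span_minimal: "S \<subseteq> M \<Longrightarrow> left_submodule M \<Longrightarrow> left_span S \<subseteq> M"
  unfolding left_span_def by (rule hull_minimal)

lemma left_span_finite:
  fixes B :: "('d::division_ring ^ 'm::finite) set"
  assumes "finite B"
  shows "left_span B = range (\<lambda>c. \<Sum>v\<in>B. c v *s v)"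
proof
  show "left_span B \<subseteq> range (\<lambda>c. \<Sum>v\<in>B. c v *s v)"
  proof (rule left_span_minimal)
    show "B \<subseteq> range (\<lambda>c. \<Sum>v\<in>B. c v *s v)"
    proof
      fix w assume w: "w \<in> B"
      have "(\<Sum>v\<in>B. (if v = w then 1 else 0) *s v) = (\<Sum>v\<in>B. if v = w then v else 0)"
        by (rule sum.cong) (auto simp: vec_eq_iff)
      then have "w = (\<Sum>v\<in>B. (if v = w then 1 else 0) *s v)" using assms w by simp
      then show "w \<in> range (\<lambda>c. \<Sum>v\<in>B. c v *s v)"
        by (intro range_eqI[of _ _ "\<lambda>v. if v = w then 1 else 0"])
    qed
    have add: "(\<Sum>v\<in>B. c v *s v) + (\<Sum>v\<in>B. d v *s v) = (\<Sum>v\<in>B. (c v + d v) *s v)" for c d :: "'d ^ 'm \<Rightarrow> 'd"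
      by (simp add: vec_eq_iff algebra_simps sum.distrib)
    have scale: "k *s (\<Sum>v\<in>B. c v *s v) = (\<Sum>v\<in>B. (k * c v) *s v)" for k :: 'd and c :: "'d ^ 'm \<Rightarrow> 'd"
      by (simp add: vec_eq_iff sum_distrib_left mult.assoc)
    have zero: "0 = (\<Sum>v\<in>B. (0 :: 'd) *s v)" by (simp add: vec_eq_iff)
    show "left_submodule (range (\<lambda>c. \<Sum>v\<in>B. c v *s v))"
      unfolding left_submodule_def
    proof (intro conjI ballI allI; (elim rangeE)?; hypsubst?)
      show "0 \<in> range (\<lambda>c. \<Sum>v\<in>B. c v *s v)" by (subst zero) (rule rangeI)
      show "(\<Sum>v\<in>B. c v *s v) + (\<Sum>v\<in>B. d v *s v) \<in> range (\<lambda>c. \<Sum>v\<in>B. c v *s v)" for c d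
        unfolding add by (rule rangeI)
      show "k *s (\<Sum>v\<in>B. c v *s v) \<in> range (\<lambda>c. \<Sum>v\<in>B. c v *s v)" for k c
        unfolding scale by (rule rangeI)
    qed
  qed
  show "range (\<lambda>c. \<Sum>v\<in>B. c v *s v) \<subseteq> left_span B"
  proof (rule image_subsetI)
    show "(\<Sum>v\<in>B. c v *s v) \<in> left_span B" for c
      using left_span_superset[of B] by (intro left_submodule_sum[OF left_submodule_left_span]) blast
  qed
qed

lemma left_span_singleton: "left_span {a} = range (\<lambda>c. c *s a)"
  for a :: "'d::division_ring ^ 'm::finite"
proof -
  have "range (\<lambda>c :: 'd ^ 'm \<Rightarrow> 'd. c a *s a) = range (\<lambda>c. c *s a)"
    by (force intro: range_eqI[where x = "\<lambda>_. _"])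
  then show ?thesis by (simp add: left_span_finite)
qed

lemma proj_point_iff: "proj_point A \<longleftrightarrow> (\<exists>a. a \<noteq> 0 \<and> A = left_span {a})"
  for A :: "('d::division_ring ^ 'm::finite) set"
proof
  assume "proj_point A"
  then obtain a where a: "left_basis {a} A"
    unfolding proj_point_def has_rank_def by (auto simp: card_1_singleton_iff)
  then have "a \<noteq> 0" unfolding left_basis_def by (auto dest!: spec[of _ "\<lambda>_. 1"])
  then show "\<exists>a. a \<noteq> 0 \<and> A = left_span {a}" using a unfolding left_basis_def by auto
next
  assume "\<exists>a. a \<noteq> 0 \<and> A = left_span {a}"
  then obtain a where a: "a \<noteq> 0" "A = left_span {a}" by blast
  have "c = 0" if c: "c *s a = 0" for c
  proof -
    obtain i where "a $ i \<noteq> 0" using a(1) by (auto simp: vec_eq_iff)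
    moreover have "(c *s a) $ i = 0" using c by simp
    ultimately show ?thesis by simp
  qed
  then have "left_basis {a} A" using a unfolding left_basis_def by auto
  then show "proj_point A"
    unfolding proj_point_def has_rank_def using a left_submodule_left_span
    by (intro conjI exI[of _ "{a}"]) auto
qed

definition ker_hyperplane :: "'d::division_ring ^ 'm \<Rightarrow> ('d ^ 'm) set" where
  "ker_hyperplane l = {v. pair v l = 0}"

lemma left_submodule_ker_hyperplane: "left_submodule (ker_hyperplane l)"
  for l :: "'d::division_ring ^ 'm::finite"
  by (auto simp: left_submodule_def ker_hyperplane_def)

text \<open>A basis of \<open>CARD('m) - 1\<close> vectors has a common annihilator
  \<open>l\<close>. A vector of the kernel outside the span, together with one outside the kernel,
  would enlarge it to \<open>CARD('m) + 1\<close> independent vectors. For the converse a basis of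
  the kernel is written down.\<close>

lemma proj_hyperplane_iff: "proj_hyperplane L \<longleftrightarrow> (\<exists>l. l \<noteq> 0 \<and> L = ker_hyperplane l)"
  for L :: "('d::division_ring ^ 'm::finite) set"
proof
  assume "proj_hyperplane L"
  then obtain B where B: "finite B" "left_span B = L" "card B = CARD('m) - 1"
    "\<And>c. (\<Sum>v\<in>B. c v *s v) = 0 \<Longrightarrow> \<forall>v\<in>B. c v = 0" and L: "left_submodule L"
    unfolding proj_hyperplane_def has_rank_def left_basis_def by auto
  have "card B < CARD('m)" using B(3) by simp
  then obtain l where l: "l \<noteq> 0" "\<forall>v\<in>B. pair v l = 0" using exists_annihilator[OF B(1)] by blast
  have sub: "L \<subseteq> ker_hyperplane l"
    unfolding B(2)[symmetric] using l(2)
    by (intro left_span_minimal left_submodule_ker_hyperplane) (auto simp: ker_hyperplane_def)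
  have "v \<in> L" if v: "pair v l = 0" for v
  proof (rule ccontr)
    assume vL: "v \<notin> L"
    have BL: "B \<subseteq> L" using left_span_superset B(2) by blast
    have "l $ i = 0" for i
    proof (rule ccontr)
      assume li: "l $ i \<noteq> 0"
      define e :: "'d ^ 'm" where "e = axis i 1"
      have el: "pair e l \<noteq> 0" using li by (simp add: e_def pair_axis)
      have vB: "v \<notin> B" "e \<notin> B" "e \<noteq> v" using vL BL el l(2) v by auto
      then have "card (insert e (insert v B)) = Suc (Suc (card B))" using B(1) by simp
      then have "CARD('m) < card (insert e (insert v B))" using B(3) by simp
      then obtain c where c: "\<exists>x\<in>insert e (insert v B). c x \<noteq> 0" "(\<Sum>x\<in>insert e (insert v B). c x *s x) = 0"
        using exists_dependence[of "insert e (insert v B)"] B(1) by blast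
      have s: "c e *s e + (c v *s v + (\<Sum>x\<in>B. c x *s x)) = 0" using c(2) vB B(1) by simp
      then have "pair (c e *s e + (c v *s v + (\<Sum>x\<in>B. c x *s x))) l = 0" by simp
      then have "c e * pair e l = 0" using l(2) v by simp
      then have ce: "c e = 0" using el by simp
      have sB: "(\<Sum>x\<in>B. c x *s x) \<in> L" using BL by (intro left_submodule_sum[OF L]) blast
      have cv: "c v = 0"
      proof (rule ccontr)
        assume nz: "c v \<noteq> 0"
        have "c v *s v = (- 1) *s (\<Sum>x\<in>B. c x *s x)"
          using s ce by (simp add: eq_neg_iff_add_eq_0 vector_smult_lneg)
        then have "inverse (c v) *s (c v *s v) \<in> L"
          using L sB unfolding left_submodule_def by metis
        then show False using nz vL by simp
      qed
      then have "\<forall>x\<in>B. c x = 0" using B(4) s ce by simp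
      then show False using c(1) ce cv by auto
    qed
    then show False using l(1) by (simp add: vec_eq_iff)
  qed
  then have "L = ker_hyperplane l" using sub by (auto simp: ker_hyperplane_def)
  then show "\<exists>l. l \<noteq> 0 \<and> L = ker_hyperplane l" using l(1) by blast
next
  assume "\<exists>l. l \<noteq> 0 \<and> L = ker_hyperplane l"
  then obtain l where l: "l \<noteq> 0" "L = ker_hyperplane l" by blast
  then obtain k where k: "l $ k \<noteq> 0" by (auto simp: vec_eq_iff)
  \<comment> \<open>These vectors lie in the kernel of \<open>l\<close>, and their coordinates other
    than \<open>k\<close> are those of the standard basis; this gives independence as well as
    spanning.\<close>
  define f where "f i = axis i 1 - (l $ i * inverse (l $ k)) *s axis k 1" for i
  define I where "I = - {k}"
  have fi: "f i $ j = (if i = j then 1 else 0)" if "j \<noteq> k" for i j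
    using that by (simp add: f_def axis_def)
  have inj: "inj_on f I"
  proof (rule inj_onI)
    fix i j assume "i \<in> I" "j \<in> I" "f i = f j"
    then show "i = j" using fi[of j i] fi[of j j] by (auto simp: I_def split: if_splits)
  qed
  have comp: "(\<Sum>v\<in>f ` I. c v *s v) $ j = c (f j)" if "j \<noteq> k" for c j
  proof -
    have "(\<Sum>v\<in>f ` I. c v *s v) $ j = (\<Sum>i\<in>I. c (f i) * f i $ j)"
      by (simp add: sum.reindex[OF inj])
    also have "\<dots> = (\<Sum>i\<in>I. if i = j then c (f i) else 0)"
      by (rule sum.cong) (auto simp: fi that)
    finally show ?thesis using that by (simp add: I_def)
  qed
  have fk: "f i \<in> L" for i
    using k unfolding l(2) ker_hyperplane_def f_def by (simp add: pair_axis mult.assoc)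
  have "left_span (f ` I) = L"
  proof
    show "left_span (f ` I) \<subseteq> L"
      unfolding l(2) using fk l(2) by (intro left_span_minimal left_submodule_ker_hyperplane) auto
    show "L \<subseteq> left_span (f ` I)"
    proof
      fix v assume v: "v \<in> L"
      define w where "w = v - (\<Sum>x\<in>f ` I. v $ (inv_into I f x) *s x)"
      have wj: "w $ j = 0" if "j \<noteq> k" for j
        using that inj comp[OF that, of "\<lambda>x. v $ inv_into I f x"] by (simp add: w_def I_def)
      have "(\<Sum>x\<in>f ` I. v $ (inv_into I f x) *s x) \<in> L"
        using fk unfolding l(2) by (intro left_submodule_sum left_submodule_ker_hyperplane) auto
      then have "pair w l = 0" using v unfolding l(2) w_def ker_hyperplane_def by simp
      moreover have "pair w l = (\<Sum>i\<in>UNIV. if i = k then w $ i * l $ i else 0)"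
        unfolding pair_def by (rule sum.cong) (auto simp: wj)
      ultimately have "w $ k = 0" using k by simp
      then have "w = 0" using wj by (metis vec_eq_iff zero_index)
      then have "v = (\<Sum>x\<in>f ` I. v $ (inv_into I f x) *s x)" by (simp add: w_def)
      then show "v \<in> left_span (f ` I)"
        by (subst left_span_finite) (auto intro: range_eqI)
    qed
  qed
  moreover have "\<forall>v\<in>f ` I. c v = 0" if "(\<Sum>v\<in>f ` I. c v *s v) = 0" for c
  proof -
    have "c (f j) = 0" if "j \<in> I" for j
      using comp[of j c] that unfolding \<open>(\<Sum>v\<in>f ` I. c v *s v) = 0\<close> by (simp add: I_def)
    then show ?thesis by blast
  qed
  ultimately have "left_basis (f ` I) L" unfolding left_basis_def by simp
  moreover have "card (f ` I) = CARD('m) - 1"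
    unfolding card_image[OF inj] by (simp add: I_def Compl_eq_Diff_UNIV card_Diff_singleton)
  ultimately show "proj_hyperplane L"
    unfolding proj_hyperplane_def has_rank_def l(2) using left_submodule_ker_hyperplane by blast
qed

lemma incident_iff: "left_span {a} \<subseteq> ker_hyperplane l \<longleftrightarrow> pair a l = 0"
  for a l :: "'d::division_ring ^ 'm::finite"
proof
  assume "left_span {a} \<subseteq> ker_hyperplane l"
  then have "a \<in> ker_hyperplane l" using left_span_superset[of "{a}"] by blast
  then show "pair a l = 0" by (simp add: ker_hyperplane_def)
qed (auto simp: left_span_singleton ker_hyperplane_def)

text \<open>Since \<open>a\<^sub>1\<close> is off both hyperplanes, the line through two distinct
  points meets \<open>ker_hyperplane l\<close> in the span of \<open>v l\<close>. Coherence means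
  that both hyperplanes cut out the same vector; if it vanishes, the two points coincide.\<close>

lemma coherent_iff:
  fixes a\<^sub>1 a\<^sub>2 l\<^sub>1 l\<^sub>2 :: "'d::division_ring ^ 'm::finite"
  assumes nz: "pair a\<^sub>1 l\<^sub>1 \<noteq> 0" "pair a\<^sub>1 l\<^sub>2 \<noteq> 0" "pair a\<^sub>2 l\<^sub>1 \<noteq> 0" "pair a\<^sub>2 l\<^sub>2 \<noteq> 0"
  shows "left_span {a\<^sub>1} = left_span {a\<^sub>2} \<or> ker_hyperplane l\<^sub>1 = ker_hyperplane l\<^sub>2 \<or>
      proj_meets (proj_join (left_span {a\<^sub>1}) (left_span {a\<^sub>2})) (ker_hyperplane l\<^sub>1 \<inter> ker_hyperplane l\<^sub>2)
    \<longleftrightarrow> pair a\<^sub>2 l\<^sub>1 * inverse (pair a\<^sub>1 l\<^sub>1) = pair a\<^sub>2 l\<^sub>2 * inverse (pair a\<^sub>1 l\<^sub>2)"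
    (is "?P \<or> ?Q \<or> ?R \<longleftrightarrow> ?E")
proof -
  define v where "v l = a\<^sub>2 - (pair a\<^sub>2 l * inverse (pair a\<^sub>1 l)) *s a\<^sub>1" for l :: "'d ^ 'm"
  have v0: "pair (v l) l = 0" if "pair a\<^sub>1 l \<noteq> 0" for l
    using that by (simp add: v_def mult.assoc)
  have cancel: "x * inverse y = c" if "x = c * y" "y \<noteq> 0" for x y c :: 'd
    using that by (simp add: mult.assoc)
  have ?E if ?P
  proof -
    from that obtain c where "a\<^sub>2 = c *s a\<^sub>1"
      using left_span_superset[of "{a\<^sub>2}"] unfolding left_span_singleton by auto
    then show ?E using nz by (simp add: mult.assoc)
  qed
  moreover have ?E if ?Q
  proof -
    from that have "pair (v l\<^sub>1) l\<^sub>2 = 0" using v0[OF nz(1)] by (auto simp: ker_hyperplane_def)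
    then have "pair a\<^sub>2 l\<^sub>2 = (pair a\<^sub>2 l\<^sub>1 * inverse (pair a\<^sub>1 l\<^sub>1)) * pair a\<^sub>1 l\<^sub>2"
      by (simp add: v_def)
    then show ?E using cancel nz by metis
  qed
  moreover have ?E if ?R
  proof -
    from that obtain x where x: "x \<noteq> 0" "x \<in> left_span (left_span {a\<^sub>1} \<union> left_span {a\<^sub>2})"
      "pair x l\<^sub>1 = 0" "pair x l\<^sub>2 = 0"
      unfolding proj_meets_def proj_point_iff proj_join_def ker_hyperplane_def
      using left_span_superset by blast
    define M where "M = (\<lambda>(c\<^sub>1, c\<^sub>2). c\<^sub>1 *s a\<^sub>1 + c\<^sub>2 *s a\<^sub>2) ` UNIV"
    have "left_submodule M"
      unfolding left_submodule_def
    proof (intro conjI ballI allI)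
      show "0 \<in> M" unfolding M_def by (rule image_eqI[of _ _ "(0, 0)"]) auto
    next
      fix x y assume "x \<in> M" "y \<in> M"
      then obtain c d c' d' where "x = c *s a\<^sub>1 + d *s a\<^sub>2" "y = c' *s a\<^sub>1 + d' *s a\<^sub>2" by (auto simp: M_def)
      then show "x + y \<in> M" unfolding M_def
        by (intro image_eqI[of _ _ "(c + c', d + d')"]) (auto simp: vec_eq_iff algebra_simps)
    next
      fix k x assume "x \<in> M"
      then obtain c d where "x = c *s a\<^sub>1 + d *s a\<^sub>2" by (auto simp: M_def)
      then show "k *s x \<in> M" unfolding M_def
        by (intro image_eqI[of _ _ "(k * c, k * d)"]) (auto simp: vec_eq_iff algebra_simps)
    qed
    moreover have "left_span {a\<^sub>1} \<subseteq> M" unfolding left_span_singleton M_def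
      by (force intro: image_eqI[of _ _ "(_, 0)"])
    moreover have "left_span {a\<^sub>2} \<subseteq> M" unfolding left_span_singleton M_def
      by (force intro: image_eqI[of _ _ "(0, _)"])
    ultimately have "x \<in> M" using x(2) left_span_minimal[of "left_span {a\<^sub>1} \<union> left_span {a\<^sub>2}" M] by blast
    then obtain c d where cd: "x = c *s a\<^sub>1 + d *s a\<^sub>2" by (auto simp: M_def)
    have d: "d \<noteq> 0"
    proof
      assume "d = 0"
      then have "c * pair a\<^sub>1 l\<^sub>1 = 0" using x(3) cd by simp
      then have "c = 0" using nz by simp
      then show False using cd x(1) \<open>d = 0\<close> by simp
    qed
    have "pair a\<^sub>2 l = - (inverse d * c) * pair a\<^sub>1 l" if "pair x l = 0" for l
    proof -
      have "d * pair a\<^sub>2 l = - (c * pair a\<^sub>1 l)" using that cd by (simp add: eq_neg_iff_add_eq_0 add.commute)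
      then have "inverse d * (d * pair a\<^sub>2 l) = inverse d * - (c * pair a\<^sub>1 l)" by simp
      then show ?thesis using d by (simp add: mult.assoc[symmetric])
    qed
    then show ?E using cancel nz x by metis
  qed
  moreover have "?P \<or> ?Q \<or> ?R" if E: ?E
  proof (cases "v l\<^sub>1 = 0")
    case True
    define c where "c = pair a\<^sub>2 l\<^sub>1 * inverse (pair a\<^sub>1 l\<^sub>1)"
    have c: "a\<^sub>2 = c *s a\<^sub>1" using True by (simp add: v_def c_def)
    have "c \<noteq> 0" using nz by (simp add: c_def)
    then have "a\<^sub>1 = inverse c *s a\<^sub>2" by (simp add: c)
    then have "left_span {a\<^sub>1} \<subseteq> left_span {a\<^sub>2}" "left_span {a\<^sub>2} \<subseteq> left_span {a\<^sub>1}"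
      using c left_span_singleton[of a\<^sub>1] left_span_singleton[of a\<^sub>2]
      by (metis left_span_minimal left_submodule_left_span rangeI singletonD subsetI)+
    then show ?thesis by blast
  next
    case False
    have "v l\<^sub>1 = v l\<^sub>2" using E by (simp add: v_def)
    then have k: "v l\<^sub>1 \<in> ker_hyperplane l\<^sub>1 \<inter> ker_hyperplane l\<^sub>2"
      using v0[OF nz(1)] v0[OF nz(2)] by (simp add: ker_hyperplane_def)
    let ?J = "proj_join (left_span {a\<^sub>1}) (left_span {a\<^sub>2})"
    have J: "left_submodule ?J" unfolding proj_join_def by (rule left_submodule_left_span)
    have "a\<^sub>1 \<in> ?J" "a\<^sub>2 \<in> ?J"
      unfolding proj_join_def using left_span_superset[of "{a\<^sub>1}"] left_span_superset[of "{a\<^sub>2}"]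
        left_span_superset[of "left_span {a\<^sub>1} \<union> left_span {a\<^sub>2}"] by auto
    moreover have "c *s x \<in> ?J" "x + y \<in> ?J" if "x \<in> ?J" "y \<in> ?J" for c x y
      using J that unfolding left_submodule_def by simp_all
    ultimately have "a\<^sub>2 + (- (pair a\<^sub>2 l\<^sub>1 * inverse (pair a\<^sub>1 l\<^sub>1))) *s a\<^sub>1 \<in> ?J"
      by (simp only:)
    then have "v l\<^sub>1 \<in> ?J" by (simp add: v_def vector_smult_lneg)
    then have "left_span {v l\<^sub>1} \<subseteq> ?J" using J by (intro left_span_minimal) auto
    moreover have "left_span {v l\<^sub>1} \<subseteq> ker_hyperplane l\<^sub>1 \<inter> ker_hyperplane l\<^sub>2"
      using k left_span_minimal[of "{v l\<^sub>1}", OF _ left_submodule_ker_hyperplane] by auto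
    ultimately have ?R using False unfolding proj_meets_def proj_point_iff by blast
    then show ?thesis by blast
  qed
  ultimately show ?thesis by blast
qed

text \<open>A vector avoiding the old kernels is moved in a direction \<open>e\<close> outside the
  new one. Each \<open>k\<close> forbids at most one scalar \<open>c\<close>, and an infinite ring
  offers others.\<close>

lemma avoid_kernels:
  fixes S :: "('d::division_ring ^ 'm::finite) set"
  assumes inf: "infinite (UNIV :: 'd set)" and "finite S" "0 \<notin> S"
  shows "\<exists>a. \<forall>l\<in>S. pair a l \<noteq> 0"
  using assms(2,3)
proof (induction S rule: finite_induct)
  case (insert l S)
  then obtain a where a: "\<forall>l\<in>S. pair a l \<noteq> 0" by auto
  obtain i where i: "l $ i \<noteq> 0" using insert.prems by (auto simp: vec_eq_iff)
  define e :: "'d ^ 'm" where "e = axis i 1"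
  have el: "pair e l \<noteq> 0" using i by (simp add: e_def pair_axis)
  define F where "F = (\<lambda>k. - (pair a k * inverse (pair e k))) ` (insert l S)"
  have "finite F" using insert.hyps by (simp add: F_def)
  then obtain c where c: "c \<notin> F" using inf by (metis ex_new_if_finite)
  have "pair (a + c *s e) k \<noteq> 0" if k: "k \<in> insert l S" for k
  proof
    assume "pair (a + c *s e) k = 0"
    then have 0: "pair a k + c * pair e k = 0" by simp
    show False
    proof (cases "pair e k = 0")
      case True
      then show False using 0 k a el by auto
    next
      case False
      have "c * pair e k = - pair a k" using 0 by (simp add: eq_neg_iff_add_eq_0 add.commute)
      then have "c * pair e k * inverse (pair e k) = - pair a k * inverse (pair e k)" by simp
      then have "c = - (pair a k * inverse (pair e k))" using False by (simp add: mult.assoc)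
      then show False using c k by (auto simp: F_def)
    qed
  qed
  then show ?case by blast
qed auto

text \<open>General position: any \<open>CARD('m)\<close> of the vectors \<open>a b\<close> are independent, which is
  expressed by the solvability of the linear systems with these rows.\<close>

lemma general_position:
  fixes B :: "'b set"
  assumes inf: "infinite (UNIV :: 'd::division_ring set)" and "finite B"
  shows "\<exists>a :: 'b \<Rightarrow> 'd ^ 'm::finite. \<forall>N\<subseteq>B. card N \<le> CARD('m) \<longrightarrow>
    (\<forall>x. \<exists>l. \<forall>b\<in>N. pair (a b) l = x b)"
  using assms(2)
proof (induction B rule: finite_induct)
  case (insert b B)
  then obtain a :: "'b \<Rightarrow> 'd ^ 'm" where
    a: "\<And>N x. N \<subseteq> B \<Longrightarrow> card N \<le> CARD('m) \<Longrightarrow> \<exists>l. \<forall>b\<in>N. pair (a b) l = x b" by metis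
  \<comment> \<open>For each set \<open>N\<close> of fewer than \<open>CARD('m)\<close> old vectors,
    \<open>k N\<close> is a hyperplane through them; the new vector \<open>v\<close> is taken off
    all these hyperplanes.\<close>
  define \<N> where "\<N> = {N. N \<subseteq> B \<and> card N < CARD('m)}"
  have "\<exists>l. l \<noteq> 0 \<and> (\<forall>b\<in>N. pair (a b) l = 0)" if "N \<in> \<N>" for N
  proof -
    have "finite N" using that insert.hyps(1) finite_subset by (auto simp: \<N>_def)
    then have "card (a ` N) < CARD('m)" using that card_image_le[of N a] by (auto simp: \<N>_def)
    then show ?thesis using exists_annihilator[of "a ` N"] \<open>finite N\<close> by auto
  qed
  then obtain k where k: "\<And>N. N \<in> \<N> \<Longrightarrow> k N \<noteq> 0 \<and> (\<forall>b\<in>N. pair (a b) (k N) = 0)" by metis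
  have "finite \<N>" unfolding \<N>_def using insert.hyps(1) by simp
  then obtain v where v: "\<And>N. N \<in> \<N> \<Longrightarrow> pair v (k N) \<noteq> 0"
    using avoid_kernels[OF inf, of "k ` \<N>"] k by (metis finite_imageI imageE imageI)
  define a' where "a' = a(b := v)"
  have "\<exists>l. \<forall>c\<in>N. pair (a' c) l = x c" if N: "N \<subseteq> insert b B" "card N \<le> CARD('m)" for N x
  proof (cases "b \<in> N")
    case False
    then obtain l where "\<forall>c\<in>N. pair (a c) l = x c" using a[of N x] N by blast
    then show ?thesis using False by (intro exI[of _ l]) (auto simp: a'_def)
  next
    case True
    define N' where "N' = N - {b}"
    have fN: "finite N" using N(1) insert.hyps(1) by (metis finite_insert finite_subset)
    have "card N' < card N" using True fN unfolding N'_def by (intro psubset_card_mono) auto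
    then have N': "N' \<in> \<N>" "N' \<subseteq> B" "card N' \<le> CARD('m)" using N by (auto simp: \<N>_def N'_def)
    then obtain l where l: "\<forall>c\<in>N'. pair (a c) l = x c" using a by blast
    \<comment> \<open>Adding a right multiple of \<open>k N'\<close> does not disturb the values at
      the old vectors of \<open>N'\<close>, and the factor \<open>d\<close> corrects the value at
      \<open>v\<close>.\<close>
    define d where "d = inverse (pair v (k N')) * (x b - pair v l)"
    define l' where "l' = l + (\<chi> i. k N' $ i * d)"
    have pl: "pair w l' = pair w l + pair w (k N') * d" for w by (simp add: l'_def pair_scale_right)
    have "pair v l' = x b" using v[OF N'(1)] by (simp add: pl d_def mult.assoc[symmetric])
    moreover have "pair (a c) l' = x c" if "c \<in> N'" for c using l k[OF N'(1)] that by (simp add: pl)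
    ultimately have "\<forall>c\<in>N. pair (a' c) l' = x c" by (auto simp: a'_def N'_def)
    then show ?thesis by blast
  qed
  then show ?case by blast
qed auto

section \<open>Gluing schemes of polygons\<close>

definition adj :: "'l list \<Rightarrow> ('l \<times> 'l) set" where
  "adj w = set (zip w (tl w))"

definition cyc :: "'l list \<Rightarrow> ('l \<times> 'l) set" where
  "cyc w = set (zip w (rotate1 w))"

lemma adj_simps [simp]: "adj [] = {}" "adj [a] = {}" "adj (a # b # w) = insert (a, b) (adj (b # w))"
  by (simp_all add: adj_def)

lemma adj_Cons: "w \<noteq> [] \<Longrightarrow> adj (a # w) = insert (a, hd w) (adj w)"
  by (cases w) simp_all

lemma adj_append: "v \<noteq> [] \<Longrightarrow> w \<noteq> [] \<Longrightarrow> adj (v @ w) = insert (last v, hd w) (adj v \<union> adj w)"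
  by (induction v rule: induct_list012) (auto simp: adj_Cons)

lemma adj_snoc: "w \<noteq> [] \<Longrightarrow> set (zip w (tl w @ [a])) = insert (last w, a) (adj w)"
  by (induction w rule: induct_list012) auto

lemma cyc_eq: "w \<noteq> [] \<Longrightarrow> cyc w = insert (last w, hd w) (adj w)"
  unfolding cyc_def using adj_snoc[of w "hd w"]
  by (cases w) (simp_all only: list.sel rotate1.simps not_False_eq_True list.distinct simp_thms)

lemma adj_subset: "(c, d) \<in> adj w \<Longrightarrow> c \<in> set w \<and> d \<in> set w"
  by (induction w rule: induct_list012) auto

lemma cyc_subset: "(c, d) \<in> cyc w \<Longrightarrow> c \<in> set w \<and> d \<in> set w"
  unfolding cyc_def by (auto dest: set_zip_leftD set_zip_rightD)

lemma zip_rotate1: "length v = length w \<Longrightarrow> zip (rotate1 v) (rotate1 w) = rotate1 (zip v w)"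
  by (cases v; cases w) auto

lemma cyc_rotate1: "cyc (rotate1 w) = cyc w"
  unfolding cyc_def by (subst zip_rotate1) simp_all

lemma cyc_rotate: "cyc (p @ q) = cyc (q @ p)"
proof -
  have "cyc (rotate n (p @ q)) = cyc (p @ q)" for n
    by (induction n) (simp_all add: cyc_rotate1)
  from this[of "length p"] show ?thesis by (simp add: rotate_append)
qed

lemma path_potential:
  fixes u \<mu> :: "'l \<Rightarrow> 'k::ab_group_add"
  assumes "w \<noteq> []" "\<And>c d. (c, d) \<in> adj w \<Longrightarrow> u d = u c + \<mu> c"
  shows "u (last w) + \<mu> (last w) = u (hd w) + sum_list (map \<mu> w)"
  using assms by (induction w rule: induct_list012) (auto simp: add.assoc)

text \<open>The involution splits \<open>S\<close> into pairs with equal values, and each pair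
  contributes zero by \<open>dbl\<close>.\<close>

lemma sum_involution_eq_0:
  fixes f :: "'l \<Rightarrow> 'k::ab_group_add"
  assumes dbl: "\<And>a :: 'k. a + a = 0"
    and "finite S" "\<And>x. x \<in> S \<Longrightarrow> \<alpha> x \<in> S" "\<And>x. x \<in> S \<Longrightarrow> \<alpha> x \<noteq> x" "\<And>x. \<alpha> (\<alpha> x) = x"
    "\<And>x. x \<in> S \<Longrightarrow> f (\<alpha> x) = f x"
  shows "sum f S = 0"
  using assms(2,3,4,6)
proof (induction "card S" arbitrary: S rule: less_induct)
  case less
  show ?case
  proof (cases "S = {}")
    case False
    then obtain x where x: "x \<in> S" by blast
    define S' where "S' = S - {x, \<alpha> x}"
    have S: "S = insert x (insert (\<alpha> x) S')" using x less.prems(2) by (auto simp: S'_def)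
    have "\<alpha> y \<in> S'" if "y \<in> S'" for y
      using that less.prems(2) assms(5) unfolding S'_def by (metis Diff_iff insert_iff empty_iff)
    moreover have "card S' < card S"
      unfolding S'_def using x less.prems(1) by (intro psubset_card_mono) auto
    ultimately have "sum f S' = 0"
      using less.hyps[of S'] less.prems unfolding S'_def by simp
    moreover have "sum f S = f x + (f (\<alpha> x) + sum f S')"
      using less.prems(1) less.prems(3)[of x] x unfolding S'_def
      by (subst S[unfolded S'_def]) (auto simp: sum.insert_remove)
    ultimately show ?thesis using less.prems(4)[OF x] dbl by simp
  qed simp
qed

text \<open>Words are boundaries of the polygons of a gluing scheme, with \<open>\<alpha>\<close> reversing letters, and
  \<open>cyc\<close> relates consecutive letters.  Here \<open>w\<close> is the boundary of a single polygon: either it has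
  two interleaved pairs of sides, which carry a commutator, or \<open>w\<close> can be folded up to a tree.\<close>

lemma one_polygon:
  fixes x y :: "'d::division_ring" and \<alpha> :: "'l \<Rightarrow> 'l"
  assumes \<alpha>: "\<And>d. \<alpha> (\<alpha> d) = d" "\<And>d. \<alpha> d \<noteq> d" and w: "distinct w" "\<And>d. d \<in> set w \<Longrightarrow> \<alpha> d \<in> set w"
    and xy: "x * y \<noteq> y * x" and dbl: "\<And>a :: 'k::ab_group_add. a + a = 0"
  shows "(\<exists>\<nu> :: 'l \<Rightarrow> 'd. (\<forall>d. \<nu> d \<noteq> 0 \<and> \<nu> (\<alpha> d) = inverse (\<nu> d)) \<and> prod_list (map \<nu> w) \<noteq> 1) \<or>
    (\<forall>\<mu> :: 'l \<Rightarrow> 'k::ab_group_add. (\<forall>d\<in>set w. \<mu> (\<alpha> d) = \<mu> d) \<longrightarrow>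
      (\<exists>u. (\<forall>(d, d')\<in>cyc w. u d' = u d + \<mu> d) \<and> (\<forall>d d'. (\<alpha> d, d') \<in> cyc w \<longrightarrow> u d' = u d)))"
proof (cases "\<exists>d e p q r s t. w = p @ d # q @ e # r @ \<alpha> d # s @ \<alpha> e # t")
  case True
  then obtain d e p q r s t where split: "w = p @ d # q @ e # r @ \<alpha> d # s @ \<alpha> e # t" by blast
  \<comment> \<open>Along \<open>w\<close> the nontrivial labels appear in the order
    \<open>x\<close>, \<open>y\<close>, \<open>inverse x\<close>, \<open>inverse y\<close>,
    precisely because the two pairs interleave.\<close>
  define \<nu> where "\<nu> c = (if c = d then x else if c = \<alpha> d then inverse x
      else if c = e then y else if c = \<alpha> e then inverse y else 1)" for c
  have xy0: "x \<noteq> 0" "y \<noteq> 0" using xy by auto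
  have ne: "d \<noteq> e" "d \<noteq> \<alpha> e" "\<alpha> d \<noteq> e" "\<alpha> d \<noteq> \<alpha> e" "d \<noteq> \<alpha> d" "e \<noteq> \<alpha> e" using w(1) unfolding split by auto
  have inv: "\<nu> c \<noteq> 0 \<and> \<nu> (\<alpha> c) = inverse (\<nu> c)" for c
  proof -
    have "\<alpha> c = d \<longleftrightarrow> c = \<alpha> d" "\<alpha> c = e \<longleftrightarrow> c = \<alpha> e" "\<alpha> c = \<alpha> d \<longleftrightarrow> c = d" "\<alpha> c = \<alpha> e \<longleftrightarrow> c = e"
      using \<alpha>(1) by metis+
    then show ?thesis using xy0 ne by (auto simp: \<nu>_def)
  qed
  have one: "prod_list (map \<nu> v) = 1" if "set v \<inter> {d, \<alpha> d, e, \<alpha> e} = {}" for v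
    using that by (induction v) (auto simp: \<nu>_def)
  have "prod_list (map \<nu> w) = \<nu> d * (\<nu> e * (\<nu> (\<alpha> d) * \<nu> (\<alpha> e)))"
    using w(1) unfolding split by (simp add: one)
  then have "prod_list (map \<nu> w) = x * (y * (inverse x * inverse y))"
    using ne by (simp add: \<nu>_def)
  moreover have "x * (y * (inverse x * inverse y)) \<noteq> 1"
  proof
    assume "x * (y * (inverse x * inverse y)) = 1"
    then have "x * y * inverse (y * x) = 1"
      using xy0 by (simp add: nonzero_inverse_mult_distrib mult.assoc)
    then have "x * y * inverse (y * x) * (y * x) = y * x" by simp
    then show False using xy xy0 by (simp add: mult.assoc)
  qed
  ultimately have "prod_list (map \<nu> w) \<noteq> 1" by simp
  then show ?thesis by (intro disjI1 exI[of _ \<nu>] conjI allI inv)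
next
  case False
  \<comment> \<open>A partner outside the segment would interleave with the pair of
    \<open>d\<close>. If it precedes \<open>d\<close>, the two pairs exchange their roles.\<close>
  have closed: "\<alpha> e \<in> set q" if sp: "w = p @ d # q @ \<alpha> d # r" and e: "e \<in> set q" for p d q r e
  proof (rule ccontr)
    assume n: "\<alpha> e \<notin> set q"
    obtain q1 q2 where q: "q = q1 @ e # q2" using e by (meson split_list)
    have "e \<in> set w" using e unfolding sp by simp
    then have "\<alpha> e \<in> set p \<union> {d} \<union> set q \<union> {\<alpha> d} \<union> set r" using w(2)[of e] unfolding sp by auto
    moreover have "e \<noteq> d" "e \<noteq> \<alpha> d" using w(1) e unfolding sp by auto
    then have "\<alpha> e \<noteq> d" "\<alpha> e \<noteq> \<alpha> d" using \<alpha>(1) by metis+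
    ultimately have "\<alpha> e \<in> set p \<or> \<alpha> e \<in> set r" using n by blast
    then show False
    proof
      assume "\<alpha> e \<in> set r"
      then obtain r1 r2 where "r = r1 @ \<alpha> e # r2" by (meson split_list)
      then have "w = p @ d # q1 @ e # q2 @ \<alpha> d # r1 @ \<alpha> e # r2" using sp q by simp
      then show False using False by blast
    next
      assume "\<alpha> e \<in> set p"
      then obtain p1 p2 where "p = p1 @ \<alpha> e # p2" by (meson split_list)
      then have "w = p1 @ \<alpha> e # p2 @ d # q1 @ \<alpha> (\<alpha> e) # q2 @ \<alpha> d # r" using sp q \<alpha>(1) by simp
      then show False using False by blast
    qed
  qed
  have "\<exists>u. (\<forall>(d, d')\<in>cyc w. u d' = u d + \<mu> d) \<and> (\<forall>d d'. (\<alpha> d, d') \<in> cyc w \<longrightarrow> u d' = u d)"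
    if \<mu>: "\<forall>d\<in>set w. \<mu> (\<alpha> d) = \<mu> d" for \<mu> :: "'l \<Rightarrow> 'k::ab_group_add"
  proof -
    \<comment> \<open>The potential of a letter is the sum of the labels read before it. This closes
      up around the cycle because the labels of \<open>w\<close> cancel in pairs.\<close>
    define u where "u d = sum_list (map \<mu> (takeWhile (\<lambda>c. c \<noteq> d) w))" for d
    have zero: "sum_list (map \<mu> v) = 0"
      if "set v \<subseteq> set w" "distinct v" "\<And>e. e \<in> set v \<Longrightarrow> \<alpha> e \<in> set v" for v
      using sum_involution_eq_0[OF dbl, of "set v" \<alpha> \<mu>] that \<mu> \<alpha> by (auto simp: sum_list_distinct_conv_sum_set)
    have u: "u d = sum_list (map \<mu> p)" if "w = p @ d # r" for p d r
    proof -
      have "takeWhile (\<lambda>c. c \<noteq> d) w = p" using that w(1) by (simp add: takeWhile_tail takeWhile_append)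
      then show ?thesis by (simp add: u_def)
    qed
    have step: "u d' = u d + \<mu> d" if "(d, d') \<in> cyc w" for d d'
    proof -
      have "w \<noteq> []" using that by (auto simp: cyc_def)
      have "\<exists>p r. v = p @ d # d' # r" if "(d, d') \<in> adj v" for v
        using that
      proof (induction v rule: induct_list012)
        case (3 a b v)
        then show ?case by (auto intro: exI[of _ "[]"] exI[of _ "a # _"]) (metis append_Cons)+
      qed auto
      from this[of w] consider p r where "w = p @ d # d' # r" | "d = last w" "d' = hd w"
        using \<open>(d, d') \<in> cyc w\<close> \<open>w \<noteq> []\<close> unfolding cyc_eq[OF \<open>w \<noteq> []\<close>] by blast
      then show ?thesis
      proof cases
        case 1
        then show ?thesis using u[of p d "d' # r"] u[of "p @ [d]" d' r] by simp
      next
        case 2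
        have "w = butlast w @ [d]" "w = [] @ d' # tl w" using 2 \<open>w \<noteq> []\<close> by simp_all
        then have "u d = sum_list (map \<mu> (butlast w))" "u d' = sum_list (map \<mu> [])" by (blast intro: u)+
        moreover have "sum_list (map \<mu> w) = 0" using zero[of w] w by simp
        moreover have "sum_list (map \<mu> (butlast w @ [d])) = sum_list (map \<mu> w)"
          using 2 \<open>w \<noteq> []\<close> by simp
        ultimately have "u d + \<mu> d = 0" "u d' = 0" by simp_all
        then show ?thesis by simp
      qed
    qed
    \<comment> \<open>The letters strictly between \<open>d\<close> and \<open>\<alpha> d\<close>
      cancel in pairs by \<open>closed\<close>, so only the label of the first of the two letters
      remains.\<close>
    have opp: "u (\<alpha> d) = u d + \<mu> d" if "d \<in> set w" for d
    proof -
      have *: "u (\<alpha> d) = u d + \<mu> d" if sp: "w = p @ d # q @ \<alpha> d # r" for p q d r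
      proof -
        have "sum_list (map \<mu> q) = 0" using zero[of q] closed[OF sp] w(1) unfolding sp by auto
        moreover have "u (\<alpha> d) = sum_list (map \<mu> (p @ d # q))" using u[of "p @ d # q" "\<alpha> d" r] sp by simp
        ultimately show ?thesis using u[OF sp] by simp
      qed
      obtain p r where pr: "w = p @ d # r" using split_list[OF \<open>d \<in> set w\<close>] by blast
      have "\<alpha> d \<in> set p \<or> \<alpha> d \<in> set r" using w(2)[OF that] \<alpha>(2)[of d] pr by auto
      then show ?thesis
      proof
        assume "\<alpha> d \<in> set r"
        then obtain r1 r2 where "r = r1 @ \<alpha> d # r2" by (meson split_list)
        then show ?thesis using *[of p d r1 r2] pr by simp
      next
        assume "\<alpha> d \<in> set p"
        then obtain p1 p2 where "p = p1 @ \<alpha> d # p2" by (meson split_list)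
        then have "u d = u (\<alpha> d) + \<mu> (\<alpha> d)" using *[of p1 "\<alpha> d" p2 r] pr \<alpha>(1) by simp
        then show ?thesis using \<mu> \<open>d \<in> set w\<close> dbl by (simp add: add.assoc)
      qed
    qed
    \<comment> \<open>The letter after \<open>\<alpha> d\<close> starts at the initial vertex of
      \<open>d\<close>; going along \<open>d\<close> and back adds its label twice, hence
      nothing.\<close>
    have "u d' = u d" if "(\<alpha> d, d') \<in> cyc w" for d d'
    proof -
      have d: "d \<in> set w" using cyc_subset[OF that] w(2) \<alpha>(1) by metis
      have "u d' = u d + \<mu> d + \<mu> (\<alpha> d)" using step[OF that] opp[OF d] by simp
      then show ?thesis using \<mu> d dbl by (simp add: add.assoc)
    qed
    then show ?thesis using step by (intro exI[of _ u]) auto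
  qed
  then show ?thesis by blast
qed

text \<open>Moving a prefix to the end conjugates the product, so the condition on a boundary word
  does not depend on its first letter.\<close>

lemma prod_list_rotate_eq_1:
  fixes a b :: "'d::division_ring list"
  shows "prod_list (a @ b) = 1 \<longleftrightarrow> prod_list (b @ a) = 1"
proof -
  have "q * p = 1" if "p * q = 1" for p q :: 'd
  proof -
    have "p \<noteq> 0" using that by auto
    moreover have "p * (q * p) = p * 1" using that by (simp add: mult.assoc[symmetric])
    ultimately show ?thesis by (simp only: mult_cancel_left) simp
  qed
  then show ?thesis by auto
qed

text \<open>The second alternative says that every closed labelling is exact, with potential \<open>u\<close>; the
  potential lives on letters, standing for their initial vertices.  In the induction, two polygons
  are merged along a common side.\<close>

lemma gluing_scheme:
  fixes x y :: "'d::division_ring" and \<alpha> :: "'l \<Rightarrow> 'l"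
  assumes \<alpha>: "\<And>d. \<alpha> (\<alpha> d) = d" "\<And>d. \<alpha> d \<noteq> d" and xy: "x * y \<noteq> y * x"
    and dbl: "\<And>a :: 'k::ab_group_add. a + a = 0"
    and "distinct (concat (w # W))" "\<And>d. d \<in> set (concat (w # W)) \<Longrightarrow> \<alpha> d \<in> set (concat (w # W))"
    and "\<And>v. v \<in> set (w # W) \<Longrightarrow> v \<noteq> [] \<and> even (length v)"
    and "\<And>A. A \<subset> set (w # W) \<Longrightarrow> w \<in> A \<Longrightarrow> \<exists>v\<in>A. \<exists>d\<in>set v. \<alpha> d \<notin> \<Union>(set ` A)"
  shows "(\<exists>\<nu> :: 'l \<Rightarrow> 'd. (\<forall>d. \<nu> d \<noteq> 0 \<and> \<nu> (\<alpha> d) = inverse (\<nu> d)) \<and>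
      (\<forall>v\<in>set W. prod_list (map \<nu> v) = 1) \<and> prod_list (map \<nu> w) \<noteq> 1) \<or>
    (\<forall>\<mu> :: 'l \<Rightarrow> 'k::ab_group_add. (\<forall>d. \<mu> (\<alpha> d) = \<mu> d) \<and> (\<forall>v\<in>set (w # W). sum_list (map \<mu> v) = 0) \<longrightarrow>
      (\<exists>u. \<forall>v\<in>set (w # W). (\<forall>(d, d')\<in>cyc v. u d' = u d + \<mu> d) \<and> (\<forall>d d'. (\<alpha> d, d') \<in> cyc v \<longrightarrow> u d' = u d)))"
  using assms(5-)
proof (induction "length W" arbitrary: w W)
  case 0
  then show ?case using one_polygon[OF \<alpha>, of w x y, OF _ _ xy dbl] by auto
next
  case (Suc n)
  have "W \<noteq> []" using Suc.hyps(2) by auto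
  have ne: "v \<noteq> []" if "v \<in> set (w # W)" for v using Suc.prems(3) that by blast
  have wW: "w \<notin> set W"
  proof
    assume "w \<in> set W"
    then have sub: "set w \<subseteq> set (concat W)" by auto
    have "set w \<inter> set (concat W) = {}" using Suc.prems(1) by simp
    then have "set w = {}" unfolding Int_absorb2[OF sub] .
    then show False using ne[of w] by simp
  qed
  \<comment> \<open>The last hypothesis, applied to \<open>w\<close> alone, provides a side along
    which a neighbour can be merged into it.\<close>
  have "{w} \<subset> set (w # W)" using wW hd_in_set[OF \<open>W \<noteq> []\<close>] by auto
  then obtain d where d: "d \<in> set w" "\<alpha> d \<notin> set w" using Suc.prems(4)[of "{w}"] by auto
  then have "\<alpha> d \<in> set (concat W)" using Suc.prems(2)[of d] by simp
  then obtain w1 where w1: "w1 \<in> set W" "\<alpha> d \<in> set w1" by auto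
  obtain W1 W2 where W: "W = W1 @ w1 # W2" using w1(1) by (meson split_list)
  obtain p s where w: "w = p @ d # s" using d(1) by (meson split_list)
  obtain p1 s1 where w1s: "w1 = p1 @ \<alpha> d # s1" using w1(2) by (meson split_list)
  define a b where "a = s @ p" and "b = s1 @ p1"
  define V where "V = W1 @ W2"
  have len: "even (length w)" "even (length w1)" using Suc.prems(3) w1(1) by auto
  \<comment> \<open>A nonempty even word keeps a letter when the common side is removed, and the
    merged word is even again. Below, \<open>hd b\<close> and \<open>hd a\<close> stand for the two
    end points of the common side.\<close>
  have ab: "a \<noteq> []" "b \<noteq> []" using len by (auto simp: w w1s a_def b_def)
  have cw: "cyc w = cyc (d # a)" "cyc w1 = cyc (\<alpha> d # b)"
    using cyc_rotate[of p "d # s"] cyc_rotate[of p1 "\<alpha> d # s1"] by (simp_all add: w w1s a_def b_def)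
  have sw: "set w = insert d (set a)" "set w1 = insert (\<alpha> d) (set b)" by (auto simp: w w1s a_def b_def)
  have dist: "distinct (d # \<alpha> d # a @ b @ concat V)"
  proof -
    have "mset (d # \<alpha> d # a @ b @ concat V) = mset (concat (w # W))"
      by (simp add: W w w1s a_def b_def V_def)
    then show ?thesis using Suc.prems(1) by (metis mset_eq_imp_distinct_iff)
  qed
  have setU: "set (concat (w # W)) = insert d (insert (\<alpha> d) (set (concat ((a @ b) # V))))"
    by (auto simp: W w w1s a_def b_def V_def)
  have V: "d \<notin> set v" "\<alpha> d \<notin> set v" if "v \<in> set V" for v using dist that by auto
  have h1: "n = length V" using Suc.hyps(2) by (simp add: W V_def)
  have h2: "distinct (concat ((a @ b) # V))" using dist by simp
  have h3: "\<alpha> c \<in> set (concat ((a @ b) # V))" if c: "c \<in> set (concat ((a @ b) # V))" for c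
  proof -
    have "c \<noteq> d" "c \<noteq> \<alpha> d" using c dist by auto
    then have "\<alpha> c \<noteq> d" "\<alpha> c \<noteq> \<alpha> d" using \<alpha>(1) by metis+
    moreover have "\<alpha> c \<in> set (concat (w # W))" using Suc.prems(2) c unfolding setU by blast
    ultimately show ?thesis unfolding setU by blast
  qed
  have h4: "v \<noteq> [] \<and> even (length v)" if "v \<in> set ((a @ b) # V)" for v
  proof -
    have "length w = Suc (length a)" "length w1 = Suc (length b)" by (simp_all add: w w1s a_def b_def)
    then have "even (length (a @ b))" using len by simp
    moreover have "set V \<subseteq> set (w # W)" by (auto simp: V_def W)
    ultimately show ?thesis using that Suc.prems(3)[of v] ab by auto
  qed
  have h5: "\<exists>v\<in>A. \<exists>c\<in>set v. \<alpha> c \<notin> \<Union>(set ` A)" if A: "A \<subset> set ((a @ b) # V)" "a @ b \<in> A" for A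
  proof -
    \<comment> \<open>A set containing the merged polygon is pulled back by putting \<open>w\<close>
      and \<open>w1\<close> in its place. Both glued letters are then present, so the unpaired
      letter obtained is an old one.\<close>
    define A' where "A' = (A - {a @ b}) \<union> {w, w1}"
    have nV: "a @ b \<notin> set V" using dist ab by (cases a) auto
    have AV: "A - {a @ b} \<subset> set V" using A nV by auto
    have "w \<notin> set V" "w1 \<notin> set V" using V sw by auto
    then have "A' \<subset> set (w # W)" using AV unfolding A'_def W V_def by auto
    then obtain v c where v: "v \<in> A'" "c \<in> set v" "\<alpha> c \<notin> \<Union>(set ` A')"
      using Suc.prems(4)[of A'] by (auto simp: A'_def)
    have U: "\<Union>(set ` A') = insert d (insert (\<alpha> d) (\<Union>(set ` A)))"
      using A(2) sw by (auto simp: A'_def)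
    have "c \<noteq> d" "c \<noteq> \<alpha> d" using v(3) \<alpha>(1) unfolding U by auto
    then have "c \<in> \<Union>(set ` A)" using v U by blast
    then show ?thesis using v(3) unfolding U by blast
  qed
  note IH = Suc.hyps(1)[OF h1 h2 h3 h4 h5]
  have dab: "d \<notin> set a" "d \<notin> set b" "\<alpha> d \<notin> set a" "\<alpha> d \<notin> set b" using dist by auto
  show ?case
    using IH
  proof
    assume "\<exists>\<nu>. (\<forall>d. \<nu> d \<noteq> 0 \<and> \<nu> (\<alpha> d) = inverse (\<nu> d)) \<and>
      (\<forall>v\<in>set V. prod_list (map \<nu> v) = (1::'d)) \<and> prod_list (map \<nu> (a @ b)) \<noteq> 1"
    then obtain \<nu> :: "'l \<Rightarrow> 'd" where \<nu>: "\<And>d. \<nu> d \<noteq> 0" "\<And>d. \<nu> (\<alpha> d) = inverse (\<nu> d)"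
      "\<And>v. v \<in> set V \<Longrightarrow> prod_list (map \<nu> v) = 1" "prod_list (map \<nu> (a @ b)) \<noteq> 1" by blast
    \<comment> \<open>The common side receives the label that makes the product along
      \<open>w1\<close> trivial; up to rotation, the product along \<open>w\<close> then becomes
      that of the merged word.\<close>
    define P where "P = prod_list (map \<nu> b)"
    have P0: "P \<noteq> 0" using \<nu>(1) by (auto simp: P_def prod_list_zero_iff)
    define \<kappa> where "\<kappa> = \<nu>(d := P, \<alpha> d := inverse P)"
    have eq: "map \<kappa> v = map \<nu> v" if "d \<notin> set v" "\<alpha> d \<notin> set v" for v
      using that by (auto simp: \<kappa>_def)
    have \<kappa>d: "\<kappa> d = P" "\<kappa> (\<alpha> d) = inverse P" using \<alpha>(2)[of d] by (auto simp: \<kappa>_def)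
    have "\<kappa> c \<noteq> 0 \<and> \<kappa> (\<alpha> c) = inverse (\<kappa> c)" for c
    proof -
      have "\<alpha> c = d \<longleftrightarrow> c = \<alpha> d" "\<alpha> c = \<alpha> d \<longleftrightarrow> c = d" using \<alpha>(1) by metis+
      then show ?thesis using \<nu>(1,2) P0 \<alpha>(2)[of d] \<alpha>(2)[of c] by (auto simp: \<kappa>_def)
    qed
    then have h1: "\<forall>c. \<kappa> c \<noteq> 0 \<and> \<kappa> (\<alpha> c) = inverse (\<kappa> c)" by blast
    have h2: "prod_list (map \<kappa> v) = 1" if "v \<in> set W" for v
    proof (cases "v = w1")
      case True
      have "prod_list (map \<kappa> (\<alpha> d # s1) @ map \<kappa> p1) = \<kappa> (\<alpha> d) * prod_list (map \<kappa> b)"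
        by (simp add: b_def mult.assoc)
      also have "\<dots> = 1" unfolding \<kappa>d eq[OF dab(2,4)] P_def[symmetric] using P0 by simp
      finally have "prod_list (map \<kappa> p1 @ map \<kappa> (\<alpha> d # s1)) = 1" by (subst prod_list_rotate_eq_1)
      then show ?thesis by (simp add: True w1s)
    next
      case False
      then have "v \<in> set V" using that by (auto simp: W V_def)
      then show ?thesis using \<nu>(3) eq[OF V(1,2)] by (simp only:)
    qed
    have h3: "prod_list (map \<kappa> w) \<noteq> 1"
    proof
      assume "prod_list (map \<kappa> w) = 1"
      then have "prod_list (map \<kappa> p @ map \<kappa> (d # s)) = 1" by (simp add: w)
      then have "prod_list (map \<kappa> (d # s) @ map \<kappa> p) = 1" by (subst prod_list_rotate_eq_1)
      then have "\<kappa> d * prod_list (map \<kappa> a) = 1" by (simp add: a_def mult.assoc)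
      then have "prod_list (map \<nu> b @ map \<nu> a) = 1" using eq[OF dab(1,3)] by (simp add: \<kappa>d P_def)
      then have "prod_list (map \<nu> a @ map \<nu> b) = 1" by (subst prod_list_rotate_eq_1)
      then show False using \<nu>(4) by simp
    qed
    show ?thesis using h1 h3 by (intro disjI1 exI[of _ \<kappa>] conjI) (auto intro: h2)
  next
    assume R: "\<forall>\<mu> :: 'l \<Rightarrow> 'k::ab_group_add. (\<forall>d. \<mu> (\<alpha> d) = \<mu> d) \<and> (\<forall>v\<in>set ((a @ b) # V). sum_list (map \<mu> v) = 0) \<longrightarrow>
      (\<exists>u. \<forall>v\<in>set ((a @ b) # V). (\<forall>(d, d')\<in>cyc v. u d' = u d + \<mu> d) \<and> (\<forall>d d'. (\<alpha> d, d') \<in> cyc v \<longrightarrow> u d' = u d))"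
    have "\<exists>u. \<forall>v\<in>set (w # W). (\<forall>(d, d')\<in>cyc v. u d' = u d + \<mu> d) \<and> (\<forall>d d'. (\<alpha> d, d') \<in> cyc v \<longrightarrow> u d' = u d)"
      if \<mu>: "\<forall>d. \<mu> (\<alpha> d) = \<mu> d" "\<forall>v\<in>set (w # W). sum_list (map \<mu> v) = 0" for \<mu> :: "'l \<Rightarrow> 'k::ab_group_add"
    proof -
      have dbl2: "x + (x + y) = y" for x y :: 'k by (simp add: dbl flip: add.assoc)
      have "sum_list (map \<mu> w) = \<mu> d + sum_list (map \<mu> a)"
        by (simp add: w a_def ac_simps)
      then have sa: "\<mu> d + sum_list (map \<mu> a) = 0" using \<mu>(2) by simp
      have "sum_list (map \<mu> w1) = \<mu> (\<alpha> d) + sum_list (map \<mu> b)"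
        by (simp add: w1s b_def ac_simps)
      then have sb: "\<mu> d + sum_list (map \<mu> b) = 0" using \<mu> w1(1) by simp
      have neg: "r = t" if "q + r = 0" "q + t = 0" for q r t :: 'k using that by (metis add_left_cancel)
      have "sum_list (map \<mu> (a @ b)) = 0" using neg[OF sa sb] by (simp add: dbl)
      moreover have "sum_list (map \<mu> v) = 0" if "v \<in> set V" for v using \<mu>(2) that by (auto simp: V_def W)
      ultimately obtain u where u: "\<And>v c c'. v \<in> set ((a @ b) # V) \<Longrightarrow> (c, c') \<in> cyc v \<Longrightarrow> u c' = u c + \<mu> c"
        "\<And>v c c'. v \<in> set ((a @ b) # V) \<Longrightarrow> (\<alpha> c, c') \<in> cyc v \<Longrightarrow> u c' = u c"
        using R \<mu>(1) by (elim allE[of _ \<mu>]) fastforce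
      have cab: "cyc (a @ b) = insert (last b, hd a) (insert (last a, hd b) (adj a \<union> adj b))"
        using ab by (simp add: cyc_eq adj_append)
      have cda: "cyc (d # a) = insert (last a, d) (insert (d, hd a) (adj a))"
        "cyc (\<alpha> d # b) = insert (last b, \<alpha> d) (insert (\<alpha> d, hd b) (adj b))"
        using ab by (simp_all add: cyc_eq adj_Cons)
      \<comment> \<open>Walking along \<open>b\<close> compares the potentials at the two ends of
        the common side; they differ by its label because \<open>\<mu>\<close> sums to zero along
        \<open>w1\<close>.\<close>
      have "u (last b) + \<mu> (last b) = u (hd b) + sum_list (map \<mu> b)"
        using ab u(1)[of "a @ b"] by (intro path_potential) (auto simp: cab)
      moreover have "u (hd a) = u (last b) + \<mu> (last b)" using u(1)[of "a @ b"] by (simp add: cab)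
      moreover have "sum_list (map \<mu> b) = \<mu> d" using neg[OF _ sb, of "\<mu> d"] dbl by simp
      ultimately have hab: "u (hd a) = u (hd b) + \<mu> d" by simp
      have hba: "u (hd b) = u (hd a) + \<mu> d" by (simp add: hab add.assoc dbl)
      \<comment> \<open>The letter \<open>d\<close> starts where \<open>\<alpha> d\<close> ends,
        that is, where \<open>b\<close> begins; \<open>\<alpha> d\<close> starts where
        \<open>a\<close> begins.\<close>
      define u' where "u' = u(d := u (hd b), \<alpha> d := u (hd a))"
      have u'd: "u' d = u (hd b)" "u' (\<alpha> d) = u (hd a)" using \<alpha>(2)[of d] by (auto simp: u'_def)
      have u'e: "u' c = u c" if "c \<noteq> d" "c \<noteq> \<alpha> d" for c using that by (simp add: u'_def)
      have u'a: "u' c = u c" if "c \<in> set a \<union> set b" for c using u'e[of c] dab that by blast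
      have lh: "last a \<in> set a" "hd a \<in> set a" "last b \<in> set b" "hd b \<in> set b" using ab by simp_all
      have u'lh: "u' (last a) = u (last a)" "u' (hd a) = u (hd a)" "u' (last b) = u (last b)" "u' (hd b) = u (hd b)"
        using lh u'a by blast+
      have adjab: "u' c' = u' c + \<mu> c" if "(c, c') \<in> adj a \<union> adj b" for c c'
        using u(1)[of "a @ b" c c'] that adj_subset[of c c'] u'a by (fastforce simp: cab)
      have adjab': "u' c' = u' c" if cc: "(\<alpha> c, c') \<in> adj a \<union> adj b" for c c'
      proof -
        have "\<alpha> c \<in> set a \<union> set b" "c' \<in> set a \<union> set b" using adj_subset cc by fastforce+
        moreover from this have "c \<noteq> d" "c \<noteq> \<alpha> d" using dab \<alpha>(1) by auto
        ultimately show ?thesis using u(2)[of "a @ b" c c'] cc u'a u'e by (auto simp: cab)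
      qed
      have last_c: "c \<noteq> d \<and> c \<noteq> \<alpha> d" if "\<alpha> c = last a \<or> \<alpha> c = last b" for c
        using that lh dab \<alpha>(1) by metis
      have g1: "u' c' = u' c + \<mu> c" if hc: "(c, c') \<in> cyc w \<union> cyc w1" for c c'
      proof -
        consider "(c, c') \<in> adj a \<union> adj b" | "c = last a" "c' = d" | "c = d" "c' = hd a"
          | "c = last b" "c' = \<alpha> d" | "c = \<alpha> d" "c' = hd b"
          using hc unfolding cw cda by blast
        then show ?thesis
        proof cases
          case 1
          then show ?thesis by (rule adjab)
        next
          case 2
          then show ?thesis using u(1)[of "a @ b" "last a" "hd b"] by (simp add: cab u'd u'lh)
        next
          case 3
          then show ?thesis using hab by (simp add: u'd u'lh)
        next
          case 4
          then show ?thesis using u(1)[of "a @ b" "last b" "hd a"] by (simp add: cab u'd u'lh)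
        next
          case 5
          then show ?thesis using hba \<mu>(1) by (simp add: u'd u'lh)
        qed
      qed
      have g2: "u' c' = u' c" if hc: "(\<alpha> c, c') \<in> cyc w \<union> cyc w1" for c c'
      proof -
        consider "(\<alpha> c, c') \<in> adj a \<union> adj b" | "\<alpha> c = last a" "c' = d" | "\<alpha> c = d" "c' = hd a"
          | "\<alpha> c = last b" "c' = \<alpha> d" | "\<alpha> c = \<alpha> d" "c' = hd b"
          using hc unfolding cw cda by blast
        then show ?thesis
        proof cases
          case 1
          then show ?thesis by (rule adjab')
        next
          case 2
          then show ?thesis using last_c[of c] u(2)[of "a @ b" c "hd b"] by (simp add: cab u'd u'e)
        next
          case 3
          then have "c = \<alpha> d" using \<alpha>(1) by metis
          then show ?thesis using 3 by (simp add: u'd u'lh)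
        next
          case 4
          then show ?thesis using last_c[of c] u(2)[of "a @ b" c "hd a"] by (simp add: cab u'd u'e)
        next
          case 5
          then have "c = d" using \<alpha>(1) by metis
          then show ?thesis using 5 by (simp add: u'd u'lh)
        qed
      qed
      have g3: "u' c' = u' c + \<mu> c" if "v \<in> set V" "(c, c') \<in> cyc v" for v c c'
        using u(1)[of v c c'] that V[OF that(1)] cyc_subset[OF that(2)] u'e by (metis list.set_intros(2))
      have g4: "u' c' = u' c" if "v \<in> set V" "(\<alpha> c, c') \<in> cyc v" for v c c'
      proof -
        have "\<alpha> c \<noteq> d" "\<alpha> c \<noteq> \<alpha> d" "c' \<noteq> d" "c' \<noteq> \<alpha> d" using V[OF that(1)] cyc_subset[OF that(2)] by auto
        moreover from this have "c \<noteq> d" "c \<noteq> \<alpha> d" using \<alpha>(1) by auto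
        ultimately show ?thesis using u(2)[of v c c'] that u'e by simp
      qed
      have sWV: "set (w # W) = {w, w1} \<union> set V" by (auto simp: W V_def)
      have "(\<forall>(d, d')\<in>cyc v. u' d' = u' d + \<mu> d) \<and> (\<forall>d d'. (\<alpha> d, d') \<in> cyc v \<longrightarrow> u' d' = u' d)"
        if "v \<in> set (w # W)" for v
      proof (cases "v \<in> set V")
        case True
        then show ?thesis using g3 g4 by blast
      next
        case False
        then have "cyc v \<subseteq> cyc w \<union> cyc w1" using that unfolding sWV by blast
        then show ?thesis using g1 g2 by blast
      qed
      then show ?thesis by blast
    qed
    then show ?thesis by blast
  qed
qed

section \<open>Counting closed and exact labellings over the field of two elements\<close>

lemma UNIV_bit: "(UNIV :: bit set) = {0, 1}"
  by (auto simp: bit_not_zero_iff)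

lemma finite_UNIV_bit: "finite (UNIV :: bit set)"
  unfolding UNIV_bit by simp

lemma card_PiE_bit: "finite A \<Longrightarrow> card (A \<rightarrow>\<^sub>E (UNIV :: bit set)) = 2 ^ card A"
  by (simp add: card_PiE UNIV_bit numeral_2_eq_2)

text \<open>If there is no such labelling, then all closed \<open>bit\<close>-labellings of the edges are exact.  But
  there are at least \<open>2 ^ (card E - card F)\<close> closed and at most \<open>2 ^ (card Vs - 1)\<close> exact
  labellings.\<close>

lemma quadrilateral_labelling:
  fixes E :: "'e set" and Vs :: "'v set" and F :: "'f set" and bd :: "'f \<Rightarrow> ('e \<times> bool) list"
    and org :: "'e \<times> bool \<Rightarrow> 'v" and x y :: "'d::division_ring"
  assumes fin: "finite E" "finite Vs" "finite F"
    and len: "\<And>f. f \<in> F \<Longrightarrow> length (bd f) = 4"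
    and dist: "\<And>f. f \<in> F \<Longrightarrow> distinct (bd f)"
    and bdE: "\<And>f d. f \<in> F \<Longrightarrow> d \<in> set (bd f) \<Longrightarrow> fst d \<in> E"
    and cover: "\<And>d. fst d \<in> E \<Longrightarrow> \<exists>!f. f \<in> F \<and> d \<in> set (bd f)"
    and org: "\<And>d. fst d \<in> E \<Longrightarrow> org d \<in> Vs"
    and step: "\<And>f d d'. f \<in> F \<Longrightarrow> (d, d') \<in> cyc (bd f) \<Longrightarrow> org d' = org (apsnd Not d)"
    and link: "\<And>(u :: 'e \<times> bool \<Rightarrow> bit) d d'. (\<And>f d d'. f \<in> F \<Longrightarrow> (apsnd Not d, d') \<in> cyc (bd f) \<Longrightarrow> u d' = u d) \<Longrightarrow>
      fst d \<in> E \<Longrightarrow> fst d' \<in> E \<Longrightarrow> org d = org d' \<Longrightarrow> u d = u d'"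
    and conn: "\<And>A. A \<subset> F \<Longrightarrow> A \<noteq> {} \<Longrightarrow> \<exists>f\<in>A. \<exists>d\<in>set (bd f). \<forall>f'\<in>A. apsnd Not d \<notin> set (bd f')"
    and euler: "card Vs + card F \<le> card E"
    and f0: "f0 \<in> F" and xy: "x * y \<noteq> y * x"
  shows "\<exists>\<nu> :: 'e \<times> bool \<Rightarrow> 'd. (\<forall>d. \<nu> d \<noteq> 0 \<and> \<nu> (apsnd Not d) = inverse (\<nu> d)) \<and>
    (\<forall>f\<in>F - {f0}. prod_list (map \<nu> (bd f)) = 1) \<and> prod_list (map \<nu> (bd f0)) \<noteq> 1"
proof (rule ccontr)
  assume contra: "\<not> ?thesis"
  let ?\<alpha> = "apsnd Not :: 'e \<times> bool \<Rightarrow> 'e \<times> bool"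
  have \<alpha>: "?\<alpha> (?\<alpha> d) = d" "?\<alpha> d \<noteq> d" for d by (auto simp: apsnd_def prod_eq_iff)
  obtain xs where xs: "set xs = F - {f0}" "distinct xs" using fin(3) finite_distinct_list[of "F - {f0}"] by auto
  have bd_disj: "f = f'" if "f \<in> F" "f' \<in> F" "d \<in> set (bd f)" "d \<in> set (bd f')" for f f' d
    using cover[of d] bdE[of f d] that by blast
  have hdin: "hd (bd f) \<in> set (bd f)" if "f \<in> F" for f using len[OF that] by (intro hd_in_set) auto
  have inj: "inj_on bd F" using bd_disj hdin by (intro inj_onI) metis
  have setF: "set (f0 # xs) = F" using xs f0 by auto
  have dW: "distinct (concat (map bd (f0 # xs)))"
  proof (rule distinct_concat)
    show "distinct (map bd (f0 # xs))" using xs inj unfolding distinct_map setF by simp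
    show "distinct ys" if "ys \<in> set (map bd (f0 # xs))" for ys using that dist xs f0 by auto
    show "set ys \<inter> set zs = {}" if "ys \<in> set (map bd (f0 # xs))" "zs \<in> set (map bd (f0 # xs))" "ys \<noteq> zs" for ys zs
      using that bd_disj unfolding set_map setF by blast
  qed
  have setW: "set (concat (map bd (f0 # xs))) = {d. fst d \<in> E}"
  proof -
    have "set (concat (map bd (f0 # xs))) = (\<Union>f\<in>F. set (bd f))" using setF by auto
    also have "\<dots> = {d. fst d \<in> E}" using bdE cover by blast
    finally show ?thesis .
  qed
  have "(\<exists>\<nu> :: 'e \<times> bool \<Rightarrow> 'd. (\<forall>d. \<nu> d \<noteq> 0 \<and> \<nu> (?\<alpha> d) = inverse (\<nu> d)) \<and>
      (\<forall>v\<in>set (map bd xs). prod_list (map \<nu> v) = 1) \<and> prod_list (map \<nu> (bd f0)) \<noteq> 1) \<or>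
    (\<forall>\<mu> :: 'e \<times> bool \<Rightarrow> bit. (\<forall>d. \<mu> (?\<alpha> d) = \<mu> d) \<and> (\<forall>v\<in>set (bd f0 # map bd xs). sum_list (map \<mu> v) = 0) \<longrightarrow>
      (\<exists>u. \<forall>v\<in>set (bd f0 # map bd xs). (\<forall>(d, d')\<in>cyc v. u d' = u d + \<mu> d) \<and> (\<forall>d d'. (?\<alpha> d, d') \<in> cyc v \<longrightarrow> u d' = u d)))"
  proof (rule gluing_scheme[OF \<alpha> xy])
    show "a + a = 0" for a :: bit by simp
    show "distinct (concat (bd f0 # map bd xs))" using dW by simp
    show "?\<alpha> d \<in> set (concat (bd f0 # map bd xs))" if "d \<in> set (concat (bd f0 # map bd xs))" for d
    proof -
      have "set (concat (bd f0 # map bd xs)) = {d. fst d \<in> E}" using setW by (simp only: list.map)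
      then show ?thesis using that by (simp only: mem_Collect_eq fst_apsnd)
    qed
    show "v \<noteq> [] \<and> even (length v)" if "v \<in> set (bd f0 # map bd xs)" for v
    proof -
      obtain f where "f \<in> F" "v = bd f" using \<open>v \<in> _\<close> xs f0 by auto
      then show ?thesis using len[of f] by auto
    qed
    fix A assume A: "A \<subset> set (bd f0 # map bd xs)" "bd f0 \<in> A"
    define A' where "A' = {f \<in> F. bd f \<in> A}"
    have sF: "set (bd f0 # map bd xs) = bd ` F" using xs f0 by auto
    then have bA: "bd ` A' = A" using A by (auto simp: A'_def)
    then have "A' \<noteq> F" using A sF by auto
    then have "A' \<subset> F" "A' \<noteq> {}" using A f0 by (auto simp: A'_def)
    from conn[OF this] show "\<exists>v\<in>A. \<exists>d\<in>set v. ?\<alpha> d \<notin> \<Union> (set ` A)"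
      unfolding bA[symmetric] by blast
  qed
  with contra have "\<forall>\<mu> :: 'e \<times> bool \<Rightarrow> bit. (\<forall>d. \<mu> (?\<alpha> d) = \<mu> d) \<and> (\<forall>v\<in>set (bd f0 # map bd xs). sum_list (map \<mu> v) = 0) \<longrightarrow>
      (\<exists>u. \<forall>v\<in>set (bd f0 # map bd xs). (\<forall>(d, d')\<in>cyc v. u d' = u d + \<mu> d) \<and> (\<forall>d d'. (?\<alpha> d, d') \<in> cyc v \<longrightarrow> u d' = u d))"
    unfolding set_map xs by blast
  moreover have "set (bd f0 # map bd xs) = bd ` F" using xs f0 by auto
  ultimately have exact: "\<exists>u. \<forall>f\<in>F. (\<forall>(d, d')\<in>cyc (bd f). u d' = u d + \<mu> d) \<and> (\<forall>d d'. (?\<alpha> d, d') \<in> cyc (bd f) \<longrightarrow> u d' = u d)"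
    if "\<forall>d. \<mu> (?\<alpha> d) = \<mu> d" "\<forall>f\<in>F. sum_list (map \<mu> (bd f)) = 0" for \<mu> :: "'e \<times> bool \<Rightarrow> bit"
  proof -
    have "\<forall>v\<in>bd ` F. sum_list (map \<mu> v) = 0" using that(2) by simp
    with \<open>set (bd f0 # map bd xs) = bd ` F\<close> that(1)
      \<open>\<forall>\<mu>. _ \<mu> \<longrightarrow> _ \<mu>\<close>[THEN spec, of \<mu>]
    show ?thesis by (simp only: simp_thms) blast
  qed
  obtain d0 :: "'e \<times> bool" where d0: "fst d0 \<in> E" using bdE[OF f0 hdin[OF f0]] by blast
  define v0 where "v0 = org d0"
  have v0: "v0 \<in> Vs" using org d0 by (simp add: v0_def)
  define X where "X = E \<rightarrow>\<^sub>E (UNIV :: bit set)"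
  define Y where "Y = F \<rightarrow>\<^sub>E (UNIV :: bit set)"
  define S where "S \<mu> f = sum_list (map (\<lambda>d. \<mu> (fst d)) (bd f))" for \<mu> :: "'e \<Rightarrow> bit" and f
  define \<Phi> where "\<Phi> \<mu> = restrict (S \<mu>) F" for \<mu>
  define C where "C = {\<mu> \<in> X. \<forall>f\<in>F. S \<mu> f = 0}"
  \<comment> \<open>\<open>\<Phi>\<close> records the sums around the faces. Adding a chosen
    preimage of \<open>\<Phi> \<mu>\<close> makes \<open>\<mu>\<close> closed, and the result
    together with \<open>\<Phi> \<mu>\<close> determines \<open>\<mu>\<close>. This injection takes
    the place of the rank-nullity theorem.\<close>
  define G where "G \<mu> = (restrict (\<lambda>e. \<mu> e + inv_into X \<Phi> (\<Phi> \<mu>) e) E, \<Phi> \<mu>)" for \<mu>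
  have S_add: "S (restrict (\<lambda>e. \<mu> e + \<mu>' e) E) f = S \<mu> f + S \<mu>' f" if "f \<in> F" for \<mu> \<mu>' f
  proof -
    have "map (\<lambda>d. restrict (\<lambda>e. \<mu> e + \<mu>' e) E (fst d)) (bd f) = map (\<lambda>d. \<mu> (fst d) + \<mu>' (fst d)) (bd f)"
      using bdE[OF that] by simp
    then show ?thesis unfolding S_def by (simp only: sum_list_addf)
  qed
  have inv: "inv_into X \<Phi> (\<Phi> \<mu>) \<in> X" "\<Phi> (inv_into X \<Phi> (\<Phi> \<mu>)) = \<Phi> \<mu>" if "\<mu> \<in> X" for \<mu>
    by (rule inv_into_into[OF imageI[OF that]], rule f_inv_into_f[OF imageI[OF that]])
  have "inj_on G X"
  proof (rule inj_onI)
    fix \<mu> \<mu>' assume m: "\<mu> \<in> X" "\<mu>' \<in> X" "G \<mu> = G \<mu>'"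
    then have "\<Phi> \<mu> = \<Phi> \<mu>'" by (simp add: G_def)
    then have "restrict (\<lambda>e. \<mu> e + inv_into X \<Phi> (\<Phi> \<mu>) e) E = restrict (\<lambda>e. \<mu>' e + inv_into X \<Phi> (\<Phi> \<mu>) e) E"
      using m(3) by (simp add: G_def)
    then have "\<mu> e + inv_into X \<Phi> (\<Phi> \<mu>) e = \<mu>' e + inv_into X \<Phi> (\<Phi> \<mu>) e" if "e \<in> E" for e
      by (drule_tac fun_cong[of _ _ e]) (simp only: restrict_apply that if_True)
    then have "\<mu> e = \<mu>' e" if "e \<in> E" for e using that by (meson add_right_cancel)
    then show "\<mu> = \<mu>'" using m(1,2) unfolding X_def by (meson PiE_ext)
  qed
  moreover have "G ` X \<subseteq> C \<times> Y"
  proof (rule image_subsetI)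
    fix \<mu> assume m: "\<mu> \<in> X"
    have "S (restrict (\<lambda>e. \<mu> e + inv_into X \<Phi> (\<Phi> \<mu>) e) E) f = 0" if f: "f \<in> F" for f
    proof -
      have "S \<mu> f = \<Phi> \<mu> f" "S (inv_into X \<Phi> (\<Phi> \<mu>)) f = \<Phi> (inv_into X \<Phi> (\<Phi> \<mu>)) f"
        using f by (simp_all add: \<Phi>_def)
      then show ?thesis unfolding S_add[OF f] inv(2)[OF m] by simp
    qed
    then show "G \<mu> \<in> C \<times> Y" by (auto simp: G_def C_def X_def Y_def \<Phi>_def)
  qed
  moreover have "finite X" "finite Y" unfolding X_def Y_def using fin finite_UNIV_bit by (auto intro!: finite_PiE)
  then have "finite (C \<times> Y)" by (simp add: C_def)
  ultimately have "card X \<le> card C * card Y" by (metis card_inj_on_le card_cartesian_product)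
  then have le1: "2 ^ card E \<le> card C * 2 ^ card F"
    using fin by (simp add: X_def Y_def card_PiE_bit)
  \<comment> \<open>Constants do not affect coboundaries, so potentials are normalized to vanish at
    \<open>v0\<close>. The vertex saved in the exponent \<open>card Vs - 1\<close> is what
    contradicts \<open>euler\<close>.\<close>
  define z where "z u v = (if v = v0 then 0 else u v)" for u :: "'v \<Rightarrow> bit" and v
  define \<delta> where "\<delta> u = restrict (\<lambda>e. z u (org (e, True)) + z u (org (e, False))) E" for u
  have "C \<subseteq> \<delta> ` ((Vs - {v0}) \<rightarrow>\<^sub>E UNIV)"
  proof
    fix \<mu> assume m: "\<mu> \<in> C"
    then obtain u where u: "\<And>f d d'. f \<in> F \<Longrightarrow> (d, d') \<in> cyc (bd f) \<Longrightarrow> u d' = u d + \<mu> (fst d)"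
      "\<And>f d d'. f \<in> F \<Longrightarrow> (?\<alpha> d, d') \<in> cyc (bd f) \<Longrightarrow> u d' = u d"
      using exact[of "\<lambda>d. \<mu> (fst d)"] unfolding C_def S_def by fastforce
    have lnk: "u d = u d'" if "fst d \<in> E" "fst d' \<in> E" "org d = org d'" for d d'
      using link[of u d d'] u(2) that by blast
    \<comment> \<open>By \<open>link\<close> all letters issuing from a vertex have the same
      potential, so \<open>u\<close> descends to the vertices and the choice is harmless.\<close>
    define U where "U v = u (SOME d. fst d \<in> E \<and> org d = v)" for v
    have U: "U (org d) = u d" if "fst d \<in> E" for d
      using someI[of "\<lambda>d'. fst d' \<in> E \<and> org d' = org d" d] that lnk unfolding U_def by metis
    define w where "w = restrict (\<lambda>v. U v + U v0) (Vs - {v0})"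
    have zw: "z w (org d) = u d + U v0" if "fst d \<in> E" for d
    proof (cases "org d = v0")
      case True
      then have "u d = U v0" using U[OF that] by simp
      then show ?thesis using True by (simp add: z_def)
    next
      case False
      then show ?thesis using org[OF that] U[OF that] by (simp add: z_def w_def)
    qed
    have "\<mu> e = \<delta> w e" if e: "e \<in> E" for e
    proof -
      obtain f where f: "f \<in> F" "(e, True) \<in> set (bd f)" using cover[of "(e, True)"] e by auto
      then obtain i where i: "i < length (bd f)" "bd f ! i = (e, True)" by (auto simp: in_set_conv_nth)
      define d' where "d' = rotate1 (bd f) ! i"
      have "((e, True), d') \<in> cyc (bd f)"
        unfolding cyc_def d'_def using i by (auto simp: set_zip intro!: exI[of _ i])
      from u(1)[OF f(1) this] step[OF f(1) this] bdE[OF f(1), of d'] cyc_subset[OF this]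
      have "u d' = u (e, True) + \<mu> e" "org d' = org (e, False)" "fst d' \<in> E"
        by (simp_all only: apsnd_conv fst_conv simp_thms)
      then have "u (e, False) = u (e, True) + \<mu> e" using lnk[of d' "(e, False)"] e by simp
      moreover have "\<delta> w e = (u (e, True) + U v0) + (u (e, False) + U v0)"
        using e zw[of "(e, True)"] zw[of "(e, False)"] by (simp add: \<delta>_def)
      moreover have "(a + c) + ((a + b) + c) = b" for a b c :: bit
        by (cases a; cases b; cases c) simp_all
      ultimately show ?thesis by metis
    qed
    moreover have "\<mu> \<in> E \<rightarrow>\<^sub>E UNIV" "\<delta> w \<in> E \<rightarrow>\<^sub>E UNIV" using m by (simp_all add: C_def X_def \<delta>_def)
    ultimately have "\<mu> = \<delta> w" by (blast intro: PiE_ext)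
    moreover have "w \<in> (Vs - {v0}) \<rightarrow>\<^sub>E UNIV" by (simp add: w_def)
    ultimately show "\<mu> \<in> \<delta> ` ((Vs - {v0}) \<rightarrow>\<^sub>E UNIV)" by blast
  qed
  then have "card C \<le> card ((Vs - {v0}) \<rightarrow>\<^sub>E (UNIV :: bit set))"
  proof -
    have "finite ((Vs - {v0}) \<rightarrow>\<^sub>E (UNIV :: bit set))"
      using fin(2) finite_UNIV_bit by (intro finite_PiE) auto
    then show ?thesis using \<open>C \<subseteq> _\<close> by (meson card_image_le card_mono finite_imageI order.trans)
  qed
  also have "\<dots> = 2 ^ (card Vs - 1)" using fin(2) v0 by (simp add: card_PiE_bit)
  finally have "card C * 2 ^ card F \<le> 2 ^ (card Vs - 1) * 2 ^ card F" by (rule mult_le_mono1)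
  from le_trans[OF le1 this] have "(2::nat) ^ card E \<le> 2 ^ (card Vs - 1 + card F)"
    by (simp only: power_add)
  then have "card E \<le> card Vs - 1 + card F" by simp
  moreover have "card Vs > 0" using v0 fin(2) by (auto simp: card_gt_0_iff)
  ultimately show False using euler by linarith
qed

section \<open>Local degree of maps from the plane to a surface\<close>

text \<open>Loops with equal winding number are homotopic in the punctured plane, but the homotopy
  may leave the ball on which \<open>g\<close> is controlled. The radial retraction \<open>R\<close>
  brings it back without moving the loops themselves.\<close>

lemma winding_number_compose:
  fixes g :: "complex \<Rightarrow> complex"
  assumes g: "continuous_on (ball c e) g" "inj_on g (ball c e)"
    and p: "path p" "pathfinish p = pathstart p" "path_image p \<subseteq> ball c e - {c}"
    and q: "path q" "pathfinish q = pathstart q" "path_image q \<subseteq> ball c e - {c}"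
    and eq: "winding_number p c = winding_number q c"
  shows "winding_number (g \<circ> p) (g c) = winding_number (g \<circ> q) (g c)"
proof -
  have "compact (path_image p \<union> path_image q)" using p(1) q(1) by (simp add: compact_Un compact_path_image)
  then have "compact ((\<lambda>w. dist c w) ` (path_image p \<union> path_image q))"
    by (intro compact_continuous_image continuous_intros)
  moreover have "(\<lambda>w. dist c w) ` (path_image p \<union> path_image q) \<noteq> {}" by simp
  ultimately obtain s where s: "s \<in> (\<lambda>w. dist c w) ` (path_image p \<union> path_image q)"
    "\<And>t. t \<in> (\<lambda>w. dist c w) ` (path_image p \<union> path_image q) \<Longrightarrow> t \<le> s"
    using compact_attains_sup by metis
  have s0: "0 < s" "s < e" using s(1) p(3) q(3) by auto
  \<comment> \<open>Both loops stay within distance \<open>s\<close> of \<open>c\<close>, where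
    \<open>R\<close> is the identity; all farther points are pushed radially onto the circle of
    radius \<open>s\<close>.\<close>
  define R where "R w = c + of_real (min 1 (s / norm (w - c))) * (w - c)" for w
  have R_id: "R w = w" if "dist c w \<le> s" "w \<noteq> c" for w
  proof -
    have "1 \<le> s / norm (w - c)" using that by (simp add: dist_norm norm_minus_commute le_divide_eq)
    then show ?thesis by (simp add: R_def)
  qed
  have contR: "continuous_on (- {c}) R"
    unfolding R_def by (intro continuous_intros) auto
  have R_ball: "R w \<in> ball c e - {c}" if "w \<noteq> c" for w
  proof -
    have pos: "min 1 (s / norm (w - c)) > 0" using that s0 by simp
    have "norm (R w - c) = min 1 (s / norm (w - c)) * norm (w - c)"
      using pos by (simp add: R_def norm_mult del: min_less_iff_conj)
    also have "\<dots> \<le> s / norm (w - c) * norm (w - c)" by (intro mult_right_mono) auto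
    also have "\<dots> = s" using that by simp
    finally have "norm (R w - c) < e" using s0 by simp
    moreover have "R w \<noteq> c" using pos that by (simp add: R_def)
    ultimately show ?thesis by (simp add: dist_norm norm_minus_commute)
  qed
  have "homotopic_loops (- {c}) p q"
    using winding_number_homotopic_loops_eq[OF p(1) _ q(1) _ p(2) q(2), of c] p(3) q(3) eq by blast
  moreover have "continuous_on (- {c}) (g \<circ> R)"
    by (intro continuous_on_compose contR continuous_on_subset[OF g(1)]) (use R_ball in blast)
  moreover have "c \<in> ball c e" using s0 by simp
  then have "(g \<circ> R) w \<noteq> g c" if "w \<noteq> c" for w
    using R_ball[OF that] inj_onD[OF g(2), of "R w" c] by auto
  then have "g \<circ> R \<in> - {c} \<rightarrow> - {g c}" by auto
  ultimately have "homotopic_loops (- {g c}) ((g \<circ> R) \<circ> p) ((g \<circ> R) \<circ> q)"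
    by (rule homotopic_loops_continuous_image)
  then have "winding_number ((g \<circ> R) \<circ> p) (g c) = winding_number ((g \<circ> R) \<circ> q) (g c)"
    by (rule winding_number_homotopic_loops)
  moreover have "winding_number ((g \<circ> R) \<circ> p) (g c) = winding_number (g \<circ> p) (g c)"
  proof (rule winding_number_cong)
    fix t :: real assume "0 \<le> t" "t \<le> 1"
    then have "p t \<in> path_image p" by (simp add: path_image_def)
    then have "dist c (p t) \<le> s" "p t \<noteq> c" using s(2) p(3) by blast+
    then show "((g \<circ> R) \<circ> p) t = (g \<circ> p) t" using R_id[of "p t"] by simp
  qed
  moreover have "winding_number ((g \<circ> R) \<circ> q) (g c) = winding_number (g \<circ> q) (g c)"
  proof (rule winding_number_cong)
    fix t :: real assume "0 \<le> t" "t \<le> 1"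
    then have "q t \<in> path_image q" by (simp add: path_image_def)
    then have "dist c (q t) \<le> s" "q t \<noteq> c" using s(2) q(3) by blast+
    then show "((g \<circ> R) \<circ> q) t = (g \<circ> q) t" using R_id[of "q t"] by simp
  qed
  ultimately show ?thesis by simp
qed

text \<open>The image of the circle is a simple closed curve. The image of the open disc is open by
  invariance of domain, that of the closed disc is compact, so the component of \<open>g c\<close>
  off the curve cannot leave the latter and is bounded: \<open>g c\<close> lies inside the
  curve.\<close>

lemma winding_number_injective_circle:
  fixes g :: "complex \<Rightarrow> complex"
  assumes g: "continuous_on (ball c e) g" "inj_on g (ball c e)" and r: "0 < r" "r < e"
  shows "winding_number (g \<circ> circlepath c r) (g c) \<in> {1, - 1}"
proof -
  let ?J = "g ` sphere c r"
  have cb: "cball c r \<subseteq> ball c e" using r by auto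
  have simple: "simple_path (g \<circ> circlepath c r)"
  proof (rule simple_path_continuous_image)
    show "simple_path (circlepath c r)" using r by (simp add: simple_path_circlepath)
    show "continuous_on (path_image (circlepath c r)) g" "inj_on g (path_image (circlepath c r))"
      using g cb r by (auto intro: continuous_on_subset inj_on_subset)
  qed
  have pim: "path_image (g \<circ> circlepath c r) = ?J" using r by (simp add: path_image_compose)
  have "c \<in> ball c r" using r by simp
  have disj: "g ` ball c r \<inter> ?J = {}"
    using g(2) cb by (auto simp: inj_on_def) (metis dist_commute less_irrefl cb ball_subset_cball mem_ball mem_cball order.strict_implies_order subsetD order.refl)
  let ?K = "connected_component_set (- ?J) (g c)"
  have "ball c r \<subseteq> ball c e" using r by auto
  then have "open (g ` ball c r)"
    using g by (meson invariance_of_domain continuous_on_subset inj_on_subset open_ball)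
  moreover have cmp: "compact (g ` cball c r)"
    using g(1) cb by (intro compact_continuous_image compact_cball) (rule continuous_on_subset)
  then have "open (- g ` cball c r)" by (simp add: compact_imp_closed open_Compl)
  moreover have un: "g ` cball c r = g ` ball c r \<union> ?J"
  proof -
    have "cball c r = ball c r \<union> sphere c r" by auto
    then show ?thesis by (simp only: image_Un)
  qed
  then have "?K \<subseteq> g ` ball c r \<union> - g ` cball c r"
    using connected_component_subset[of "- ?J" "g c"] by blast
  moreover have "g ` ball c r \<inter> - g ` cball c r \<inter> ?K = {}" using un by blast
  moreover have "g ` ball c r \<inter> ?K \<noteq> {}"
  proof -
    have "g c \<in> - ?J" using disj \<open>c \<in> ball c r\<close> by blast
    then have "g c \<in> ?K" by (simp only: mem_Collect_eq connected_component_refl_eq)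
    then show ?thesis using \<open>c \<in> ball c r\<close> by blast
  qed
  ultimately have "?K \<inter> - g ` cball c r = {}"
    using connectedD[OF connected_connected_component[of "- ?J" "g c"], of "g ` ball c r" "- g ` cball c r"] by blast
  then have "?K \<subseteq> g ` cball c r" by blast
  then have "bounded ?K" using compact_imp_bounded[OF cmp] by (rule bounded_subset[rotated])
  moreover have "g c \<notin> ?J" using disj \<open>c \<in> ball c r\<close> by blast
  ultimately have "g c \<in> inside ?J" unfolding inside_def by simp
  then show ?thesis
    using simple_closed_path_winding_number_inside[OF simple] unfolding pim by (metis insert_iff)
qed

text \<open>Centre and radius are moved linearly. The condition that bounds the circle is convex, so
  all intermediate circles stay in the ball, and injectivity keeps
  \<open>k (C l t) - k (Z l)\<close> away from zero.\<close>

lemma winding_number_injective_circle_const: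
  fixes k :: "complex \<Rightarrow> complex"
  assumes k: "continuous_on (ball w e) k" "inj_on k (ball w e)"
    and z: "dist w z + r < e" "0 < r" and z': "dist w z' + r' < e" "0 < r'"
  shows "winding_number (k \<circ> circlepath z r) (k z) = winding_number (k \<circ> circlepath z' r') (k z')"
proof -
  define Z where "Z l = (1 - of_real l) * z + of_real l * z'" for l :: real
  define \<rho> where "\<rho> l = (1 - l) * r + l * r'" for l :: real
  define C where "C l t = Z l + of_real (\<rho> l) * exp (2 * of_real pi * \<i> * of_real t)" for l t :: real
  have \<rho>0: "\<rho> l > 0" if "l \<in> {0..1}" for l
  proof -
    have "(1 - l) * - r + l * - r' < 0" by (rule convex_bound_lt) (use that z(2) z'(2) in simp_all)
    then show ?thesis unfolding \<rho>_def mult_minus_right by linarith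
  qed
  have Zin: "dist w (Z l) + \<rho> l < e" if l: "l \<in> {0..1}" for l
  proof -
    have "Z l - w = (1 - of_real l) * (z - w) + of_real l * (z' - w)" by (simp add: Z_def algebra_simps)
    then have "dist w (Z l) \<le> norm ((1 - of_real l) * (z - w)) + norm (of_real l * (z' - w))"
      by (simp only: dist_norm norm_minus_commute[of w] norm_triangle_ineq)
    also have "norm ((1 - of_real l) * (z - w)) = (1 - l) * dist w z"
    proof -
      have "(1 - of_real l :: complex) = of_real (1 - l)" by simp
      then have "norm (1 - of_real l :: complex) = 1 - l" using l by (simp only: norm_of_real) simp
      then show ?thesis by (simp only: norm_mult dist_norm norm_minus_commute[of w])
    qed
    also have "norm (of_real l * (z' - w)) = l * dist w z'"
      using l by (simp only: norm_mult dist_norm norm_minus_commute[of w] norm_of_real) simp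
    finally have "dist w (Z l) + \<rho> l \<le> (1 - l) * (dist w z + r) + l * (dist w z' + r')"
      unfolding \<rho>_def distrib_left by linarith
    also have "\<dots> < e"
      by (rule convex_bound_lt) (use z z' l in simp_all)
    finally show ?thesis .
  qed
  have Zball: "Z l \<in> ball w e" if "l \<in> {0..1}" for l using Zin[OF that] \<rho>0[OF that] by simp
  have distC: "dist (Z l) (C l t) = \<rho> l" if "l \<in> {0..1}" for l t
  proof -
    have "norm (exp (2 * of_real pi * \<i> * of_real t)) = 1" by simp
    then show ?thesis using \<rho>0[OF that] by (simp add: C_def dist_norm norm_mult)
  qed
  have Cball: "C l t \<in> ball w e" if "l \<in> {0..1}" for l t
    using Zin[OF that] distC[OF that, of t] dist_triangle[of w "C l t" "Z l"] by simp
  have CZ: "C l t \<noteq> Z l" if "l \<in> {0..1}" for l t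
    using distC[OF that, of t] \<rho>0[OF that] by auto
  have kC: "k (C l t) - k (Z l) \<noteq> 0" if "l \<in> {0..1}" for l t
    using CZ[OF that, of t] inj_onD[OF k(2) _ Cball[OF that, of t] Zball[OF that]] by auto
  define h where "h = (\<lambda>(l, t). k (C l t) - k (Z l))"
  have "homotopic_loops (- {0}) (\<lambda>t. k (circlepath z r t) - k z) (\<lambda>t. k (circlepath z' r' t) - k z')"
    unfolding homotopic_loops
  proof (intro exI[of _ h] conjI ballI)
    have "continuous_on ({0..1} \<times> {0..1}) (\<lambda>x. k (C (fst x) (snd x)))"
      unfolding C_def Z_def \<rho>_def
      by (rule continuous_on_compose2[OF k(1)], intro continuous_intros)
        (use Cball in \<open>auto simp: C_def Z_def \<rho>_def\<close>)
    moreover have "continuous_on ({0..1} \<times> {0..1::real}) (\<lambda>x. k (Z (fst x)))"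
      unfolding Z_def
      by (rule continuous_on_compose2[OF k(1)], intro continuous_intros)
        (use Zball in \<open>auto simp: Z_def\<close>)
    ultimately show "continuous_on ({0..1} \<times> {0..1}) h"
      unfolding h_def case_prod_beta by (rule continuous_on_diff)
    show "h \<in> {0..1} \<times> {0..1} \<rightarrow> - {0}" using kC by (auto simp: h_def)
    show "h (0, x) = k (circlepath z r x) - k z" for x by (simp add: h_def C_def Z_def \<rho>_def circlepath)
    show "h (1, x) = k (circlepath z' r' x) - k z'" for x by (simp add: h_def C_def Z_def \<rho>_def circlepath)
    show "pathfinish (h \<circ> Pair t) = pathstart (h \<circ> Pair t)" for t
      by (simp add: pathfinish_def pathstart_def h_def C_def)
  qed
  from winding_number_homotopic_loops[OF this] show ?thesis
    unfolding o_def by (subst winding_number_offset, subst (2) winding_number_offset)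
qed

text \<open>Rotation through the angles from 0 to \<open>pi\<close> is a homotopy of loops that
  avoids 0.\<close>

lemma winding_number_uminus:
  assumes "path p" "pathfinish p = pathstart p" "0 \<notin> path_image p"
  shows "winding_number (\<lambda>t. - p t) 0 = winding_number p 0"
proof -
  have "homotopic_loops (- {0}) p (\<lambda>t. - p t)"
    unfolding homotopic_loops
  proof (intro exI[of _ "\<lambda>(l, t). exp (of_real (pi * l) * \<i>) * p t"] conjI ballI)
    have "continuous_on {0..1} p" using assms(1) by (simp add: path_def)
    then have "continuous_on ({0..1::real} \<times> {0..1}) (\<lambda>x. p (snd x))"
      by (rule continuous_on_compose2) (auto intro: continuous_intros)
    then show "continuous_on ({0..1} \<times> {0..1}) (\<lambda>(l, t). exp (of_real (pi * l) * \<i>) * p t)"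
      unfolding case_prod_beta by (intro continuous_intros) auto
    show "(\<lambda>(l, t). exp (of_real (pi * l) * \<i>) * p t) \<in> {0..1} \<times> {0..1} \<rightarrow> - {0}"
      using assms(3) by (auto simp: path_image_def)
    show "pathfinish ((\<lambda>(l, t). exp (of_real (pi * l) * \<i>) * p t) \<circ> Pair t) =
        pathstart ((\<lambda>(l, t). exp (of_real (pi * l) * \<i>) * p t) \<circ> Pair t)" for t
      using assms(2) by (simp add: pathfinish_def pathstart_def)
    show "(case (1, x) of (l, t) \<Rightarrow> exp (of_real (pi * l) * \<i>) * p t) = - p x" for x by simp
    show "(case (0, x) of (l, t) \<Rightarrow> exp (of_real (pi * l) * \<i>) * p t) = p x" for x by simp
  qed
  then show ?thesis by (rule winding_number_homotopic_loops[symmetric])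
qed

lemma winding_number_cnj_circle:
  assumes "r > 0"
  shows "winding_number (cnj \<circ> circlepath z r) (cnj z) = - 1"
  using assms by (subst winding_number_cnj) (auto simp: winding_number_circlepath_centre)

text \<open>Relative to the centre, a straight-line homotopy replaces the increasing function
  \<open>s\<close> by the identity: real parts agree, imaginary parts have equal signs, so no
  segment meets 0. What remains is the reflection \<open>- cnj\<close>, which reverses the
  circle.\<close>

lemma winding_number_reflect:
  fixes s :: "real \<Rightarrow> real"
  assumes s: "continuous_on {a<..<b} s" "strict_mono_on {a<..<b} s"
    and z: "Im z - r > a" "Im z + r < b" and r: "r > 0"
  defines "\<theta> \<equiv> \<lambda>\<zeta>. Complex (- Re \<zeta>) (s (Im \<zeta>))"
  shows "winding_number (\<theta> \<circ> circlepath z r) (\<theta> z) = - 1"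
proof -
  let ?c = "circlepath z r"
  define p where "p t = \<theta> (?c t) - \<theta> z" for t
  define q where "q t = - cnj (?c t - z)" for t
  have c_in: "dist z (?c t) = r" for t
  proof -
    have "norm (exp (2 * of_real pi * \<i> * of_real t)) = 1" by simp
    then show ?thesis using r by (simp add: circlepath dist_norm norm_mult)
  qed
  have Imc: "Im (?c t) \<in> {a<..<b}" for t
    using c_in[of t] z abs_Im_le_cmod[of "?c t - z"] by (simp add: dist_norm norm_minus_commute abs_le_iff)
  have Imz: "Im z \<in> {a<..<b}" using z r by simp
  have c_cont: "continuous_on {0..1} ?c" using path_circlepath by (simp add: path_def)
  have "continuous_on {0..1} (\<lambda>t. Im (?c t))" "continuous_on {0..1} (\<lambda>t. Re (?c t))"
    using c_cont by (auto intro: continuous_intros)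
  then have "continuous_on {0..1} (\<lambda>t. s (Im (?c t)))" "continuous_on {0..1} (\<lambda>t. Re (?c t))"
    using Imc by (auto intro!: continuous_on_compose2[OF s(1)])
  then have pp: "path p"
    using c_cont unfolding path_def p_def \<theta>_def Complex_eq by (intro continuous_intros)
  have pq: "path q"
    unfolding path_def q_def using c_cont by (intro continuous_intros)
  have c01: "?c 0 = ?c 1" by (simp add: circlepath)
  have lp: "pathfinish p = pathstart p" "pathfinish q = pathstart q"
    by (simp_all add: pathfinish_def pathstart_def p_def q_def c01)
  have seg: "0 \<notin> closed_segment (p t) (q t)" for t
  proof
    assume "0 \<in> closed_segment (p t) (q t)"
    then obtain l where l: "0 \<le> l" "l \<le> 1" "0 = (1 - l) *\<^sub>R p t + l *\<^sub>R q t"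
      by (auto simp: closed_segment_def)
    have re: "Re (p t) = Re z - Re (?c t)" "Re (q t) = Re z - Re (?c t)" by (simp_all add: p_def q_def \<theta>_def)
    have im: "Im (p t) = s (Im (?c t)) - s (Im z)" "Im (q t) = Im (?c t) - Im z" by (simp_all add: p_def q_def \<theta>_def)
    have "0 = (1 - l) * Re (p t) + l * Re (q t)" using l(3) by (metis plus_complex.sel(1) scaleR_complex.sel(1) zero_complex.sel(1))
    then have R: "Re (?c t) = Re z" unfolding re by (simp add: algebra_simps)
    have I: "0 = (1 - l) * Im (p t) + l * Im (q t)" using l(3) by (metis plus_complex.sel(2) scaleR_complex.sel(2) zero_complex.sel(2))
    have "?c t \<noteq> z" using c_in[of t] r by auto
    then have "Im (?c t) < Im z \<or> Im (?c t) > Im z" using R by (auto simp: complex_eq_iff)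
    then show False
    proof
      assume lt: "Im (?c t) < Im z"
      then have "s (Im (?c t)) < s (Im z)" using strict_mono_onD[OF s(2) Imc Imz] by blast
      then have neg: "Im (p t) < 0" "Im (q t) < 0" using lt im by simp_all
      have "(1 - l) * Im (p t) + l * Im (q t) < 0"
        using convex_bound_lt[of "Im (p t)" 0 "Im (q t)" "1 - l" l] neg l by simp
      then show False using I by simp
    next
      assume lt: "Im (?c t) > Im z"
      then have "s (Im (?c t)) > s (Im z)" using strict_mono_onD[OF s(2) Imz Imc] by blast
      then have "- Im (p t) < 0" "- Im (q t) < 0" using lt im by simp_all
      then have "(1 - l) * - Im (p t) + l * - Im (q t) < 0"
        using convex_bound_lt[of "- Im (p t)" 0 "- Im (q t)" "1 - l" l] l by simp
      then show False using I by simp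
    qed
  qed
  have "homotopic_loops (- {0}) p q"
    using seg by (intro homotopic_loops_linear pp pq lp) auto
  then have "winding_number p 0 = winding_number q 0" by (rule winding_number_homotopic_loops)
  also have "winding_number q 0 = winding_number (\<lambda>t. cnj (?c t - z)) 0"
    unfolding q_def
  proof (rule winding_number_uminus)
    show "path (\<lambda>t. cnj (?c t - z))" unfolding path_def using c_cont by (intro continuous_intros)
    show "pathfinish (\<lambda>t. cnj (?c t - z)) = pathstart (\<lambda>t. cnj (?c t - z))"
      by (simp add: pathfinish_def pathstart_def c01)
    have "?c t \<noteq> z" for t using c_in[of t] r by auto
    then show "0 \<notin> path_image (\<lambda>t. cnj (?c t - z))" unfolding path_image_def by auto
  qed
  also have "\<dots> = winding_number (cnj \<circ> ?c) (cnj z)"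
    by (subst (2) winding_number_offset) (simp add: o_def)
  also have "\<dots> = - 1" using winding_number_cnj_circle[OF r] .
  finally have "winding_number p 0 = - 1" .
  moreover have "p = (\<lambda>t. (\<theta> \<circ> ?c) t - \<theta> z)" by (simp add: fun_eq_iff p_def)
  ultimately show ?thesis by (subst winding_number_offset) (simp only:)
qed

section \<open>Charts and invariance of domain on a surface\<close>

lemma chartD:
  assumes "chart X U \<phi>"
  shows "openin X U" "open (\<phi> ` U)" "inj_on \<phi> U" "U \<subseteq> topspace X"
    "continuous_map (subtopology X U) euclidean \<phi>"
    "continuous_map (top_of_set (\<phi> ` U)) X (inv_into U \<phi>)"
    "\<And>W. openin X W \<Longrightarrow> W \<subseteq> U \<Longrightarrow> open (\<phi> ` W)"
proof -
  have hm: "homeomorphic_map (subtopology X U) (top_of_set (\<phi> ` U)) \<phi>"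
    and o: "openin X U" "open (\<phi> ` U)"
    using assms by (auto simp: chart_def)
  show "openin X U" "open (\<phi> ` U)" by (fact o)+
  show sub: "U \<subseteq> topspace X" using o(1) by (rule openin_subset)
  have ts: "topspace (subtopology X U) = U" using sub by auto
  show inj: "inj_on \<phi> U" using homeomorphic_imp_injective_map[OF hm] unfolding ts .
  show "continuous_map (subtopology X U) euclidean \<phi>"
    using homeomorphic_imp_continuous_map[OF hm] by (simp add: continuous_map_in_subtopology)
  obtain g where g: "homeomorphic_maps (subtopology X U) (top_of_set (\<phi> ` U)) \<phi> g"
    using hm homeomorphic_map_maps by blast
  have "continuous_map (top_of_set (\<phi> ` U)) X g"
    using g unfolding homeomorphic_maps_def continuous_map_in_subtopology by blast
  moreover have "g y = inv_into U \<phi> y" if y: "y \<in> \<phi> ` U" for y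
  proof -
    obtain x where "x \<in> U" "y = \<phi> x" using y by blast
    then show ?thesis using g inj unfolding homeomorphic_maps_def ts by simp
  qed
  ultimately show "continuous_map (top_of_set (\<phi> ` U)) X (inv_into U \<phi>)"
    by (rule continuous_map_eq) simp
  fix W assume W: "openin X W" "W \<subseteq> U"
  then have "openin (subtopology X U) W" by (simp add: openin_open_subtopology o(1))
  then have "openin (top_of_set (\<phi> ` U)) (\<phi> ` W)"
    using homeomorphic_imp_open_map[OF hm] by (simp add: open_map_def)
  then show "open (\<phi> ` W)" using o(2) by (simp add: openin_open_eq)
qed

lemma chart_compose_continuous:
  assumes "chart X U \<phi>" "continuous_map (top_of_set S) X k" "k ` S \<subseteq> U"
  shows "continuous_on S (\<phi> \<circ> k)"
proof -
  have "continuous_map (top_of_set S) (subtopology X U) k"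
    using assms(2,3) by (auto simp: continuous_map_in_subtopology)
  from continuous_map_compose[OF this chartD(5)[OF assms(1)]] show ?thesis by simp
qed

lemma open_preimage:
  assumes "continuous_map (top_of_set S) X k" "open S" "openin X U"
  shows "open {z \<in> S. k z \<in> U}"
  using openin_continuous_map_preimage[OF assms(1,3)] assms(2) by (simp add: openin_open_eq)

definition planar :: "'a topology \<Rightarrow> bool" where
  "planar X \<longleftrightarrow> (\<forall>x\<in>topspace X. \<exists>U \<phi>. chart X U \<phi> \<and> x \<in> U)"

text \<open>In a chart around each image point this is invariance of domain in the plane. It will
  show that glued pieces of two tiles form a neighbourhood of an interior point of their common
  edge.\<close>

lemma openin_injective_image:
  fixes S :: "complex set"
  assumes X: "planar X" and k: "continuous_map (top_of_set S) X k" "inj_on k S" and S: "open S"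
  shows "openin X (k ` S)"
proof (subst openin_subopen, safe)
  fix z assume z: "z \<in> S"
  then have "k z \<in> topspace X" using continuous_map_funspace[OF k(1)] by auto
  then obtain U \<phi> where U: "chart X U \<phi>" "k z \<in> U" using X unfolding planar_def by blast
  define S' where "S' = {z \<in> S. k z \<in> U}"
  have o: "open S'" unfolding S'_def by (rule open_preimage[OF k(1) S chartD(1)[OF U(1)]])
  have "continuous_map (top_of_set S') X k"
    using continuous_map_from_subtopology_mono[OF k(1), of S'] by (auto simp: S'_def)
  then have c: "continuous_on S' (\<phi> \<circ> k)"
    by (rule chart_compose_continuous[OF U(1)]) (auto simp: S'_def)
  have i: "inj_on (\<phi> \<circ> k) S'"
    using k(2) chartD(3)[OF U(1)] by (auto simp: inj_on_def S'_def)
  have "open ((\<phi> \<circ> k) ` S')" by (rule invariance_of_domain[OF c o i])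
  then have "openin (subtopology X U) {x \<in> topspace (subtopology X U). \<phi> x \<in> (\<phi> \<circ> k) ` S'}"
    by (intro openin_continuous_map_preimage[OF chartD(5)[OF U(1)]]) auto
  moreover have "{x \<in> topspace (subtopology X U). \<phi> x \<in> (\<phi> \<circ> k) ` S'} = k ` S'"
    using chartD(3,4)[OF U(1)] by (fastforce simp: S'_def inj_on_def)
  ultimately have "openin X (k ` S')" by (metis openin_open_subtopology chartD(1)[OF U(1)])
  moreover have "k z \<in> k ` S'" "k ` S' \<subseteq> k ` S" using z U(2) by (auto simp: S'_def)
  ultimately show "\<exists>T. openin X T \<and> k z \<in> T \<and> T \<subseteq> k ` S" by blast
qed

text \<open>The counterpart for maps from the surface to the plane, again by passing to charts. It
  will show that an edge cannot have fewer than two sides.\<close>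

lemma open_injective_image:
  fixes m :: "'a \<Rightarrow> complex"
  assumes X: "planar X" and m: "continuous_map (subtopology X W) euclidean m" "inj_on m W" and W: "openin X W"
  shows "open (m ` W)"
proof (subst open_subopen, safe)
  fix x assume x: "x \<in> W"
  then have "x \<in> topspace X" using openin_subset[OF W] by blast
  then obtain U \<phi> where U: "chart X U \<phi>" "x \<in> U" using X unfolding planar_def by blast
  define V where "V = U \<inter> W"
  have V: "openin X V" "V \<subseteq> U" "V \<subseteq> W" using W chartD(1)[OF U(1)] by (auto simp: V_def)
  have inv: "inv_into U \<phi> ` \<phi> ` V = V"
    using chartD(3)[OF U(1)] V(2) by (rule inv_into_image_cancel)
  have "continuous_map (top_of_set (\<phi> ` V)) X (inv_into U \<phi>)"
    by (rule continuous_map_from_subtopology_mono[OF chartD(6)[OF U(1)]]) (use V(2) in blast)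
  then have "continuous_map (top_of_set (\<phi> ` V)) (subtopology X W) (inv_into U \<phi>)"
    unfolding continuous_map_in_subtopology using inv V(3) by auto
  from continuous_map_compose[OF this m(1)] have "continuous_on (\<phi> ` V) (m \<circ> inv_into U \<phi>)" by simp
  moreover have "inj_on (m \<circ> inv_into U \<phi>) (\<phi> ` V)"
  proof (rule comp_inj_on)
    show "inj_on (inv_into U \<phi>) (\<phi> ` V)" using V(2) by (intro inj_on_inv_into) blast
    show "inj_on m (inv_into U \<phi> ` \<phi> ` V)" unfolding inv using m(2) V(3) by (rule inj_on_subset)
  qed
  moreover have "open (\<phi> ` V)" using chartD(7)[OF U(1) V(1,2)] .
  ultimately have "open ((m \<circ> inv_into U \<phi>) ` \<phi> ` V)" using invariance_of_domain by blast
  moreover have "(m \<circ> inv_into U \<phi>) ` \<phi> ` V = m ` V" unfolding image_comp[symmetric] inv ..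
  ultimately have "open (m ` V)" by simp
  moreover have "m x \<in> m ` V" "m ` V \<subseteq> m ` W" using x U(2) V(3) by (auto simp: V_def)
  ultimately show "\<exists>T. open T \<and> m x \<in> T \<and> T \<subseteq> m ` W" by blast
qed

text \<open>The local degree at \<open>z\<close> of a locally injective map \<open>k\<close> from the plane to a surface with an
  oriented atlas \<open>A\<close> is \<open>s\<close>.\<close>

definition ldeg :: "('a set \<times> ('a \<Rightarrow> complex)) set \<Rightarrow> (complex \<Rightarrow> 'a) \<Rightarrow> complex \<Rightarrow> complex \<Rightarrow> bool" where
  "ldeg A k z s \<longleftrightarrow> (\<exists>U \<phi> e r. (U, \<phi>) \<in> A \<and> 0 < r \<and> r < e \<and> k ` ball z e \<subseteq> U \<and>
     continuous_on (ball z e) (\<phi> \<circ> k) \<and> inj_on (\<phi> \<circ> k) (ball z e) \<and>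
     winding_number (\<phi> \<circ> k \<circ> circlepath z r) (\<phi> (k z)) = s)"

text \<open>Circles inside one ball of injectivity all have the same winding number, so the witness
  can be shrunk below any \<open>d\<close> and its circle exchanged for any other one in the ball,
  even with another centre.\<close>

lemma ldegE:
  assumes "ldeg A k z s" "d > 0"
  obtains U \<phi> e where "(U, \<phi>) \<in> A" "0 < e" "e \<le> d" "k ` ball z e \<subseteq> U"
    "continuous_on (ball z e) (\<phi> \<circ> k)" "inj_on (\<phi> \<circ> k) (ball z e)"
    "\<forall>z' r. 0 < r \<longrightarrow> dist z z' + r < e \<longrightarrow> winding_number (\<phi> \<circ> k \<circ> circlepath z' r) (\<phi> (k z')) = s"
proof -
  obtain U \<phi> e r where u: "(U, \<phi>) \<in> A" "0 < r" "r < e" "k ` ball z e \<subseteq> U"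
     "continuous_on (ball z e) (\<phi> \<circ> k)" "inj_on (\<phi> \<circ> k) (ball z e)"
     "winding_number (\<phi> \<circ> k \<circ> circlepath z r) (\<phi> (k z)) = s"
    using assms(1) unfolding ldeg_def by blast
  have sub: "ball z (min d e) \<subseteq> ball z e" by auto
  show thesis
  proof (rule that[OF u(1)])
    show "0 < min d e" using u assms(2) by simp
    show "min d e \<le> d" by simp
    show "k ` ball z (min d e) \<subseteq> U" using u(4) sub by blast
    show "continuous_on (ball z (min d e)) (\<phi> \<circ> k)" using u(5) sub by (rule continuous_on_subset)
    show "inj_on (\<phi> \<circ> k) (ball z (min d e))" using u(6) sub by (rule inj_on_subset)
    have "winding_number (\<phi> \<circ> k \<circ> circlepath z' r') (\<phi> (k z')) = s"
      if r': "0 < r'" "dist z z' + r' < min d e" for z' r'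
    proof -
    have "winding_number ((\<phi> \<circ> k) \<circ> circlepath z' r') ((\<phi> \<circ> k) z') = winding_number ((\<phi> \<circ> k) \<circ> circlepath z r) ((\<phi> \<circ> k) z)"
      using u(2,3) r' by (intro winding_number_injective_circle_const[OF u(5,6)]) auto
    then show ?thesis using u(7) by simp
    qed
    then show "\<forall>z' r. 0 < r \<longrightarrow> dist z z' + r < min d e \<longrightarrow> winding_number (\<phi> \<circ> k \<circ> circlepath z' r) (\<phi> (k z')) = s"
      by blast
  qed
qed

lemma ldegI:
  assumes "(U, \<phi>) \<in> A" "0 < r" "r < e" "k ` ball z e \<subseteq> U"
     "continuous_on (ball z e) (\<phi> \<circ> k)" "inj_on (\<phi> \<circ> k) (ball z e)"
     "winding_number (\<phi> \<circ> k \<circ> circlepath z r) (\<phi> (k z)) = s"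
  shows "ldeg A k z s"
  using assms unfolding ldeg_def by blast

lemma ldeg_cong:
  assumes "ldeg A k z s" "d > 0" "\<And>w. w \<in> ball z d \<Longrightarrow> k w = k' w"
  shows "ldeg A k' z s"
proof -
  obtain U \<phi> e where u: "(U, \<phi>) \<in> A" "0 < e" "e \<le> d" "k ` ball z e \<subseteq> U"
    "continuous_on (ball z e) (\<phi> \<circ> k)" "inj_on (\<phi> \<circ> k) (ball z e)"
    "\<forall>z' r. 0 < r \<longrightarrow> dist z z' + r < e \<longrightarrow> winding_number (\<phi> \<circ> k \<circ> circlepath z' r) (\<phi> (k z')) = s"
    by (rule ldegE[OF assms(1,2)])
  have eq: "k w = k' w" if "w \<in> ball z e" for w using assms(3) that u(3) by auto
  show ?thesis
  proof (rule ldegI[OF u(1), of "e / 2" e])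
    show "k' ` ball z e \<subseteq> U" using u(4) eq by (metis image_cong)
    show "continuous_on (ball z e) (\<phi> \<circ> k')"
      using u(5) by (rule continuous_on_eq) (simp add: eq)
    show "inj_on (\<phi> \<circ> k') (ball z e)"
      using u(6) inj_on_cong[of "ball z e" "\<phi> \<circ> k" "\<phi> \<circ> k'"] eq by simp
    have "winding_number (\<phi> \<circ> k' \<circ> circlepath z (e / 2)) (\<phi> (k z)) = winding_number (\<phi> \<circ> k \<circ> circlepath z (e / 2)) (\<phi> (k z))"
    proof (rule winding_number_cong)
      fix t
      have "norm (exp (2 * of_real pi * \<i> * of_real t)) = 1" by simp
      then have "circlepath z (e / 2) t \<in> ball z e"
        using u(2) by (simp add: circlepath dist_norm norm_mult)
      then show "(\<phi> \<circ> k' \<circ> circlepath z (e / 2)) t = (\<phi> \<circ> k \<circ> circlepath z (e / 2)) t" using eq by simp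
    qed
    then show "winding_number (\<phi> \<circ> k' \<circ> circlepath z (e / 2)) (\<phi> (k' z)) = s"
      using u(7)[rule_format, of "e / 2" z] u(2) eq[of z] by simp
  qed (use u(2) in simp_all)
qed

definition oriented_atlas :: "'a topology \<Rightarrow> ('a set \<times> ('a \<Rightarrow> complex)) set \<Rightarrow> bool" where
  "oriented_atlas X A \<longleftrightarrow> (\<forall>(U, \<phi>)\<in>A. chart X U \<phi>) \<and> (\<Union>(U, \<phi>)\<in>A. U) = topspace X \<and>
     (\<forall>(U, \<phi>)\<in>A. \<forall>(V, \<psi>)\<in>A. orientation_preserving_on (\<phi> ` (U \<inter> V)) (\<psi> \<circ> inv_into U \<phi>))"

lemma ldeg_exists:
  assumes A: "oriented_atlas X A" and k: "continuous_map (top_of_set S) X k" and S: "open S" "z \<in> S"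
    and inj: "d > 0" "inj_on k (ball z d)"
  shows "ldeg A k z 1 \<or> ldeg A k z (- 1)"
proof -
  have "k z \<in> topspace X" using continuous_map_funspace[OF k] S(2) by auto
  then obtain U \<phi> where U: "(U, \<phi>) \<in> A" "k z \<in> U" "chart X U \<phi>"
    using A unfolding oriented_atlas_def by blast
  have "open {z \<in> S. k z \<in> U}" by (rule open_preimage[OF k S(1) chartD(1)[OF U(3)]])
  then obtain e' where e': "e' > 0" "ball z e' \<subseteq> {z \<in> S. k z \<in> U}"
    using S(2) U(2) by (metis (mono_tags, lifting) mem_Collect_eq open_contains_ball)
  define e where "e = min d e'"
  have e: "e > 0" "ball z e \<subseteq> {z \<in> S. k z \<in> U}" "ball z e \<subseteq> ball z d" using e' inj(1) by (auto simp: e_def)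
  have "continuous_map (top_of_set (ball z e)) X k"
    by (rule continuous_map_from_subtopology_mono[OF k]) (use e in blast)
  then have c: "continuous_on (ball z e) (\<phi> \<circ> k)"
    by (rule chart_compose_continuous[OF U(3)]) (use e in blast)
  have i: "inj_on (\<phi> \<circ> k) (ball z e)"
  proof (rule comp_inj_on)
    show "inj_on k (ball z e)" using inj(2) e(3) by (rule inj_on_subset)
    show "inj_on \<phi> (k ` ball z e)" using chartD(3)[OF U(3)] by (rule inj_on_subset) (use e in blast)
  qed
  have "winding_number ((\<phi> \<circ> k) \<circ> circlepath z (e / 2)) ((\<phi> \<circ> k) z) \<in> {1, - 1}"
    using e(1) by (intro winding_number_injective_circle[OF c i]) auto
  moreover have "ldeg A k z (winding_number ((\<phi> \<circ> k) \<circ> circlepath z (e / 2)) ((\<phi> \<circ> k) z))"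
    by (rule ldegI[OF U(1) _ _ _ c i, of "e / 2"]) (use e in auto)
  ultimately show ?thesis by auto
qed

lemma ldeg_values: "ldeg A k z s \<Longrightarrow> s \<in> {1, - 1}"
  unfolding ldeg_def using winding_number_injective_circle by fastforce

text \<open>Here the orientation of the atlas enters. In the first chart, the image \<open>p\<close>
  of a small circle is homotopic, off its centre, to a round circle \<open>q\<close> or to the
  reverse of \<open>q\<close>. The transition map winds \<open>q\<close> once positively and
  therefore preserves the winding number of \<open>p\<close>.\<close>

lemma ldeg_unique:
  assumes A: "oriented_atlas X A" and s: "ldeg A k z s" and s': "ldeg A k z s'"
  shows "s = s'"
proof -
  obtain U \<phi> e where u: "(U, \<phi>) \<in> A" "0 < e" "e \<le> 1" "k ` ball z e \<subseteq> U"
    "continuous_on (ball z e) (\<phi> \<circ> k)" "inj_on (\<phi> \<circ> k) (ball z e)"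
    "\<forall>z' r. 0 < r \<longrightarrow> dist z z' + r < e \<longrightarrow> winding_number (\<phi> \<circ> k \<circ> circlepath z' r) (\<phi> (k z')) = s"
    by (rule ldegE[OF s zero_less_one])
  obtain V \<psi> e' where v: "(V, \<psi>) \<in> A" "0 < e'" "e' \<le> e" "k ` ball z e' \<subseteq> V"
    "continuous_on (ball z e') (\<psi> \<circ> k)" "inj_on (\<psi> \<circ> k) (ball z e')"
    "\<forall>z' r. 0 < r \<longrightarrow> dist z z' + r < e' \<longrightarrow> winding_number (\<psi> \<circ> k \<circ> circlepath z' r) (\<psi> (k z')) = s'"
    by (rule ldegE[OF s' u(2)])
  have cU: "chart X U \<phi>" and cV: "chart X V \<psi>" using A u(1) v(1) unfolding oriented_atlas_def by auto
  have T: "orientation_preserving_on (\<phi> ` (U \<inter> V)) (\<psi> \<circ> inv_into U \<phi>)"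
    using A u(1) v(1) unfolding oriented_atlas_def by fast
  let ?T = "\<psi> \<circ> inv_into U \<phi>"
  have zin: "k z \<in> U \<inter> V" using u(2,4) v(2,4) by auto
  have "open (\<phi> ` (U \<inter> V))"
    using chartD(1)[OF cU] chartD(1)[OF cV] by (intro chartD(7)[OF cU]) auto
  then obtain d where d: "d > 0" "ball (\<phi> (k z)) d \<subseteq> \<phi> ` (U \<inter> V)"
    using zin by (metis imageI open_contains_ball)
  have inv: "inv_into U \<phi> ` \<phi> ` (U \<inter> V) = U \<inter> V"
    using chartD(3)[OF cU] by (intro inv_into_image_cancel) auto
  have "continuous_map (top_of_set (\<phi> ` (U \<inter> V))) X (inv_into U \<phi>)"
    by (rule continuous_map_from_subtopology_mono[OF chartD(6)[OF cU]]) blast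
  then have "continuous_on (\<phi> ` (U \<inter> V)) ?T"
    by (rule chart_compose_continuous[OF cV]) (use inv in blast)
  then have Tc: "continuous_on (ball (\<phi> (k z)) d) ?T" using d(2) by (rule continuous_on_subset)
  have "inj_on ?T (\<phi> ` (U \<inter> V))"
  proof (rule comp_inj_on)
    show "inj_on (inv_into U \<phi>) (\<phi> ` (U \<inter> V))" by (intro inj_on_inv_into) blast
    show "inj_on \<psi> (inv_into U \<phi> ` \<phi> ` (U \<inter> V))" unfolding inv using chartD(3)[OF cV] by (rule inj_on_subset) blast
  qed
  then have Ti: "inj_on ?T (ball (\<phi> (k z)) d)" using d(2) by (rule inj_on_subset)
  have "isCont (\<phi> \<circ> k) z"
    using iffD1[OF continuous_on_eq_continuous_at[OF open_ball] u(5)] u(2) centre_in_ball by blast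
  then obtain b where b: "b > 0" "\<And>w. dist w z < b \<Longrightarrow> dist ((\<phi> \<circ> k) w) ((\<phi> \<circ> k) z) < d"
    using d(1) unfolding continuous_at_eps_delta by blast
  define r where "r = min b e' / 2"
  have r: "0 < r" "r < b" "r < e'" "r < e" using b(1) v(2,3) by (auto simp: r_def)
  define p where "p = (\<phi> \<circ> k) \<circ> circlepath z r"
  have ps: "path_image (circlepath z r) = sphere z r" using r by simp
  have sb: "sphere z r \<subseteq> ball z e" using r by auto
  have pp: "path p"
    unfolding p_def using u(5) sb ps by (intro path_continuous_image) (auto intro: continuous_on_subset)
  have pl: "pathfinish p = pathstart p"
    by (simp add: p_def pathfinish_compose pathstart_compose)
  have pim: "path_image p \<subseteq> ball (\<phi> (k z)) d - {\<phi> (k z)}"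
  proof
    fix y assume "y \<in> path_image p"
    then obtain w where w: "w \<in> sphere z r" "y = \<phi> (k w)" unfolding p_def path_image_compose ps by auto
    then have "dist y (\<phi> (k z)) < d" using b(2)[of w] r by (simp add: dist_commute)
    moreover have "w \<in> ball z e" "z \<in> ball z e" "w \<noteq> z" using w r by auto
    then have "y \<noteq> \<phi> (k z)" using inj_onD[OF u(6), of w z] w by auto
    ultimately show "y \<in> ball (\<phi> (k z)) d - {\<phi> (k z)}" by (simp add: dist_commute)
  qed
  have wp: "winding_number p (\<phi> (k z)) = s" using u(7)[rule_format, of r z] r by (simp add: p_def)
  have Tk: "?T (\<phi> (k w)) = \<psi> (k w)" if "w \<in> ball z e" for w
  proof -
    have "k w \<in> U" using u(4) that by blast
    then show ?thesis by (simp add: inv_into_f_f[OF chartD(3)[OF cU]])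
  qed
  have "z \<in> ball z e" using u(2) by simp
  have wTp: "winding_number (?T \<circ> p) (?T (\<phi> (k z))) = s'"
  proof -
    have "winding_number (?T \<circ> p) (?T (\<phi> (k z))) = winding_number (\<psi> \<circ> k \<circ> circlepath z r) (?T (\<phi> (k z)))"
    proof (rule winding_number_cong)
      fix t :: real assume "0 \<le> t" "t \<le> 1"
      then have "circlepath z r t \<in> path_image (circlepath z r)" unfolding path_image_def by simp
      then have "circlepath z r t \<in> ball z e" using sb unfolding ps by blast
      then show "(?T \<circ> p) t = (\<psi> \<circ> k \<circ> circlepath z r) t" using Tk by (simp add: p_def)
    qed
    then show ?thesis using v(7)[rule_format, of r z] r Tk[OF \<open>z \<in> ball z e\<close>] by simp
  qed
  define q where "q = circlepath (\<phi> (k z)) (d / 2)"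
  have q: "path q" "pathfinish q = pathstart q" "path_image q \<subseteq> ball (\<phi> (k z)) d - {\<phi> (k z)}"
    "winding_number q (\<phi> (k z)) = 1"
    using d(1) by (auto simp: q_def winding_number_circlepath_centre)
  have "cball (\<phi> (k z)) (d / 2) \<subseteq> \<phi> ` (U \<inter> V)" using d by (auto intro!: subsetD[OF d(2)])
  then have wTq: "winding_number (?T \<circ> q) (?T (\<phi> (k z))) = 1"
    using T d(1) unfolding orientation_preserving_on_def q_def by (simp del: comp_apply)
  have "s = 1 \<or> s = - 1" using ldeg_values[OF s] by simp
  then show ?thesis
  proof
    assume "s = 1"
    then have "winding_number (?T \<circ> p) (?T (\<phi> (k z))) = winding_number (?T \<circ> q) (?T (\<phi> (k z)))"
      using wp q by (intro winding_number_compose[OF Tc Ti pp pl pim]) simp_all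
    then show ?thesis using wTp wTq \<open>s = 1\<close> by simp
  next
    assume "s = - 1"
    moreover have "winding_number (reversepath q) (\<phi> (k z)) = - 1"
      using q by (subst winding_number_reversepath) auto
    ultimately have "winding_number (?T \<circ> p) (?T (\<phi> (k z))) = winding_number (?T \<circ> reversepath q) (?T (\<phi> (k z)))"
      using wp q by (intro winding_number_compose[OF Tc Ti pp pl pim]) simp_all
    also have "\<dots> = - winding_number (?T \<circ> q) (?T (\<phi> (k z)))"
      unfolding path_compose_reversepath
    proof (rule winding_number_reversepath)
      show "path (?T \<circ> q)" using q(1,3) Tc by (intro path_continuous_image) (auto intro: continuous_on_subset)
      show "?T (\<phi> (k z)) \<notin> path_image (?T \<circ> q)"
        using q(3) d(1) inj_onD[OF Ti, of "\<phi> (k z)"] unfolding path_image_compose by force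
    qed
    finally show ?thesis using wTp wTq \<open>s = - 1\<close> by simp
  qed
qed

lemma ldeg_locally_constant:
  assumes "ldeg A k z s"
  shows "\<exists>d>0. \<forall>z'\<in>ball z d. ldeg A k z' s"
proof -
  obtain U \<phi> e where u: "(U, \<phi>) \<in> A" "0 < e" "e \<le> 1" "k ` ball z e \<subseteq> U"
    "continuous_on (ball z e) (\<phi> \<circ> k)" "inj_on (\<phi> \<circ> k) (ball z e)"
    "\<forall>z' r. 0 < r \<longrightarrow> dist z z' + r < e \<longrightarrow> winding_number (\<phi> \<circ> k \<circ> circlepath z' r) (\<phi> (k z')) = s"
    by (rule ldegE[OF assms zero_less_one])
  have "ldeg A k z' s" if "z' \<in> ball z (e / 2)" for z'
  proof (rule ldegI[OF u(1), of "e / 4" "e / 2"])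
    have sub: "ball z' (e / 2) \<subseteq> ball z e"
    proof
      fix w assume "w \<in> ball z' (e / 2)"
      then show "w \<in> ball z e" using that dist_triangle[of z w z'] by simp
    qed
    show "k ` ball z' (e / 2) \<subseteq> U" using u(4) sub by blast
    show "continuous_on (ball z' (e / 2)) (\<phi> \<circ> k)" using u(5) sub by (rule continuous_on_subset)
    show "inj_on (\<phi> \<circ> k) (ball z' (e / 2))" using u(6) sub by (rule inj_on_subset)
    show "winding_number (\<phi> \<circ> k \<circ> circlepath z' (e / 4)) (\<phi> (k z')) = s"
      using u(2) that by (intro u(7)[rule_format]) auto
  qed (use u(2) in simp_all)
  then show ?thesis using u(2) by (intro exI[of _ "e / 2"]) auto
qed

text \<open>The points of degree \<open>s\<close> and those of degree \<open>- s\<close> form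
  disjoint open sets covering the connected set \<open>S\<close>.\<close>

lemma ldeg_constant:
  assumes A: "oriented_atlas X A" and k: "continuous_map (top_of_set S) X k" and S: "open S" "connected S"
    and inj: "\<And>z. z \<in> S \<Longrightarrow> \<exists>d>0. inj_on k (ball z d)"
    and z: "z \<in> S" "z' \<in> S" "ldeg A k z s"
  shows "ldeg A k z' s"
proof -
  define D where "D s = {z \<in> S. ldeg A k z s}" for s
  have op: "open (D s)" for s
    unfolding open_contains_ball
  proof
    fix w assume w: "w \<in> D s"
    then obtain d where d: "d > 0" "\<forall>z'\<in>ball w d. ldeg A k z' s"
      using ldeg_locally_constant[of A k w s] by (auto simp: D_def)
    have "w \<in> S" using w by (simp add: D_def)
    then obtain d' where d': "d' > 0" "ball w d' \<subseteq> S" using S(1) by (meson open_contains_ball)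
    have "ball w (min d d') \<subseteq> D s" using d d' by (auto simp: D_def)
    then show "\<exists>e>0. ball w e \<subseteq> D s" using d d' by (metis min_less_iff_conj)
  qed
  have cov: "S \<subseteq> D s \<union> D (- s)"
  proof
    fix w assume w: "w \<in> S"
    then obtain d where "d > 0" "inj_on k (ball w d)" using inj by blast
    then have "ldeg A k w 1 \<or> ldeg A k w (- 1)" using ldeg_exists[OF A k S(1) w] by blast
    moreover have "s = 1 \<or> s = - 1" using ldeg_values[OF z(3)] by simp
    ultimately show "w \<in> D s \<union> D (- s)" using w by (auto simp: D_def)
  qed
  have ne: "s \<noteq> - s" using ldeg_values[OF z(3)] by auto
  have dis: "D s \<inter> D (- s) \<inter> S = {}" using ldeg_unique[OF A, of k _ s "- s"] ne unfolding D_def by blast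
  have "D s \<inter> S \<noteq> {}" using z by (auto simp: D_def)
  then have "D (- s) \<inter> S = {}" using connectedD[OF S(2) op op dis cov] by blast
  then show ?thesis using cov z(2) by (auto simp: D_def)
qed

text \<open>\<open>\<theta>\<close> carries a small circle to a loop with winding number -1, which
  may be exchanged for a reversed round circle before \<open>k\<close> and the chart are
  applied.\<close>

lemma ldeg_reverse:
  assumes s: "ldeg A k (\<theta> z) s" and \<theta>: "d > 0" "continuous_on (ball z d) \<theta>" "inj_on \<theta> (ball z d)"
    and w: "\<And>r. 0 < r \<Longrightarrow> r < d \<Longrightarrow> winding_number (\<theta> \<circ> circlepath z r) (\<theta> z) = - 1"
  shows "ldeg A (k \<circ> \<theta>) z (- s)"
proof -
  obtain U \<phi> e where u: "(U, \<phi>) \<in> A" "0 < e" "e \<le> 1" "k ` ball (\<theta> z) e \<subseteq> U"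
    "continuous_on (ball (\<theta> z) e) (\<phi> \<circ> k)" "inj_on (\<phi> \<circ> k) (ball (\<theta> z) e)"
    "\<forall>z' r. 0 < r \<longrightarrow> dist (\<theta> z) z' + r < e \<longrightarrow> winding_number (\<phi> \<circ> k \<circ> circlepath z' r) (\<phi> (k z')) = s"
    by (rule ldegE[OF s zero_less_one])
  have "isCont \<theta> z" using \<theta>(1,2) by (simp add: continuous_on_eq_continuous_at)
  then obtain b where b: "b > 0" "\<And>w. dist w z < b \<Longrightarrow> dist (\<theta> w) (\<theta> z) < e"
    using u(2) unfolding continuous_at_eps_delta by blast
  define e' where "e' = min b d"
  define r where "r = e' / 2"
  have e': "e' > 0" "ball z e' \<subseteq> ball z d" "\<theta> ` ball z e' \<subseteq> ball (\<theta> z) e"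
    using b \<theta>(1) by (auto simp: e'_def dist_commute)
  have r: "0 < r" "r < e'" "r < d" using e'(1) by (auto simp: r_def e'_def)
  define p where "p = \<theta> \<circ> circlepath z r"
  define q where "q = circlepath (\<theta> z) (e / 2)"
  have ps: "path_image (circlepath z r) = sphere z r" using r by simp
  have sb: "sphere z r \<subseteq> ball z e'" using r by auto
  have c\<theta>: "continuous_on (ball z e') \<theta>" using \<theta>(2) e'(2) by (rule continuous_on_subset)
  have i\<theta>: "inj_on \<theta> (ball z e')" using \<theta>(3) e'(2) by (rule inj_on_subset)
  have pp: "path p"
    unfolding p_def using c\<theta> sb ps by (intro path_continuous_image) (auto intro: continuous_on_subset)
  have pl: "pathfinish p = pathstart p" by (simp add: p_def pathfinish_compose pathstart_compose)
  have pim: "path_image p \<subseteq> ball (\<theta> z) e - {\<theta> z}"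
  proof
    fix y assume "y \<in> path_image p"
    then obtain w where w: "w \<in> sphere z r" "y = \<theta> w" unfolding p_def path_image_compose ps by auto
    have "w \<in> ball z e'" "z \<in> ball z e'" "w \<noteq> z" using w r by auto
    moreover from this have "y \<noteq> \<theta> z" using inj_onD[OF i\<theta>, of w z] w(2) by metis
    ultimately show "y \<in> ball (\<theta> z) e - {\<theta> z}" using e'(3) w(2) by blast
  qed
  have q: "path q" "pathfinish q = pathstart q" "path_image q \<subseteq> ball (\<theta> z) e - {\<theta> z}"
    "winding_number q (\<theta> z) = 1"
    using u(2) by (auto simp: q_def winding_number_circlepath_centre)
  have "winding_number (reversepath q) (\<theta> z) = - 1" using q by (subst winding_number_reversepath) auto
  then have "winding_number ((\<phi> \<circ> k) \<circ> p) ((\<phi> \<circ> k) (\<theta> z)) = winding_number ((\<phi> \<circ> k) \<circ> reversepath q) ((\<phi> \<circ> k) (\<theta> z))"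
    using w[OF r(1,3)] q by (intro winding_number_compose[OF u(5,6) pp pl pim]) (simp_all add: p_def)
  also have "\<dots> = - winding_number ((\<phi> \<circ> k) \<circ> q) ((\<phi> \<circ> k) (\<theta> z))"
    unfolding path_compose_reversepath
  proof (rule winding_number_reversepath)
    show "path ((\<phi> \<circ> k) \<circ> q)" using q(1,3) u(5) by (intro path_continuous_image) (auto intro: continuous_on_subset)
    show "(\<phi> \<circ> k) (\<theta> z) \<notin> path_image ((\<phi> \<circ> k) \<circ> q)"
      using q(3) u(2) inj_onD[OF u(6), of "\<theta> z"] unfolding path_image_compose by force
  qed
  also have "\<dots> = - s" using u(7)[rule_format, of "e / 2" "\<theta> z"] u(2) by (simp add: q_def)
  finally have wn: "winding_number (\<phi> \<circ> (k \<circ> \<theta>) \<circ> circlepath z r) (\<phi> ((k \<circ> \<theta>) z)) = - s"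
    by (simp add: p_def comp_assoc)
  show ?thesis
  proof (rule ldegI[OF u(1) r(1,2)])
    show "(k \<circ> \<theta>) ` ball z e' \<subseteq> U" using e'(3) u(4) by auto
    have "continuous_on (\<theta> ` ball z e') (\<phi> \<circ> k)" using u(5) e'(3) by (rule continuous_on_subset)
    from continuous_on_compose[OF c\<theta> this] show "continuous_on (ball z e') (\<phi> \<circ> (k \<circ> \<theta>))"
      by (simp add: comp_assoc)
    have "inj_on (\<phi> \<circ> k) (\<theta> ` ball z e')" using u(6) e'(3) by (rule inj_on_subset)
    from comp_inj_on[OF i\<theta> this] show "inj_on (\<phi> \<circ> (k \<circ> \<theta>)) (ball z e')" by (simp add: comp_assoc)
  qed (rule wn)
qed

section \<open>Cells of a quadrilateral tiling\<close>

text \<open>Left in the unsimplified form of \<open>embedded_polygon\<close> with four corners, so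
  that both notions match on unfolding. The value at 4 is a full turn, hence corner 0 again.\<close>

definition ang :: "nat \<Rightarrow> real" where
  "ang j = 2 * pi * real j / 4"

definition side :: "nat \<Rightarrow> complex set" where
  "side j = cis ` {ang j<..<ang (Suc j)}"

lemma ang_less: "i < j \<Longrightarrow> ang i < ang j"
  by (simp add: ang_def divide_strict_right_mono)

lemma ang_le: "i \<le> j \<Longrightarrow> ang i \<le> ang j"
  by (simp add: ang_def divide_right_mono)

lemma ang_simps: "ang 0 = 0" "ang 4 = 2 * pi"
  by (simp_all add: ang_def)

lemma ang_bounds: "j < 4 \<Longrightarrow> 0 \<le> ang j \<and> ang j < 2 * pi \<and> ang (Suc j) \<le> 2 * pi"
  using ang_le[of 0 j] ang_less[of j 4] ang_le[of "Suc j" 4] by (simp add: ang_simps)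

lemma ang_Suc: "ang (Suc j) = ang j + pi / 2"
  by (simp add: ang_def field_simps)

lemma cis_eqD:
  assumes st: "\<bar>s - t\<bar> < 2 * pi" and "cis s = cis t"
  shows "s = t"
proof -
  have "sin s = sin t \<and> cos s = cos t" using assms(2) by (simp add: complex_eq_iff)
  then obtain n :: int where n: "s = t + 2 * pi * n" using sin_cos_eq_iff[of s t] by blast
  have "\<bar>2 * pi * of_int n\<bar> < 2 * pi" using st n by simp
  then have "\<bar>of_int n :: real\<bar> < 1" by (simp add: abs_mult)
  then have "n = 0" by linarith
  then show "s = t" using n by simp
qed

lemma cis_arc_eq:
  assumes "cis s = cis t" "i < 4" "j < 4" "s \<in> {ang i..<ang (Suc i)}" "t \<in> {ang j..<ang (Suc j)}"
  shows "s = t \<and> i = j"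
proof -
  have st: "s = t"
    using assms ang_bounds[of i] ang_bounds[of j] by (intro cis_eqD) auto
  have "\<not> i < j" "\<not> j < i" using assms(4,5) st ang_le[of "Suc i" j] ang_le[of "Suc j" i] by auto
  then show ?thesis using st by simp
qed

lemma sphere_cases:
  assumes "z \<in> sphere 0 (1::real)"
  shows "\<exists>j<4. z = cis (ang j) \<or> z \<in> side j"
proof -
  have "(Re z)\<^sup>2 + (Im z)\<^sup>2 = 1" using assms by (simp add: cmod_def)
  then obtain t where t: "0 \<le> t" "t < 2 * pi" "Re z = cos t" "Im z = sin t"
    using sincos_total_2pi by blast
  then have z: "z = cis t" by (simp add: complex_eq_iff)
  define j where "j = (GREATEST j. j < 4 \<and> ang j \<le> t)"
  have "(0::nat) < 4 \<and> ang 0 \<le> t" using t by (simp add: ang_simps)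
  then have j: "j < 4 \<and> ang j \<le> t"
    unfolding j_def by (rule GreatestI_nat[where b = 4]) auto
  have "t < ang (Suc j)"
  proof (cases "Suc j < 4")
    case True
    show ?thesis
    proof (rule ccontr)
      assume "\<not> ?thesis"
      then have "Suc j \<le> j"
        unfolding j_def using True[unfolded j_def] by (intro Greatest_le_nat[where b = 4]) auto
      then show False by simp
    qed
  next
    case False
    then have "Suc j = 4" using j by simp
    then show ?thesis using t by (simp add: ang_simps)
  qed
  then show ?thesis using j z unfolding side_def by (metis greaterThanLessThan_iff imageI le_less)
qed

section \<open>Tiles parametrized by the closed disc\<close>

locale quad_surface =
  fixes T :: "'a tiling"
  assumes tiling: "quadrilateral_tiling T"
begin

abbreviation "X \<equiv> surface T"
abbreviation "V \<equiv> vertices T"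
abbreviation "E \<equiv> edges T"
abbreviation "F \<equiv> faces T"
abbreviation "cl c \<equiv> X closure_of c"

lemma cellular: "cellular_decomposition T" and surf: "closed_connected_surface X"
  and polygons: "f \<in> F \<Longrightarrow> embedded_polygon T 4 f"
  using tiling unfolding quadrilateral_tiling_def polygonal_subdivision_def by auto

lemma surface_facts: "compact_space X" "connected_space X" "Hausdorff_space X" "planar X"
  using surf unfolding closed_connected_surface_def planar_def by auto

lemma finite_cells: "finite V" "finite E" "finite F"
  using cellular unfolding cellular_decomposition_def by auto

lemma cells_cover: "V \<union> \<Union>E \<union> \<Union>F = topspace X"
  using cellular unfolding cellular_decomposition_def by auto

lemma cells_disjoint:
  "v \<in> V \<Longrightarrow> e \<in> E \<Longrightarrow> v \<notin> e" "v \<in> V \<Longrightarrow> f \<in> F \<Longrightarrow> v \<notin> f"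
  "e \<in> E \<Longrightarrow> f \<in> F \<Longrightarrow> p \<in> e \<Longrightarrow> p \<notin> f"
  "e \<in> E \<Longrightarrow> e' \<in> E \<Longrightarrow> p \<in> e \<Longrightarrow> p \<in> e' \<Longrightarrow> e = e'"
  "f \<in> F \<Longrightarrow> f' \<in> F \<Longrightarrow> p \<in> f \<Longrightarrow> p \<in> f' \<Longrightarrow> f = f'"
proof -
  have c: "disjoint E" "disjoint F" "V \<inter> \<Union>E = {}" "V \<inter> \<Union>F = {}" "\<Union>E \<inter> \<Union>F = {}"
    using cellular unfolding cellular_decomposition_def by auto
  show "v \<in> V \<Longrightarrow> e \<in> E \<Longrightarrow> v \<notin> e" using c(3) by blast
  show "v \<in> V \<Longrightarrow> f \<in> F \<Longrightarrow> v \<notin> f" using c(4) by blast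
  show "e \<in> E \<Longrightarrow> f \<in> F \<Longrightarrow> p \<in> e \<Longrightarrow> p \<notin> f" using c(5) by blast
  show "e \<in> E \<Longrightarrow> e' \<in> E \<Longrightarrow> p \<in> e \<Longrightarrow> p \<in> e' \<Longrightarrow> e = e'" using c(1) unfolding disjoint_def by blast
  show "f \<in> F \<Longrightarrow> f' \<in> F \<Longrightarrow> p \<in> f \<Longrightarrow> p \<in> f' \<Longrightarrow> f = f'" using c(2) unfolding disjoint_def by blast
qed

lemma edge_map:
  assumes "e \<in> E"
  obtains g :: "real \<Rightarrow> 'a" where "continuous_map (top_of_set {0..1}) X g"
    "homeomorphic_map (top_of_set {0<..<1}) (subtopology X e) g" "g 0 \<in> V" "g 1 \<in> V" "g ` {0<..<1} = e"
proof -
  have "\<forall>e\<in>E. \<exists>g::real \<Rightarrow> 'a. continuous_map (top_of_set {0..1}) X g \<and>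
      homeomorphic_map (top_of_set {0<..<1}) (subtopology X e) g \<and> g 0 \<in> V \<and> g 1 \<in> V"
    using cellular unfolding cellular_decomposition_def by (elim conjE)
  from bspec[OF this assms] obtain g :: "real \<Rightarrow> 'a" where g: "continuous_map (top_of_set {0..1}) X g"
    "homeomorphic_map (top_of_set {0<..<1}) (subtopology X e) g" "g 0 \<in> V" "g 1 \<in> V"
    by (elim exE conjE)
  have "e \<subseteq> topspace X" using cells_cover assms by blast
  then have "g ` {0<..<1} = e" using homeomorphic_imp_surjective_map[OF g(2)] by (simp add: Int_absorb1)
  then show thesis using g that by blast
qed

lemma edge_nonempty: "e \<in> E \<Longrightarrow> e \<noteq> {}"
proof -
  assume "e \<in> E"
  then obtain g :: "real \<Rightarrow> 'a" where "g ` {0<..<1} = e" by (rule edge_map)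
  moreover have "(1/2::real) \<in> {0<..<1}" by simp
  ultimately show ?thesis by blast
qed

text \<open>The image of the closed interval is compact, hence closed in the Hausdorff surface, and
  exceeds \<open>e\<close> by vertices only.\<close>

lemma closure_edge_subset:
  assumes "e \<in> E"
  shows "cl e \<subseteq> e \<union> V"
proof -
  obtain g :: "real \<Rightarrow> 'a" where g: "continuous_map (top_of_set {0..1}) X g" "g 0 \<in> V" "g 1 \<in> V" "g ` {0<..<1} = e"
    using edge_map[OF assms] by metis
  have "compactin X (g ` {0..1})"
    by (rule image_compactin[OF _ g(1)]) (simp add: compactin_subtopology)
  then have "closedin X (g ` {0..1})" by (rule compactin_imp_closedin[OF surface_facts(3)])
  moreover have I: "{0..1::real} = {0<..<1} \<union> {0, 1}" by auto
  have "g ` {0..1} = e \<union> {g 0, g 1}" unfolding I image_Un g(4) by simp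
  ultimately have "cl e \<subseteq> e \<union> {g 0, g 1}" by (metis closure_of_minimal Un_upper1)
  then show ?thesis using g by blast
qed

definition pmap :: "'a set \<Rightarrow> (complex \<Rightarrow> 'a) \<Rightarrow> bool" where
  "pmap f h \<longleftrightarrow> f \<in> F \<and> homeomorphic_map (top_of_set (cball 0 1)) (subtopology X (cl f)) h \<and>
     h ` ball 0 1 = f \<and> (\<forall>j<4. h (cis (ang j)) \<in> V \<and> h ` side j \<in> E)"

lemma pmap_exists: "f \<in> F \<Longrightarrow> \<exists>h. pmap f h"
  using polygons[of f] unfolding embedded_polygon_def pmap_def ang_def side_def of_nat_numeral by blast

lemma pmapD:
  assumes "pmap f h"
  shows "f \<in> F" "continuous_map (top_of_set (cball 0 1)) X h" "inj_on h (cball 0 1)" "h ` cball 0 1 = cl f"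
    "h ` ball 0 1 = f" "\<And>j. j < 4 \<Longrightarrow> h (cis (ang j)) \<in> V" "\<And>j. j < 4 \<Longrightarrow> h ` side j \<in> E"
    "homeomorphic_map (top_of_set (cball 0 1)) (subtopology X (cl f)) h"
proof -
  show hm: "homeomorphic_map (top_of_set (cball 0 1)) (subtopology X (cl f)) h"
    and "f \<in> F" "h ` ball 0 1 = f" "\<And>j. j < 4 \<Longrightarrow> h (cis (ang j)) \<in> V" "\<And>j. j < 4 \<Longrightarrow> h ` side j \<in> E"
    using assms unfolding pmap_def by auto
  show "continuous_map (top_of_set (cball 0 1)) X h"
    using homeomorphic_imp_continuous_map[OF hm] by (simp add: continuous_map_in_subtopology)
  show "inj_on h (cball 0 1)" using homeomorphic_imp_injective_map[OF hm] by simp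
  show "h ` cball 0 1 = cl f"
    using homeomorphic_imp_surjective_map[OF hm] closure_of_subset_topspace[of X f] by (simp add: Int_absorb1)
qed

lemma cis_in_cball: "cis t \<in> cball 0 1"
  by simp

lemma face_nonempty: "f \<in> F \<Longrightarrow> f \<noteq> {}"
  using pmap_exists pmapD(5) by fastforce

lemma pmap_cases:
  assumes h: "pmap f h" and p: "p \<in> cl f"
  shows "p \<in> f \<or> (\<exists>j<4. p = h (cis (ang j))) \<or> (\<exists>j<4. p \<in> h ` side j)"
proof -
  obtain z where z: "z \<in> cball 0 1" "p = h z" using p pmapD(4)[OF h] by blast
  show ?thesis
  proof (cases "z \<in> ball 0 1")
    case True
    then show ?thesis using pmapD(5)[OF h] z by blast
  next
    case False
    then have "z \<in> sphere 0 1" using z by simp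
    then show ?thesis using sphere_cases z by blast
  qed
qed

text \<open>The closed tile is made of its open cell, four corners and four sides. Since cells are
  disjoint, one common point already identifies \<open>e\<close> with a side.\<close>

lemma edge_of_face:
  assumes h: "pmap f h" and e: "e \<in> E" "p \<in> e" "p \<in> cl f"
  obtains j where "j < 4" "e = h ` side j"
proof -
  have "p \<notin> f" using cells_disjoint(3)[OF e(1) pmapD(1)[OF h] e(2)] .
  moreover have "p \<noteq> h (cis (ang j))" if "j < 4" for j
    using cells_disjoint(1)[OF pmapD(6)[OF h that] e(1)] e(2) by blast
  ultimately obtain j where j: "j < 4" "p \<in> h ` side j" using pmap_cases[OF h e(3)] by blast
  then have "e = h ` side j" using cells_disjoint(4)[OF e(1) pmapD(7)[OF h]] e(2) by blast
  then show thesis using that j(1) by blast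
qed

lemma side_subset: "side j \<subseteq> cball 0 1" "side j \<subseteq> sphere 0 1"
  unfolding side_def by auto

lemma side_nonempty: "cis (ang j + pi / 4) \<in> side j"
  unfolding side_def ang_Suc by (intro imageI) simp

lemma pmap_edge_inj:
  assumes h: "pmap f h" and ij: "i < 4" "j < 4" and eq: "h ` side i = h ` side j"
  shows "i = j"
proof -
  let ?s = "ang i + pi / 4"
  have "h (cis ?s) \<in> h ` side j" using side_nonempty[of i] eq by blast
  then obtain t where t: "t \<in> {ang j<..<ang (Suc j)}" "h (cis ?s) = h (cis t)" unfolding side_def by blast
  have "cis ?s = cis t" using inj_onD[OF pmapD(3)[OF h] t(2)] by simp
  then show ?thesis using cis_arc_eq[of ?s t i j] ij t(1) by (simp add: ang_Suc)
qed

lemma pmap_vertex_inj: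
  assumes h: "pmap f h" and ij: "i < 4" "j < 4" and eq: "h (cis (ang i)) = h (cis (ang j))"
  shows "i = j"
proof -
  have "cis (ang i) = cis (ang j)" using inj_onD[OF pmapD(3)[OF h] eq] by simp
  then show ?thesis using cis_arc_eq[of "ang i" "ang j" i j] ij by (simp add: ang_less)
qed

lemma closure_pmap_edge:
  assumes h: "pmap f h" and j: "j < 4"
  shows "cl (h ` side j) = h ` cis ` {ang j..ang (Suc j)}"
proof
  have lt: "ang j < ang (Suc j)" by (rule ang_less) simp
  have "continuous_map (top_of_set {ang j..ang (Suc j)}) (top_of_set (cball 0 1)) cis"
    by (simp add: continuous_map_in_subtopology continuous_on_cis image_subset_iff)
  then have c: "continuous_map (top_of_set {ang j..ang (Suc j)}) X (h \<circ> cis)"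
    using pmapD(2)[OF h] by (rule continuous_map_compose)
  have "compactin X ((h \<circ> cis) ` {ang j..ang (Suc j)})"
    by (rule image_compactin[OF _ c]) (simp add: compactin_subtopology)
  then have "closedin X ((h \<circ> cis) ` {ang j..ang (Suc j)})" by (rule compactin_imp_closedin[OF surface_facts(3)])
  moreover have "h ` side j \<subseteq> (h \<circ> cis) ` {ang j..ang (Suc j)}" unfolding side_def by auto
  ultimately show "cl (h ` side j) \<subseteq> h ` cis ` {ang j..ang (Suc j)}"
    unfolding image_comp by (rule closure_of_minimal[rotated])
  have "top_of_set {ang j..ang (Suc j)} closure_of {ang j<..<ang (Suc j)} = {ang j..ang (Suc j)}"
  proof -
    have "{ang j..ang (Suc j)} \<inter> {ang j<..<ang (Suc j)} = {ang j<..<ang (Suc j)}" by auto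
    then show ?thesis using lt by (simp add: closure_of_subtopology closure_greaterThanLessThan)
  qed
  then have "(h \<circ> cis) ` {ang j..ang (Suc j)} \<subseteq> cl ((h \<circ> cis) ` {ang j<..<ang (Suc j)})"
    using continuous_map_image_closure_subset[OF c, of "{ang j<..<ang (Suc j)}"] by simp
  then show "h ` cis ` {ang j..ang (Suc j)} \<subseteq> cl (h ` side j)" unfolding side_def image_comp .
qed

lemma closure_interval_cases: "{ang j..ang (Suc j)} = {ang j<..<ang (Suc j)} \<union> {ang j, ang (Suc j)}"
  using ang_less[of j "Suc j"] by auto

lemma vt_Suc_in:
  assumes h: "pmap f h" and j: "j < 4"
  shows "h (cis (ang (Suc j))) \<in> V"
proof (cases "Suc j < 4")
  case True
  then show ?thesis by (rule pmapD(6)[OF h])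
next
  case False
  then have "Suc j = 4" using j by simp
  then have "cis (ang (Suc j)) = cis (ang 0)" by (simp add: ang_simps)
  then show ?thesis using pmapD(6)[OF h, of 0] by simp
qed

lemma vertices_of_pmap_edge:
  assumes h: "pmap f h" and j: "j < 4"
  shows "vertices_of T (h ` side j) = {h (cis (ang j)), h (cis (ang (Suc j)))}"
proof -
  have "cl (h ` side j) = h ` side j \<union> {h (cis (ang j)), h (cis (ang (Suc j)))}"
    unfolding closure_pmap_edge[OF h j] closure_interval_cases image_Un by (simp add: side_def)
  moreover have "V \<inter> h ` side j = {}" using cells_disjoint(1)[OF _ pmapD(7)[OF h j]] by blast
  ultimately show ?thesis
    unfolding vertices_of_def using pmapD(6)[OF h j] vt_Suc_in[OF h j] by auto
qed

lemma vertices_of_face: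
  assumes h: "pmap f h"
  shows "vertices_of T f = (\<lambda>j. h (cis (ang j))) ` {..<4}"
proof
  show "vertices_of T f \<subseteq> (\<lambda>j. h (cis (ang j))) ` {..<4}"
  proof
    fix v assume "v \<in> vertices_of T f"
    then have v: "v \<in> V" "v \<in> cl f" by (auto simp: vertices_of_def)
    have "v \<notin> f" using cells_disjoint(2)[OF v(1) pmapD(1)[OF h]] .
    moreover have "v \<notin> h ` side j" if "j < 4" for j using cells_disjoint(1)[OF v(1) pmapD(7)[OF h that]] .
    ultimately show "v \<in> (\<lambda>j. h (cis (ang j))) ` {..<4}" using pmap_cases[OF h v(2)] by auto
  qed
  show "(\<lambda>j. h (cis (ang j))) ` {..<4} \<subseteq> vertices_of T f"
    unfolding vertices_of_def using pmapD(6)[OF h] pmapD(4)[OF h] cis_in_cball by blast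
qed

lemma pmap_edge_subset: "pmap f h \<Longrightarrow> h ` side j \<subseteq> cl f"
  using pmapD(4)[of f h] side_subset(1) by blast

lemma edge_in_closure_face:
  assumes "f \<in> F" "e \<in> E" "p \<in> e" "p \<in> cl f"
  shows "e \<subseteq> cl f"
proof -
  obtain h where h: "pmap f h" using pmap_exists assms(1) by blast
  show ?thesis using edge_of_face[OF h assms(2-4)] pmap_edge_subset[OF h] by metis
qed

section \<open>The closure order of the cells\<close>

definition cells :: "'a set set" where
  "cells = (\<lambda>v. {v}) ` V \<union> E \<union> F"

lemma cells_partition:
  assumes "c \<in> cells" "c' \<in> cells" "p \<in> c" "p \<in> c'"
  shows "c = c'"
proof -
  have *: "(p \<in> V \<and> c = {p}) \<or> c \<in> E \<or> c \<in> F" if "c \<in> cells" "p \<in> c" for c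
    using that by (auto simp: cells_def)
  note c' = *[OF assms(2,4)]
  from *[OF assms(1,3)] show ?thesis
  proof (elim disjE)
    assume "p \<in> V \<and> c = {p}"
    then show ?thesis
      using c' cells_disjoint(1)[of p c'] cells_disjoint(2)[of p c'] assms(4) by auto
  next
    assume "c \<in> E"
    then show ?thesis
      using c' cells_disjoint(1)[of p c] cells_disjoint(4)[of c c' p] cells_disjoint(3)[of c c' p] assms(3,4) by auto
  next
    assume "c \<in> F"
    then show ?thesis
      using c' cells_disjoint(2)[of p c] cells_disjoint(5)[of c c' p] cells_disjoint(3)[of c' c p] assms(3,4) by auto
  qed
qed

lemma Union_cells: "\<Union>cells = topspace X"
  using cells_cover unfolding cells_def by auto

lemma closure_vertex:
  assumes "v \<in> V"
  shows "cl {v} = {v}"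
proof -
  have "v \<in> topspace X" using cells_cover assms by blast
  then have "closedin X {v}" by (simp add: closedin_Hausdorff_singleton surface_facts(3))
  then show ?thesis by (rule closure_of_closedin)
qed

text \<open>This is the frontier condition. For an edge it holds because the closure adds vertices
  only; for a tile, because its boundary consists of whole sides and corners.\<close>

lemma cell_closure:
  assumes c: "c \<in> cells" "c' \<in> cells" and p: "p \<in> c'" "p \<in> cl c"
  shows "c' \<subseteq> cl c"
proof -
  have sub: "c \<subseteq> cl c" using c(1) Union_cells by (intro closure_of_subset) blast
  consider v where "v \<in> V" "c = {v}" | "c \<in> E" | "c \<in> F" using c(1) unfolding cells_def by blast
  then show ?thesis
  proof cases
    case 1
    then have "p \<in> c" using p(2) closure_vertex by simp
    then show ?thesis using cells_partition[OF c p(1)[THEN rev_mp]] sub cells_partition[OF c(2) c(1) p(1)] by blast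
  next
    case 2
    show ?thesis
    proof (cases "p \<in> c")
      case True
      then show ?thesis using cells_partition[OF c(2,1) p(1)] sub by blast
    next
      case False
      then have "p \<in> V" using closure_edge_subset[OF 2] p(2) by blast
      then have "c' = {p}" using cells_partition[OF c(2) _ p(1), of "{p}"] by (simp add: cells_def)
      then show ?thesis using p(2) by blast
    qed
  next
    case 3
    consider v where "v \<in> V" "c' = {v}" | "c' \<in> E" | "c' \<in> F" using c(2) unfolding cells_def by blast
    then show ?thesis
    proof cases
      case 1
      then show ?thesis using p by blast
    next
      case 2
      then show ?thesis using edge_in_closure_face[OF 3 2 p] by blast
    next
      case f': 3
      obtain h where h: "pmap c h" using pmap_exists 3 by blast
      have "p \<notin> h ` side j" if "j < 4" for j using cells_disjoint(3)[OF pmapD(7)[OF h that] f'] p(1) by blast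
      moreover have "p \<noteq> h (cis (ang j))" if "j < 4" for j using cells_disjoint(2)[OF pmapD(6)[OF h that] f'] p(1) by blast
      ultimately have "p \<in> c" using pmap_cases[OF h p(2)] by blast
      then show ?thesis using cells_partition[OF c(2,1) p(1)] sub by blast
    qed
  qed
qed

text \<open>The complement is the finite union of the closures of the other cells, none of which
  reaches \<open>S\<close>. Open stars of edges and vertices are obtained from the closure order in
  this way.\<close>

lemma open_upset:
  assumes S: "S \<subseteq> cells" "\<And>c c'. c \<in> S \<Longrightarrow> c' \<in> cells \<Longrightarrow> c \<subseteq> cl c' \<Longrightarrow> c' \<in> S"
  shows "openin X (\<Union>S)"
proof -
  have fin: "finite cells" unfolding cells_def using finite_cells by simp
  have cS: "cl c \<inter> \<Union>S = {}" if "c \<in> cells - S" for c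
  proof (rule ccontr)
    assume "\<not> ?thesis"
    then obtain p c' where "p \<in> cl c" "p \<in> c'" "c' \<in> S" by blast
    then show False using cell_closure[of c c' p] S that by blast
  qed
  have sub: "c \<subseteq> cl c" if "c \<in> cells" for c using that Union_cells by (intro closure_of_subset) blast
  have "\<Union>S = topspace X - (\<Union>c\<in>cells - S. cl c)"
  proof
    show "\<Union>S \<subseteq> topspace X - (\<Union>c\<in>cells - S. cl c)" using cS S(1) Union_cells by blast
    show "topspace X - (\<Union>c\<in>cells - S. cl c) \<subseteq> \<Union>S"
    proof
      fix p assume p: "p \<in> topspace X - (\<Union>c\<in>cells - S. cl c)"
      then obtain c where c: "c \<in> cells" "p \<in> c" using Union_cells by blast
      then have "p \<in> cl c" using sub by blast
      then have "c \<in> S" using p c(1) by blast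
      then show "p \<in> \<Union>S" using c(2) by blast
    qed
  qed
  moreover have "closedin X (\<Union>c\<in>cells - S. cl c)"
    using fin by (intro closedin_Union) auto
  ultimately show ?thesis by (simp add: openin_diff)
qed

lemma face_maximal: "f \<in> F \<Longrightarrow> c \<in> cells \<Longrightarrow> f \<subseteq> cl c \<Longrightarrow> c = f"
proof -
  assume f: "f \<in> F" and c: "c \<in> cells" and sub: "f \<subseteq> cl c"
  have fc: "f \<in> cells" using f by (simp add: cells_def)
  obtain p where p: "p \<in> f" using face_nonempty[OF f] by blast
  consider v where "v \<in> V" "c = {v}" | "c \<in> E" | "c \<in> F" using c unfolding cells_def by blast
  then show "c = f"
  proof cases
    case 1
    then show ?thesis using closure_vertex sub p cells_disjoint(2)[OF _ f, of v] by auto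
  next
    case 2
    then show ?thesis using closure_edge_subset[OF 2] sub p cells_disjoint(2)[OF _ f, of p] cells_disjoint(3)[OF 2 f, of p] by blast
  next
    case 3
    obtain h where h: "pmap c h" using pmap_exists 3 by blast
    have "p \<notin> h ` side j" if "j < 4" for j using cells_disjoint(3)[OF pmapD(7)[OF h that] f] p by blast
    moreover have "p \<noteq> h (cis (ang j))" if "j < 4" for j using cells_disjoint(2)[OF pmapD(6)[OF h that] f] p by blast
    ultimately have "p \<in> c" using pmap_cases[OF h, of p] p sub by blast
    then show ?thesis using cells_partition[OF c fc] p by blast
  qed
qed

lemma edge_below: "e \<in> E \<Longrightarrow> c \<in> cells \<Longrightarrow> e \<subseteq> cl c \<Longrightarrow> c = e \<or> c \<in> F"
proof -
  assume e: "e \<in> E" and c: "c \<in> cells" and sub: "e \<subseteq> cl c"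
  obtain p where p: "p \<in> e" using edge_nonempty[OF e] by blast
  have pV: "p \<notin> V" using cells_disjoint(1)[OF _ e] p by blast
  consider v where "v \<in> V" "c = {v}" | "c \<in> E" | "c \<in> F" using c unfolding cells_def by blast
  then show "c = e \<or> c \<in> F"
  proof cases
    case 1
    then show ?thesis using closure_vertex sub p pV by auto
  next
    case 2
    then show ?thesis using closure_edge_subset[OF 2] sub p pV cells_disjoint(4)[OF 2 e, of p] by blast
  qed simp
qed

lemma open_edge_star:
  assumes e: "e \<in> E"
  shows "openin X (e \<union> \<Union>{f \<in> F. e \<subseteq> cl f})"
proof -
  have "openin X (\<Union>(insert e {f \<in> F. e \<subseteq> cl f}))"
  proof (rule open_upset)
    show "insert e {f \<in> F. e \<subseteq> cl f} \<subseteq> cells" using e by (auto simp: cells_def)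
    fix c c' assume "c \<in> insert e {f \<in> F. e \<subseteq> cl f}" "c' \<in> cells" "c \<subseteq> cl c'"
    then show "c' \<in> insert e {f \<in> F. e \<subseteq> cl f}"
      using edge_below[OF e, of c'] face_maximal[of c c'] by auto
  qed
  then show ?thesis by simp
qed

text \<open>Otherwise the edge would be open in the surface, and its real coordinate, viewed as a
  complex number, would have an open image within the real axis.\<close>

lemma edge_in_some_face:
  assumes e: "e \<in> E"
  shows "\<exists>f\<in>F. e \<subseteq> cl f"
proof (rule ccontr)
  assume "\<not> ?thesis"
  then have none: "{f \<in> F. e \<subseteq> cl f} = {}" by blast
  have op: "openin X e" using open_edge_star[OF e] unfolding none by simp
  obtain g :: "real \<Rightarrow> 'a" where g: "homeomorphic_map (top_of_set {0<..<1}) (subtopology X e) g" "g ` {0<..<1} = e"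
    using edge_map[OF e] by metis
  obtain k where k: "homeomorphic_maps (top_of_set {0<..<1}) (subtopology X e) g k"
    using g(1) homeomorphic_map_maps by blast
  have eX: "topspace (subtopology X e) = e" using openin_subset[OF op] by (simp add: Int_absorb1)
  have kc: "continuous_map (subtopology X e) euclideanreal k" and gk: "\<And>y. y \<in> e \<Longrightarrow> g (k y) = y"
    using k eX unfolding homeomorphic_maps_def continuous_map_in_subtopology by auto
  have "continuous_map euclideanreal euclidean (complex_of_real)" by (simp add: continuous_on_of_real_id)
  from continuous_map_compose[OF kc this] have c: "continuous_map (subtopology X e) euclidean (complex_of_real \<circ> k)" .
  have "inj_on (complex_of_real \<circ> k) e" using gk by (intro inj_onI) (metis comp_apply of_real_eq_iff)
  then have "open ((complex_of_real \<circ> k) ` e)" using open_injective_image[OF surface_facts(4) c _ op] by blast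
  moreover have "(complex_of_real \<circ> k) ` e \<noteq> {}" using edge_nonempty[OF e] by blast
  ultimately obtain z d where z: "d > 0" "ball z d \<subseteq> (complex_of_real \<circ> k) ` e"
    by (metis ex_in_conv open_contains_ball)
  have "(complex_of_real \<circ> k) ` e \<subseteq> \<real>" by auto
  moreover have "z \<in> ball z d" "z + \<i> * of_real (d / 2) \<in> ball z d"
    using z(1) by (simp_all add: dist_norm norm_mult)
  ultimately have "z \<in> \<real>" "z + \<i> * of_real (d / 2) \<in> \<real>" using z(2) by blast+
  then have "Im (z + \<i> * of_real (d / 2)) = 0" "Im z = 0" by (simp_all add: complex_is_Real_iff)
  then show False using z(1) by simp
qed

text \<open>Otherwise the tile with this side attached would be open. The inverse parametrization
  would send it onto an open subset of the closed disc, hence into the open disc, although the side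
  lies on the circle.\<close>

lemma edge_in_second_face:
  assumes e: "e \<in> E" and f: "f \<in> F" "e \<subseteq> cl f"
  shows "\<exists>f'\<in>F. f' \<noteq> f \<and> e \<subseteq> cl f'"
proof (rule ccontr)
  assume "\<not> ?thesis"
  then have "{f \<in> F. e \<subseteq> cl f} = {f}" using f by blast
  then have op: "openin X (e \<union> f)" using open_edge_star[OF e] by simp
  obtain h where h: "pmap f h" using pmap_exists f by blast
  have fcl: "f \<subseteq> cl f" using pmapD(4,5)[OF h] by auto
  obtain k where k: "homeomorphic_maps (top_of_set (cball 0 1)) (subtopology X (cl f)) h k"
    using pmapD(8)[OF h] homeomorphic_map_maps by blast
  have ts: "topspace (subtopology X (cl f)) = cl f" using closure_of_subset_topspace[of X f] by auto
  have kc: "continuous_map (subtopology X (cl f)) euclidean k" and hk: "\<And>y. y \<in> cl f \<Longrightarrow> h (k y) = y"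
    and kcb: "\<And>y. y \<in> cl f \<Longrightarrow> k y \<in> cball 0 1" and kh: "\<And>z. z \<in> cball 0 1 \<Longrightarrow> k (h z) = z"
    using k ts unfolding homeomorphic_maps_def continuous_map_in_subtopology by auto
  have sub: "e \<union> f \<subseteq> cl f" using f(2) fcl by blast
  have "continuous_map (subtopology X (e \<union> f)) euclidean k"
    by (rule continuous_map_from_subtopology_mono[OF kc sub])
  moreover have "inj_on k (e \<union> f)" using hk sub by (metis inj_onI subsetD)
  ultimately have "open (k ` (e \<union> f))" using open_injective_image[OF surface_facts(4) _ _ op] by blast
  moreover have "k ` (e \<union> f) \<subseteq> cball 0 1" using kcb sub by blast
  ultimately have i: "k ` (e \<union> f) \<subseteq> ball 0 1" by (metis interior_cball interior_maximal)
  obtain p where p: "p \<in> e" using edge_nonempty[OF e] by blast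
  then have "p \<in> cl f" using f(2) by blast
  then obtain j where "j < 4" and j: "e = h ` side j" by (rule edge_of_face[OF h e p])
  then obtain z where z: "z \<in> side j" "p = h z" using p by blast
  then have "k p = z" using kh side_subset(1) by blast
  then show False using i p z(1) side_subset(2)[of j] by fastforce
qed

end

section \<open>Gluing two tiles along an edge\<close>

lemma exp_in_ball: "Re \<zeta> < 0 \<Longrightarrow> exp \<zeta> \<in> ball 0 1" "Re \<zeta> \<le> 0 \<Longrightarrow> exp \<zeta> \<in> cball 0 1"
  by simp_all

lemma exp_Complex_0: "exp (Complex 0 t) = cis t"
  by (simp add: exp_eq_polar)

lemma side_width:
  assumes "t \<in> {ang i..ang (Suc i)}" "u \<in> {ang i..ang (Suc i)}"
  shows "\<bar>t - u\<bar> < 2 * pi"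
proof -
  have "ang i \<le> t" "t \<le> ang i + pi / 2" "ang i \<le> u" "u \<le> ang i + pi / 2"
    using assms unfolding ang_Suc by simp_all
  then show ?thesis using pi_gt_zero by linarith
qed

lemma open_strip: "open {\<zeta>. Im \<zeta> \<in> {a<..<b}}"
proof -
  have "{\<zeta>. Im \<zeta> \<in> {a<..<b}} = {\<zeta>. a < Im \<zeta>} \<inter> {\<zeta>. Im \<zeta> < b}" by auto
  then show ?thesis by (simp add: open_Int open_halfspace_Im_gt open_halfspace_Im_lt)
qed

lemma connected_strip: "connected {\<zeta>. Im \<zeta> \<in> {a<..<b}}"
proof -
  have "{\<zeta>. Im \<zeta> \<in> {a<..<b}} = {\<zeta>. Im \<zeta> > a} \<inter> {\<zeta>. Im \<zeta> < b}" by auto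
  moreover have "convex ({\<zeta>. Im \<zeta> > a} \<inter> {\<zeta>. Im \<zeta> < b})"
    by (intro convex_Int convex_halfspace_Im_gt convex_halfspace_Im_lt)
  ultimately show ?thesis by (simp only: convex_connected)
qed

context quad_surface
begin

lemma pmap_arc_homeomorphic:
  assumes h: "pmap f h" and j: "j < 4"
  shows "homeomorphic_map (top_of_set {ang j..ang (Suc j)}) (subtopology X (cl (h ` side j))) (h \<circ> cis)"
proof (rule continuous_imp_homeomorphic_map)
  let ?I = "{ang j..ang (Suc j)}"
  have im: "(h \<circ> cis) ` ?I = cl (h ` side j)" unfolding closure_pmap_edge[OF h j] image_comp ..
  have "continuous_map (top_of_set ?I) (top_of_set (cball 0 1)) cis"
    by (simp add: continuous_map_in_subtopology continuous_on_cis image_subset_iff)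
  then have "continuous_map (top_of_set ?I) X (h \<circ> cis)"
    using pmapD(2)[OF h] by (rule continuous_map_compose)
  then show "continuous_map (top_of_set ?I) (subtopology X (cl (h ` side j))) (h \<circ> cis)"
    unfolding continuous_map_in_subtopology using im by auto
  show "compact_space (top_of_set ?I)" by (simp add: compact_space_subtopology)
  show "Hausdorff_space (subtopology X (cl (h ` side j)))"
    by (rule Hausdorff_space_subtopology[OF surface_facts(3)])
  show "(h \<circ> cis) ` topspace (top_of_set ?I) = topspace (subtopology X (cl (h ` side j)))"
    using im closure_of_subset_topspace[of X "h ` side j"] by (simp add: Int_absorb1)
  show "inj_on (h \<circ> cis) (topspace (top_of_set ?I))"
  proof (rule inj_onI)
    fix s t assume s: "s \<in> topspace (top_of_set ?I)" "t \<in> topspace (top_of_set ?I)" "(h \<circ> cis) s = (h \<circ> cis) t"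
    then have "cis s = cis t" using inj_onD[OF pmapD(3)[OF h], of "cis s" "cis t"] by simp
    moreover have "\<bar>s - t\<bar> < 2 * pi" using s(1,2) by (intro side_width) simp_all
    ultimately show "s = t" by (intro cis_eqD)
  qed
qed

text \<open>Near a common edge, two faces are glued along the imaginary axis of the logarithmic
  coordinate; \<open>s\<close> matches the two parametrizations of the edge.\<close>

lemma glue:
  assumes h1: "pmap f1 h1" and h2: "pmap f2 h2" and ne: "f1 \<noteq> f2" and j: "j1 < 4" "j2 < 4"
    and e: "h1 ` side j1 = h2 ` side j2"
  defines "I \<equiv> {ang j1..ang (Suc j1)}" and "I' \<equiv> {ang j1<..<ang (Suc j1)}"
  defines "S \<equiv> {\<zeta>. Im \<zeta> \<in> I'}"
  shows "\<exists>s k. continuous_on I s \<and> inj_on s I \<and> s ` I \<subseteq> {ang j2..ang (Suc j2)} \<and> (\<forall>t\<in>I. h2 (cis (s t)) = h1 (cis t)) \<and>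
    continuous_map (top_of_set S) X k \<and> inj_on k S \<and> k ` S \<subseteq> f1 \<union> h1 ` side j1 \<union> f2 \<and>
    (\<forall>\<zeta>\<in>S. Re \<zeta> \<le> 0 \<longrightarrow> k \<zeta> = h1 (exp \<zeta>)) \<and>
    (\<forall>\<zeta>\<in>S. 0 \<le> Re \<zeta> \<longrightarrow> k \<zeta> = h2 (exp (Complex (- Re \<zeta>) (s (Im \<zeta>)))))"
proof -
  let ?J = "{ang j2..ang (Suc j2)}"
  have e1: "h1 ` side j1 \<in> E" using pmapD(7)[OF h1 j(1)] .
  have f: "f1 \<in> F" "f2 \<in> F" using h1 h2 by (auto dest: pmapD(1))
  have II': "I' \<subseteq> I" by (auto simp: I_def I'_def)
  obtain g2 where g2: "homeomorphic_maps (top_of_set ?J) (subtopology X (cl (h2 ` side j2))) (h2 \<circ> cis) g2"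
    using pmap_arc_homeomorphic[OF h2 j(2)] homeomorphic_map_maps by blast
  have hm1: "homeomorphic_map (top_of_set I) (subtopology X (cl (h2 ` side j2))) (h1 \<circ> cis)"
    using pmap_arc_homeomorphic[OF h1 j(1)] unfolding e I_def .
  have ts: "topspace (subtopology X (cl (h2 ` side j2))) = cl (h2 ` side j2)"
    using closure_of_subset_topspace[of X "h2 ` side j2"] by auto
  \<comment> \<open>The edge is traced by \<open>h1\<close> and read off by \<open>g2\<close>, the
    inverse of its parametrization by \<open>h2\<close>.\<close>
  define s where "s = g2 \<circ> (h1 \<circ> cis)"
  have h1I: "h1 (cis t) \<in> cl (h2 ` side j2)" if "t \<in> I" for t
    using homeomorphic_imp_surjective_map[OF hm1] ts that by auto
  have sc: "continuous_map (top_of_set I) (top_of_set ?J) s"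
    unfolding s_def using g2
    by (intro continuous_map_compose[OF homeomorphic_imp_continuous_map[OF hm1]]) (simp only: homeomorphic_maps_def)
  then have s_cont: "continuous_on I s" and sJ: "s ` I \<subseteq> ?J"
    by (auto simp: continuous_map_in_subtopology)
  have hs: "h2 (cis (s t)) = h1 (cis t)" if "t \<in> I" for t
    using g2 ts h1I[OF that] unfolding homeomorphic_maps_def s_def by simp
  have s_inj: "inj_on s I"
  proof (rule inj_onI)
    fix t u assume t: "t \<in> I" "u \<in> I" "s t = s u"
    then have "(h1 \<circ> cis) t = (h1 \<circ> cis) u" using hs[of t] hs[of u] by simp
    then show "t = u" using inj_onD[OF homeomorphic_imp_injective_map[OF hm1], of t u] t by simp
  qed
  \<comment> \<open>\<open>R\<close> folds the right half-plane onto the left one, where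
    \<open>exp\<close> maps into the disc, and adjusts the position along the edge by
    \<open>s\<close>; on the imaginary axis both branches of \<open>k\<close> agree.\<close>
  define R where "R \<zeta> = Complex (- Re \<zeta>) (s (Im \<zeta>))" for \<zeta>
  define k where "k = (\<lambda>\<zeta>. if Re \<zeta> \<le> 0 then (h1 \<circ> exp) \<zeta> else (h2 \<circ> (exp \<circ> R)) \<zeta>)"
  have SI: "Im \<zeta> \<in> I" if "\<zeta> \<in> S" for \<zeta> using that II' by (auto simp: S_def)
  have agree: "h1 (exp \<zeta>) = h2 (exp (R \<zeta>))" if "\<zeta> \<in> S" "Re \<zeta> = 0" for \<zeta>
  proof -
    have "\<zeta> = Complex 0 (Im \<zeta>)" using that(2) by (simp add: complex_eq_iff)
    then have "exp \<zeta> = cis (Im \<zeta>)" using exp_Complex_0[of "Im \<zeta>"] by simp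
    moreover have "exp (R \<zeta>) = cis (s (Im \<zeta>))" using that(2) by (simp add: R_def exp_Complex_0)
    ultimately show ?thesis using hs[OF SI[OF that(1)]] by simp
  qed
  have k_cont: "continuous_map (top_of_set S) X k"
    unfolding k_def
  proof (rule continuous_map_cases_le)
    show "continuous_map (top_of_set S) euclideanreal Re" "continuous_map (top_of_set S) euclideanreal (\<lambda>_. 0)"
      by (simp_all add: continuous_on_Re)
    have eq: "subtopology (top_of_set S) {x \<in> topspace (top_of_set S). Re x \<le> 0} = top_of_set {x \<in> S. Re x \<le> 0}"
      "subtopology (top_of_set S) {x \<in> topspace (top_of_set S). 0 \<le> Re x} = top_of_set {x \<in> S. 0 \<le> Re x}"
      unfolding subtopology_subtopology topspace_euclidean_subtopology
      by (rule arg_cong[where f = "subtopology euclidean"], blast)+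
    have "continuous_map (top_of_set {x \<in> S. Re x \<le> 0}) (top_of_set (cball 0 1)) exp"
      using exp_in_ball(2) by (auto simp: continuous_map_in_subtopology intro!: continuous_intros)
    then show "continuous_map (subtopology (top_of_set S) {x \<in> topspace (top_of_set S). Re x \<le> 0}) X (h1 \<circ> exp)"
      unfolding eq using pmapD(2)[OF h1] by (rule continuous_map_compose)
    have "continuous_on {x \<in> S. 0 \<le> Re x} (\<lambda>\<zeta>. s (Im \<zeta>))"
      using SI by (intro continuous_on_compose2[OF s_cont] continuous_intros) auto
    then have "continuous_on {x \<in> S. 0 \<le> Re x} R"
      unfolding R_def Complex_eq by (intro continuous_intros)
    then have "continuous_on {x \<in> S. 0 \<le> Re x} (exp \<circ> R)"
      unfolding o_def by (rule continuous_on_exp)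
    moreover have "(exp \<circ> R) ` {x \<in> S. 0 \<le> Re x} \<subseteq> cball 0 1" by (auto simp: R_def)
    ultimately have "continuous_map (top_of_set {x \<in> S. 0 \<le> Re x}) (top_of_set (cball 0 1)) (exp \<circ> R)"
      by (auto simp: continuous_map_in_subtopology)
    then show "continuous_map (subtopology (top_of_set S) {x \<in> topspace (top_of_set S). 0 \<le> Re x}) X (h2 \<circ> (exp \<circ> R))"
      unfolding eq using pmapD(2)[OF h2] by (rule continuous_map_compose)
    show "(h1 \<circ> exp) \<zeta> = (h2 \<circ> (exp \<circ> R)) \<zeta>" if "\<zeta> \<in> topspace (top_of_set S)" "Re \<zeta> = 0" for \<zeta>
      using agree that by simp
  qed
  have kl: "k \<zeta> = h1 (exp \<zeta>)" if "Re \<zeta> \<le> 0" for \<zeta> using that by (simp add: k_def)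
  have kr: "k \<zeta> = h2 (exp (R \<zeta>))" if "\<zeta> \<in> S" "0 \<le> Re \<zeta>" for \<zeta>
    using agree[OF that(1)] that(2) by (cases "Re \<zeta> = 0") (simp_all add: k_def)
  have r1: "k \<zeta> \<in> f1" if "Re \<zeta> < 0" for \<zeta>
    using exp_in_ball(1)[OF that] pmapD(5)[OF h1] kl[of \<zeta>] that by auto
  have r2: "k \<zeta> \<in> f2" if "\<zeta> \<in> S" "0 < Re \<zeta>" for \<zeta>
  proof -
    have "exp (R \<zeta>) \<in> ball 0 1" using that(2) by (intro exp_in_ball(1)) (simp add: R_def)
    then show ?thesis using pmapD(5)[OF h2] kr[OF that(1)] that(2) by auto
  qed
  have r0: "k \<zeta> \<in> h1 ` side j1" if "\<zeta> \<in> S" "Re \<zeta> = 0" for \<zeta>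
  proof -
    have "\<zeta> = Complex 0 (Im \<zeta>)" using that(2) by (simp add: complex_eq_iff)
    then have "exp \<zeta> = cis (Im \<zeta>)" using exp_Complex_0[of "Im \<zeta>"] by simp
    moreover have "Im \<zeta> \<in> I'" using that(1) by (simp add: S_def)
    ultimately show ?thesis using kl[of \<zeta>] that(2) unfolding side_def I'_def by auto
  qed
  have kim: "k ` S \<subseteq> f1 \<union> h1 ` side j1 \<union> f2"
  proof (rule image_subsetI)
    fix \<zeta> assume "\<zeta> \<in> S"
    then show "k \<zeta> \<in> f1 \<union> h1 ` side j1 \<union> f2"
      using r0[of \<zeta>] r1[of \<zeta>] r2[of \<zeta>] by (cases "Re \<zeta>" "0::real" rule: linorder_cases) auto
  qed
  have k_inj: "inj_on k S"
  proof (rule inj_onI)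
    fix \<zeta> \<xi> assume \<zeta>: "\<zeta> \<in> S" and \<xi>: "\<xi> \<in> S" and eq: "k \<zeta> = k \<xi>"
    have nf: "\<not> (p \<in> f1 \<and> p \<in> f2)" for p using cells_disjoint(5)[OF f] ne by blast
    have ne1: "\<not> (p \<in> h1 ` side j1 \<and> p \<in> f2)" for p using cells_disjoint(3)[OF e1 f(2)] by blast
    \<comment> \<open>Points to the right of the axis go to the open tile \<open>f2\<close>, all
      others to \<open>f1\<close> or the edge. These cells are disjoint, so injectivity can be
      checked on each side separately.\<close>
    have side: "0 < Re \<zeta> \<longleftrightarrow> 0 < Re \<xi>"
    proof -
      have "\<not> (0 < Re \<xi>' \<and> Re \<zeta>' \<le> 0)" if "\<zeta>' \<in> S" "\<xi>' \<in> S" "k \<zeta>' = k \<xi>'" for \<zeta>' \<xi>'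
      proof
        assume "0 < Re \<xi>' \<and> Re \<zeta>' \<le> 0"
        then have "k \<zeta>' \<in> f2" "k \<zeta>' \<in> f1 \<or> k \<zeta>' \<in> h1 ` side j1"
          using r2[OF that(2)] r1[of \<zeta>'] r0[OF that(1)] that(3) by (auto simp: le_less)
        then show False using nf ne1 by blast
      qed
      from this[OF \<zeta> \<xi> eq] this[OF \<xi> \<zeta> eq[symmetric]] show ?thesis by auto
    qed
    show "\<zeta> = \<xi>"
    proof (cases "0 < Re \<zeta>")
      case True
      then have pos: "0 < Re \<zeta>" "0 < Re \<xi>" using side by auto
      then have "h2 (exp (R \<zeta>)) = h2 (exp (R \<xi>))" using eq kr \<zeta> \<xi> by simp
      moreover have "exp (R \<zeta>) \<in> cball 0 1" "exp (R \<xi>) \<in> cball 0 1" using pos by (simp_all add: R_def)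
      ultimately have "exp (R \<zeta>) = exp (R \<xi>)" using inj_onD[OF pmapD(3)[OF h2]] by blast
      moreover have "s (Im \<zeta>) \<in> ?J" "s (Im \<xi>) \<in> ?J" using sJ SI \<zeta> \<xi> by blast+
      then have "\<bar>Im (R \<zeta>) - Im (R \<xi>)\<bar> < 2 * pi" unfolding R_def complex.sel by (rule side_width)
      ultimately have "R \<zeta> = R \<xi>" by (rule exp_complex_eqI[rotated])
      then have "Re \<zeta> = Re \<xi>" "s (Im \<zeta>) = s (Im \<xi>)" by (simp_all add: R_def)
      then show ?thesis using inj_onD[OF s_inj _ SI[OF \<zeta>] SI[OF \<xi>]] by (simp add: complex_eq_iff)
    next
      case False
      then have le: "Re \<zeta> \<le> 0" "Re \<xi> \<le> 0" using side by auto
      then have "h1 (exp \<zeta>) = h1 (exp \<xi>)" using eq kl by simp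
      then have "exp \<zeta> = exp \<xi>" using inj_onD[OF pmapD(3)[OF h1] _ exp_in_ball(2)[OF le(1)] exp_in_ball(2)[OF le(2)]] by blast
      moreover have "\<bar>Im \<zeta> - Im \<xi>\<bar> < 2 * pi" using SI[OF \<zeta>] SI[OF \<xi>] unfolding I_def by (rule side_width)
      ultimately show ?thesis by (rule exp_complex_eqI[rotated])
    qed
  qed
  show ?thesis
    using s_cont s_inj sJ hs k_cont k_inj kim kl kr unfolding R_def by (intro exI[of _ s] exI[of _ k]) blast
qed

lemma edge_face_arc:
  assumes "e \<in> E" "e \<subseteq> cl f" "pmap f h"
  obtains j where "j < 4" "e = h ` side j"
proof -
  obtain p where p: "p \<in> e" using edge_nonempty[OF assms(1)] by blast
  then have "p \<in> cl f" using assms(2) by blast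
  then show thesis using edge_of_face[OF assms(3,1) p] that by blast
qed

text \<open>A third tile is impossible because the glued strip has an open image inside
  \<open>f1\<close>, the edge and \<open>f2\<close>: a tile with a point of the edge in its closure
  would have to meet this image.\<close>

lemma edge_two_faces:
  assumes e: "e \<in> E"
  obtains f1 f2 where "f1 \<in> F" "f2 \<in> F" "f1 \<noteq> f2" "e \<subseteq> cl f1" "e \<subseteq> cl f2"
    "\<forall>f\<in>F. e \<subseteq> cl f \<longrightarrow> f = f1 \<or> f = f2"
proof -
  obtain f1 where f1: "f1 \<in> F" "e \<subseteq> cl f1" using edge_in_some_face[OF e] by blast
  obtain f2 where f2: "f2 \<in> F" "f2 \<noteq> f1" "e \<subseteq> cl f2" using edge_in_second_face[OF e f1] by blast
  obtain h1 h2 where h: "pmap f1 h1" "pmap f2 h2"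
    using pmap_exists[OF f1(1)] pmap_exists[OF f2(1)] by blast
  obtain j1 where j1: "j1 < 4" "e = h1 ` side j1" using e f1(2) h(1) by (rule edge_face_arc)
  obtain j2 where j2: "j2 < 4" "e = h2 ` side j2" using e f2(3) h(2) by (rule edge_face_arc)
  let ?S = "{\<zeta>. Im \<zeta> \<in> {ang j1<..<ang (Suc j1)}}"
  have e12: "h1 ` side j1 = h2 ` side j2" using j1(2) j2(2) by simp
  have "\<exists>k. continuous_map (top_of_set ?S) X k \<and> inj_on k ?S \<and> k ` ?S \<subseteq> f1 \<union> h1 ` side j1 \<union> f2 \<and>
      (\<forall>\<zeta>\<in>?S. Re \<zeta> \<le> 0 \<longrightarrow> k \<zeta> = h1 (exp \<zeta>))"
    using glue[OF h f2(2)[THEN not_sym] j1(1) j2(1) e12] by (elim exE conjE) (intro exI conjI; assumption)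
  then obtain k where k: "continuous_map (top_of_set ?S) X k" "inj_on k ?S" "k ` ?S \<subseteq> f1 \<union> e \<union> f2"
    "\<forall>\<zeta>\<in>?S. Re \<zeta> \<le> 0 \<longrightarrow> k \<zeta> = h1 (exp \<zeta>)"
    unfolding j1(2)[symmetric] by (elim exE conjE)
  have op: "openin X (k ` ?S)" by (rule openin_injective_image[OF surface_facts(4) k(1,2) open_strip])
  let ?\<zeta> = "Complex 0 (ang j1 + pi / 4)"
  have "?\<zeta> \<in> ?S" by (simp add: ang_Suc)
  then have "k ?\<zeta> \<in> k ` ?S" "k ?\<zeta> = h1 (exp ?\<zeta>)" using bspec[OF k(4), of ?\<zeta>] by (blast, simp)
  then have p: "k ?\<zeta> \<in> e" "k ?\<zeta> \<in> k ` ?S" using side_nonempty[of j1] j1(2) unfolding exp_Complex_0 by auto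
  have "f = f1 \<or> f = f2" if f: "f \<in> F" "e \<subseteq> cl f" for f
  proof (rule ccontr)
    assume nf: "\<not> ?thesis"
    have "k ?\<zeta> \<in> cl f" using f(2) p(1) by blast
    moreover have "\<exists>q. q \<in> f \<and> q \<in> W" if "x \<in> cl f" "x \<in> W" "openin X W" for x W
      using that unfolding in_closure_of by blast
    ultimately obtain q where "q \<in> f" "q \<in> k ` ?S" using p(2) op by meson
    then show False
      using nf k(3) cells_disjoint(5)[OF f(1) f1(1)] cells_disjoint(5)[OF f(1) f2(1)] cells_disjoint(3)[OF e f(1)] by blast
  qed
  then have "\<forall>f\<in>F. e \<subseteq> cl f \<longrightarrow> f = f1 \<or> f = f2" by blast
  from that[OF f1(1) f2(1) f2(2)[THEN not_sym] f1(2) f2(3) this] show thesis .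
qed

text \<open>Although \<open>exp\<close> is not injective on the half-plane, it is so on balls of
  radius 1, whose diameter is below \<open>2 * pi\<close>. This suffices for a local degree, which
  is constant as the half-plane is connected.\<close>

lemma left_halfplane_ldeg:
  assumes A: "oriented_atlas X A" and h: "pmap f h"
  shows "\<exists>s\<in>{1, - 1}. \<forall>\<zeta>. Re \<zeta> < 0 \<longrightarrow> ldeg A (h \<circ> exp) \<zeta> s"
proof -
  let ?S = "{\<zeta>. Re \<zeta> < (0::real)}"
  have op: "open ?S" by (rule open_halfspace_Re_lt)
  have co: "connected ?S" by (intro convex_connected convex_halfspace_Re_lt)
  have "continuous_map (top_of_set ?S) (top_of_set (cball 0 1)) exp"
    by (auto simp: continuous_map_in_subtopology intro!: continuous_intros)
  then have c: "continuous_map (top_of_set ?S) X (h \<circ> exp)"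
    using pmapD(2)[OF h] by (rule continuous_map_compose)
  have inj: "\<exists>d>0. inj_on (h \<circ> exp) (ball \<zeta> d)" if \<zeta>: "\<zeta> \<in> ?S" for \<zeta>
  proof -
    obtain d where d: "d > 0" "ball \<zeta> d \<subseteq> ?S" using op \<zeta> by (meson open_contains_ball)
    have "inj_on (h \<circ> exp) (ball \<zeta> (min 1 d))"
    proof (rule inj_onI)
      fix w z assume wz: "w \<in> ball \<zeta> (min 1 d)" "z \<in> ball \<zeta> (min 1 d)" "(h \<circ> exp) w = (h \<circ> exp) z"
      have "w \<in> ball \<zeta> d" "z \<in> ball \<zeta> d" using wz by simp_all
      then have "w \<in> ?S" "z \<in> ?S" using d(2) by blast+
      then have "Re w \<le> 0" "Re z \<le> 0" by simp_all
      then have "exp w \<in> cball 0 1" "exp z \<in> cball 0 1" by simp_all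
      moreover have "h (exp w) = h (exp z)" using wz(3) by simp
      ultimately have "exp w = exp z" using inj_onD[OF pmapD(3)[OF h]] by blast
      moreover have "dist w z < 2" using wz(1,2) dist_triangle[of w z \<zeta>] by (simp add: dist_commute)
      then have "\<bar>Im w - Im z\<bar> < 2 * pi"
        using abs_Im_le_cmod[of "w - z"] pi_gt3 by (simp add: dist_norm)
      ultimately show "w = z" by (rule exp_complex_eqI[rotated])
    qed
    then show ?thesis using d(1) by (intro exI[of _ "min 1 d"]) simp
  qed
  have m1: "(- 1 :: complex) \<in> ?S" by simp
  obtain d where d: "d > 0" "inj_on (h \<circ> exp) (ball (- 1) d)" using inj[OF m1] by blast
  have "ldeg A (h \<circ> exp) (- 1) 1 \<or> ldeg A (h \<circ> exp) (- 1) (- 1)"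
    by (rule ldeg_exists[OF A c op m1 d])
  then obtain s where s: "s \<in> {1, - 1}" "ldeg A (h \<circ> exp) (- 1) s" by blast
  have "ldeg A (h \<circ> exp) \<zeta> s" if "Re \<zeta> < 0" for \<zeta>
    using ldeg_constant[OF A c op co inj m1 _ s(2)] that by blast
  then show ?thesis using s(1) by blast
qed

text \<open>The map \<open>exp\<close> preserves orientation, so the local degree of
  \<open>h \<circ> exp\<close> is that of \<open>h\<close> away from the centre of the disc; such an
  \<open>h\<close> traverses the boundary of the tile in the positive sense.\<close>

definition pos_pmap :: "('a set \<times> ('a \<Rightarrow> complex)) set \<Rightarrow> 'a set \<Rightarrow> (complex \<Rightarrow> 'a) \<Rightarrow> bool" where
  "pos_pmap A f h \<longleftrightarrow> pmap f h \<and> (\<forall>\<zeta>. Re \<zeta> < 0 \<longrightarrow> ldeg A (h \<circ> exp) \<zeta> 1)"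

text \<open>Conjugation sends corner \<open>j\<close> to corner \<open>4 - j\<close> (taken modulo
  4) and side \<open>j\<close> to side \<open>3 - j\<close>, so the disc remains a polygon with four
  corners.\<close>

lemma pmap_cnj:
  assumes h: "pmap f h"
  shows "pmap f (h \<circ> cnj)"
  unfolding pmap_def
proof (intro conjI allI impI)
  show "f \<in> F" by (rule pmapD(1)[OF h])
  have "homeomorphic_maps (top_of_set (cball 0 1)) (top_of_set (cball 0 1)) cnj cnj"
    by (auto simp: homeomorphic_maps_def continuous_map_in_subtopology intro!: continuous_intros)
  then have "homeomorphic_map (top_of_set (cball 0 1)) (top_of_set (cball 0 1)) cnj"
    using homeomorphic_map_maps by blast
  then show "homeomorphic_map (top_of_set (cball 0 1)) (subtopology X (cl f)) (h \<circ> cnj)"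
    using pmapD(8)[OF h] by (rule homeomorphic_map_compose)
  have "cnj ` ball 0 1 = ball 0 1"
  proof
    show "cnj ` ball 0 1 \<subseteq> ball 0 1" by auto
    show "ball 0 1 \<subseteq> cnj ` ball 0 1"
    proof
      fix z :: complex assume "z \<in> ball 0 1"
      then show "z \<in> cnj ` ball 0 1" by (intro image_eqI[of _ _ "cnj z"]) auto
    qed
  qed
  then show "(h \<circ> cnj) ` ball 0 1 = f" unfolding image_comp[symmetric] by (simp add: pmapD(5)[OF h])
  have shift: "cnj (cis t) = cis (2 * pi - t)" for t
    by (simp add: complex_eq_iff cos_diff sin_diff)
  fix j :: nat assume j: "j < 4"
  have a: "2 * pi - ang j = ang (4 - j)" "2 * pi - ang (Suc j) = ang (3 - j)" using j by (auto simp: ang_def field_simps of_nat_diff)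
  show "(h \<circ> cnj) (cis (ang j)) \<in> V"
  proof (cases "j = 0")
    case True
    then show ?thesis using pmapD(6)[OF h, of 0] by (simp add: ang_simps)
  next
    case False
    then show ?thesis using pmapD(6)[OF h, of "4 - j"] by (simp add: shift a)
  qed
  have "cnj ` side j = side (3 - j)"
  proof -
    have s: "Suc (3 - j) = 4 - j" using j by simp
    have "cnj ` side j = cis ` (\<lambda>t. 2 * pi - t) ` {ang j<..<ang (Suc j)}"
      unfolding side_def image_comp by (rule image_cong) (simp_all add: shift)
    also have "(\<lambda>t. 2 * pi - t) ` {ang j<..<ang (Suc j)} = {2 * pi - ang (Suc j)<..<2 * pi - ang j}"
    proof
      show "{2 * pi - ang (Suc j)<..<2 * pi - ang j} \<subseteq> (\<lambda>t. 2 * pi - t) ` {ang j<..<ang (Suc j)}"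
      proof
        fix x assume "x \<in> {2 * pi - ang (Suc j)<..<2 * pi - ang j}"
        then show "x \<in> (\<lambda>t. 2 * pi - t) ` {ang j<..<ang (Suc j)}"
          by (intro image_eqI[of _ _ "2 * pi - x"]) auto
      qed
    qed auto
    also have "\<dots> = {ang (3 - j)<..<ang (Suc (3 - j))}" unfolding s a ..
    finally show ?thesis unfolding side_def .
  qed
  then show "(h \<circ> cnj) ` side j \<in> E" unfolding image_comp[symmetric] using pmapD(7)[OF h, of "3 - j"] by simp
qed

text \<open>A parametrization of degree -1 is repaired by conjugating the disc.\<close>

lemma pos_pmap_exists:
  assumes A: "oriented_atlas X A" and f: "f \<in> F"
  shows "\<exists>h. pos_pmap A f h"
proof -
  obtain h where h: "pmap f h" using pmap_exists[OF f] by blast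
  obtain s where s: "s = 1 \<or> s = - 1" "\<And>\<zeta>. Re \<zeta> < 0 \<Longrightarrow> ldeg A (h \<circ> exp) \<zeta> s"
    using left_halfplane_ldeg[OF A h] by auto
  show ?thesis
  proof (cases "s = 1")
    case True
    then show ?thesis using h s(2) unfolding pos_pmap_def by blast
  next
    case False
    then have m: "s = - 1" using s(1) by blast
    have "ldeg A ((h \<circ> cnj) \<circ> exp) \<zeta> 1" if "Re \<zeta> < 0" for \<zeta>
    proof -
      have "ldeg A (h \<circ> exp) (cnj \<zeta>) (- 1)" using s(2)[of "cnj \<zeta>"] that m by simp
      then have "ldeg A ((h \<circ> exp) \<circ> cnj) \<zeta> (- (- 1))"
      proof (rule ldeg_reverse[where d = 1])
        show "inj_on cnj (ball \<zeta> 1)" by (simp add: inj_on_def)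
        show "continuous_on (ball \<zeta> 1) cnj" by (intro continuous_intros)
      qed (simp_all add: winding_number_cnj_circle)
      moreover have "(h \<circ> exp) \<circ> cnj = (h \<circ> cnj) \<circ> exp" by (auto simp: exp_cnj)
      ultimately show ?thesis by simp
    qed
    then show ?thesis using pmap_cnj[OF h] unfolding pos_pmap_def by blast
  qed
qed

lemma strict_mono_of_endpoints:
  fixes s :: "real \<Rightarrow> real"
  assumes s: "continuous_on {a..b} s" "inj_on s {a..b}" and ab: "s a < s b"
  shows "strict_mono_on {a<..<b} s"
proof (rule strict_mono_onI)
  fix x y assume x: "x \<in> {a<..<b}" and y: "y \<in> {a<..<b}" and xy: "x < y"
  have "s a < s y" using continuous_inj_imp_mono[of a y b s] s ab y by auto
  moreover have "{a..y} \<subseteq> {a..b}" using y by auto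
  then have "continuous_on {a..y} s" "inj_on s {a..y}" using s by (blast intro: continuous_on_subset inj_on_subset)+
  ultimately show "s x < s y" using continuous_inj_imp_mono[of a x y s] x xy by auto
qed

text \<open>Otherwise \<open>s\<close> would be increasing and the gluing map would have local degree \<open>1\<close> on one
  side of the edge and \<open>-1\<close> on the other.\<close>

lemma edge_opposite:
  assumes A: "oriented_atlas X A" and p1: "pos_pmap A f1 h1" and p2: "pos_pmap A f2 h2" and ne: "f1 \<noteq> f2"
    and j: "j1 < 4" "j2 < 4" and e: "h1 ` side j1 = h2 ` side j2"
  shows "h1 (cis (ang j1)) \<noteq> h2 (cis (ang j2))"
proof
  assume start: "h1 (cis (ang j1)) = h2 (cis (ang j2))"
  have h: "pmap f1 h1" "pmap f2 h2" using p1 p2 unfolding pos_pmap_def by auto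
  let ?I' = "{ang j1<..<ang (Suc j1)}" and ?I = "{ang j1..ang (Suc j1)}"
  let ?S = "{\<zeta>. Im \<zeta> \<in> ?I'}"
  obtain s k where s: "continuous_on ?I s" "inj_on s ?I" "s ` ?I \<subseteq> {ang j2..ang (Suc j2)}"
    "\<forall>t\<in>?I. h2 (cis (s t)) = h1 (cis t)"
    and k: "continuous_map (top_of_set ?S) X k" "inj_on k ?S"
    "\<forall>\<zeta>\<in>?S. Re \<zeta> \<le> 0 \<longrightarrow> k \<zeta> = h1 (exp \<zeta>)"
    "\<forall>\<zeta>\<in>?S. 0 \<le> Re \<zeta> \<longrightarrow> k \<zeta> = h2 (exp (Complex (- Re \<zeta>) (s (Im \<zeta>))))"
    using glue[OF h ne j e] by (elim exE conjE)
  have lt: "ang j1 < ang (Suc j1)" by (rule ang_less) simp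
  have inI: "ang j1 \<in> ?I" "ang (Suc j1) \<in> ?I" using lt by auto
  have "h2 (cis (s (ang j1))) = h2 (cis (ang j2))" using s(4) inI(1) start by simp
  then have "cis (s (ang j1)) = cis (ang j2)" using inj_onD[OF pmapD(3)[OF h(2)]] by simp
  moreover have sJ: "s (ang j1) \<in> {ang j2..ang (Suc j2)}" "s (ang (Suc j1)) \<in> {ang j2..ang (Suc j2)}"
    using s(3) inI by blast+
  moreover have "\<bar>s (ang j1) - ang j2\<bar> < 2 * pi"
    using ang_less[of j2 "Suc j2"] by (intro side_width[OF sJ(1)]) simp
  \<comment> \<open>Equal starting vertices force \<open>s\<close> to send the lower end of the
    interval to the lower end, so the injective function \<open>s\<close> has to increase.\<close>
  ultimately have sa: "s (ang j1) = ang j2" by (intro cis_eqD)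
  moreover have "s (ang (Suc j1)) \<noteq> s (ang j1)" using inj_onD[OF s(2) _ inI(2,1)] lt by auto
  ultimately have "s (ang j1) < s (ang (Suc j1))" using sJ(2) by auto
  then have mono: "strict_mono_on ?I' s" by (rule strict_mono_of_endpoints[OF s(1,2)])
  have s': "continuous_on ?I' s" using s(1) by (rule continuous_on_subset) auto
  define R where "R = (\<lambda>\<zeta>. Complex (- Re \<zeta>) (s (Im \<zeta>)))"
  define t where "t = ang j1 + pi / 4"
  \<comment> \<open>Two test points at the same height: near \<open>\<zeta>\<close> the map
    \<open>k\<close> is \<open>h1 \<circ> exp\<close>, near \<open>\<xi>\<close> it is
    \<open>h2 \<circ> exp\<close> composed with the reflection \<open>R\<close>.\<close>
  define \<zeta> where "\<zeta> = Complex (- 1) t"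
  define \<xi> where "\<xi> = Complex 1 t"
  have t: "ang j1 < t" "t < ang (Suc j1)" by (simp_all add: t_def ang_Suc)
  have in_S: "\<zeta> \<in> ?S" "\<xi> \<in> ?S" using t by (simp_all add: \<zeta>_def \<xi>_def)
  have injS: "\<exists>d>0. inj_on k (ball z d)" if "z \<in> ?S" for z
  proof -
    obtain d where "d > 0" "ball z d \<subseteq> ?S" using open_strip \<open>z \<in> ?S\<close> by (meson open_contains_ball)
    then show ?thesis using k(2) inj_on_subset by blast
  qed
  have l1: "ldeg A (h1 \<circ> exp) \<zeta> 1" using p1 unfolding pos_pmap_def by (simp add: \<zeta>_def)
  obtain d where d: "d > 0" "ball \<zeta> d \<subseteq> ?S" using open_strip in_S(1) by (meson open_contains_ball)
  have eq1: "(h1 \<circ> exp) w = k w" if w: "w \<in> ball \<zeta> (min d 1)" for w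
  proof -
    have "dist \<zeta> w < 1" using w by simp
    then have "Re w \<le> 0" using abs_Re_le_cmod[of "\<zeta> - w"] by (simp add: \<zeta>_def dist_norm)
    moreover have "w \<in> ?S" using w d(2) by auto
    ultimately show ?thesis using k(3) by simp
  qed
  have "0 < min d 1" using d(1) by simp
  then have l1': "ldeg A k \<zeta> 1" by (rule ldeg_cong[OF l1 _ eq1])
  have one: "ldeg A k \<xi> 1"
    by (rule ldeg_constant[OF A k(1) open_strip connected_strip injS in_S l1'])
  obtain d where d: "d > 0" "ball \<xi> d \<subseteq> ?S" using open_strip in_S(2) by (meson open_contains_ball)
  \<comment> \<open>Radius 1 keeps the ball around \<open>\<xi>\<close> in the right half-plane, and
    \<open>pi / 4\<close> is the distance from the height \<open>t\<close> to either edge of the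
    strip.\<close>
  define d' where "d' = min d (min 1 (pi / 4))"
  have d': "d' > 0" "ball \<xi> d' \<subseteq> ball \<xi> d" using d(1) by (auto simp: d'_def)
  have "ldeg A (h2 \<circ> exp) (R \<xi>) 1" using p2 unfolding pos_pmap_def by (simp add: \<xi>_def R_def)
  then have l2: "ldeg A ((h2 \<circ> exp) \<circ> R) \<xi> (- 1)"
  proof (rule ldeg_reverse)
    show "d' > 0" by (rule d'(1))
    have "continuous_on (ball \<xi> d') (\<lambda>z. s (Im z))"
      using d d' by (intro continuous_on_compose2[OF s'] continuous_intros) blast
    then show "continuous_on (ball \<xi> d') R" unfolding R_def Complex_eq by (intro continuous_intros)
    show "inj_on R (ball \<xi> d')"
    proof (rule inj_onI)
      fix w z assume w: "w \<in> ball \<xi> d'" "z \<in> ball \<xi> d'" "R w = R z"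
      then have "w \<in> ?S" "z \<in> ?S" using d(2) d'(2) by blast+
      then have "Im w \<in> ?I" "Im z \<in> ?I" by auto
      then have "Im w = Im z" using inj_onD[OF s(2)] w(3) by (simp add: R_def)
      then show "w = z" using w(3) by (simp add: R_def complex_eq_iff)
    qed
    fix r :: real assume r: "0 < r" "r < d'"
    then show "winding_number (R \<circ> circlepath \<xi> r) (R \<xi>) = - 1"
      unfolding R_def using t by (intro winding_number_reflect[OF s' mono]) (auto simp: \<xi>_def t_def d'_def ang_Suc)
  qed
  have eq2: "((h2 \<circ> exp) \<circ> R) w = k w" if w: "w \<in> ball \<xi> d'" for w
  proof -
    have "dist \<xi> w < 1" using w by (simp add: d'_def)
    then have "0 \<le> Re w" using abs_Re_le_cmod[of "\<xi> - w"] by (simp add: \<xi>_def dist_norm)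
    moreover have "w \<in> ?S" using w d' d(2) by blast
    ultimately show ?thesis using k(4) by (simp add: R_def)
  qed
  have "ldeg A k \<xi> (- 1)" by (rule ldeg_cong[OF l2 d'(1) eq2])
  then show False using ldeg_unique[OF A one] by fastforce
qed

end

section \<open>Links of vertices and connectedness\<close>

context quad_surface
begin

lemma planar_not_open_singleton: "\<not> openin X {v}"
proof
  assume o: "openin X {v}"
  have "continuous_map (subtopology X {v}) euclidean (\<lambda>_. 0 :: complex)" by simp
  then have "open ((\<lambda>_. 0 :: complex) ` {v})"
    by (rule open_injective_image[OF surface_facts(4) _ _ o]) simp
  then show False by (simp add: not_open_singleton)
qed

lemma edge_star_vertex:
  assumes e: "e \<in> E" "v \<in> cl e" and f: "e \<subseteq> cl f"
  shows "v \<in> cl f"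
proof -
  have "cl e \<subseteq> cl (cl f)" using f by (rule closure_of_mono)
  then show ?thesis using e(2) by auto
qed

text \<open>Without a tile at \<open>v\<close> there is no edge at \<open>v\<close> either, since
  every edge lies in the closure of a tile; then \<open>v\<close> would be an isolated
  point.\<close>

lemma vertex_in_some_face:
  assumes v: "v \<in> V"
  shows "\<exists>f\<in>F. v \<in> cl f"
proof (rule ccontr)
  assume none: "\<not> ?thesis"
  have "openin X (\<Union>{{v}})"
  proof (rule open_upset)
    show "{{v}} \<subseteq> cells" using v by (auto simp: cells_def)
    fix c c' assume c: "c \<in> {{v}}" "c' \<in> cells" "c \<subseteq> cl c'"
    then have vc: "v \<in> cl c'" by blast
    consider w where "w \<in> V" "c' = {w}" | "c' \<in> E" | "c' \<in> F" using c(2) unfolding cells_def by blast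
    then show "c' \<in> {{v}}"
    proof cases
      case 1
      then show ?thesis using vc closure_vertex by simp
    next
      case 2
      obtain f where "f \<in> F" "c' \<subseteq> cl f" using edge_in_some_face[OF 2] by blast
      then show ?thesis using edge_star_vertex[OF 2 vc] none by blast
    next
      case 3
      then show ?thesis using vc none by blast
    qed
  qed
  then show False using planar_not_open_singleton by simp
qed

text \<open>Otherwise a punctured neighbourhood of the vertex would be disconnected.\<close>

lemma link_connected:
  assumes v: "v \<in> V" and AB: "A \<union> B = {f \<in> F. v \<in> cl f}" "A \<inter> B = {}" "A \<noteq> {}" "B \<noteq> {}"
    and sep: "\<And>e a b. e \<in> E \<Longrightarrow> v \<in> cl e \<Longrightarrow> a \<in> A \<Longrightarrow> b \<in> B \<Longrightarrow> e \<subseteq> cl a \<Longrightarrow> e \<subseteq> cl b \<Longrightarrow> False"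
  shows False
proof -
  \<comment> \<open>\<open>P D\<close> is the part of the open star of \<open>v\<close>, with
    \<open>v\<close> removed, that is attached to tiles in \<open>D\<close>.\<close>
  define P where "P D = {c \<in> cells. c \<noteq> {v} \<and> v \<in> cl c \<and> (\<exists>a\<in>D. c \<subseteq> cl a)}" for D
  have fcl: "f \<subseteq> cl f" if "f \<in> F" for f
    using that cells_cover by (intro closure_of_subset) blast
  have cases: "c \<in> E \<or> c \<in> F" if "c \<in> cells" "c \<noteq> {v}" "v \<in> cl c" for c
    using that closure_vertex unfolding cells_def by auto
  have face: "c = a" if "c \<in> F" "a \<in> A \<union> B" "c \<subseteq> cl a" for c a
    using face_maximal[of c a] that AB(1) by (auto simp: cells_def)
  have cover: "c \<in> P A \<union> P B" if c: "c \<in> cells" "c \<noteq> {v}" "v \<in> cl c" for c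
  proof -
    obtain f where "f \<in> F" "c \<subseteq> cl f"
      using cases[OF c] edge_in_some_face fcl by blast
    moreover from this have "v \<in> cl f" using c(3) closure_of_mono[of c "cl f" X] by auto
    ultimately have "f \<in> A \<union> B" "c \<subseteq> cl f" using AB(1) by auto
    then show ?thesis using c unfolding P_def by blast
  qed
  \<comment> \<open>A cell in both parts is either an edge shared by the two families, which
    \<open>sep\<close> forbids, or a single tile belonging to both.\<close>
  have excl: "c \<notin> P B" if "c \<in> P A" for c
  proof
    assume "c \<in> P B"
    then obtain a b where ab: "a \<in> A" "b \<in> B" "c \<subseteq> cl a" "c \<subseteq> cl b" and c: "c \<in> cells" "c \<noteq> {v}" "v \<in> cl c"
      using \<open>c \<in> P A\<close> unfolding P_def by blast
    from cases[OF c] show False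
    proof
      assume "c \<in> E"
      then show False using sep[OF _ c(3) ab] by blast
    next
      assume "c \<in> F"
      then have "c = a" "c = b" using face ab by blast+
      then show False using ab AB(2) by blast
    qed
  qed
  have vin: "v \<in> cl c'" if "c \<subseteq> cl c'" "v \<in> cl c" for c c'
    using that closure_of_mono[of c "cl c'" X] by auto
  have nv: "c' \<noteq> {v}" if "c \<in> cells" "c \<noteq> {v}" "c \<subseteq> cl c'" for c c'
  proof
    assume "c' = {v}"
    then have "c \<subseteq> {v}" using that(3) closure_vertex[OF v] by simp
    moreover have "c \<noteq> {}" using that(1) edge_nonempty face_nonempty unfolding cells_def by auto
    ultimately show False using that(2) by blast
  qed
  have up: "c' \<in> P A \<union> P B" if "c \<in> P A \<union> P B" "c' \<in> cells" "c \<subseteq> cl c'" for c c'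
    using that cover[of c'] vin[OF that(3)] nv[OF _ _ that(3)] unfolding P_def by blast
  have down: "c \<in> P D" if cP: "c' \<in> P D" and "c \<in> cells" "c \<noteq> {v}" "v \<in> cl c" "c \<subseteq> cl c'" for c c' D
  proof -
    obtain a where a: "a \<in> D" "c' \<subseteq> cl a" using cP unfolding P_def by blast
    then have "cl c' \<subseteq> cl a" using closure_of_mono[of c' "cl a" X] by simp
    then show ?thesis using that a unfolding P_def by blast
  qed
  have upA: "c' \<in> P A" if "c \<in> P A" "c' \<in> cells" "c \<subseteq> cl c'" for c c'
    using up[of c c'] down[of c' B c] excl[of c] that unfolding P_def by blast
  have upB: "c' \<in> P B" if "c \<in> P B" "c' \<in> cells" "c \<subseteq> cl c'" for c c'
    using up[of c c'] down[of c' A c] excl[of c] that unfolding P_def by blast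
  have oA: "openin X (\<Union>(P A))" by (rule open_upset[OF _ upA]) (auto simp: P_def)
  have oB: "openin X (\<Union>(P B))" by (rule open_upset[OF _ upB]) (auto simp: P_def)
  have oS: "openin X (\<Union>(insert {v} (P A \<union> P B)))"
  proof (rule open_upset)
    show "insert {v} (P A \<union> P B) \<subseteq> cells" using v by (auto simp: P_def cells_def)
    fix c c' assume c: "c \<in> insert {v} (P A \<union> P B)" "c' \<in> cells" "c \<subseteq> cl c'"
    show "c' \<in> insert {v} (P A \<union> P B)"
    proof (cases "c = {v}")
      case True
      then show ?thesis using cover[OF c(2)] c(3) by blast
    next
      case False
      then show ?thesis using up[OF _ c(2,3)] c(1) by blast
    qed
  qed
  have disj: "\<Union>(P A) \<inter> \<Union>(P B) = {}"
  proof (rule ccontr)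
    assume "\<not> ?thesis"
    then obtain p c d where pcd: "p \<in> c" "p \<in> d" "c \<in> P A" "d \<in> P B" by blast
    then have "c = d" using cells_partition[of c d p] unfolding P_def by blast
    then show False using excl pcd by blast
  qed
  have vnot: "v \<notin> \<Union>(P D)" for D
  proof
    assume "v \<in> \<Union>(P D)"
    then obtain c where "c \<in> cells" "c \<noteq> {v}" "v \<in> c" unfolding P_def by blast
    moreover have "{v} \<in> cells" using v by (simp add: cells_def)
    ultimately show False using cells_partition[of c "{v}" v] by blast
  qed
  have "v \<in> topspace X" using v cells_cover by blast
  then obtain U \<phi> where U: "chart X U \<phi>" "v \<in> U" using surface_facts(4) unfolding planar_def by blast
  let ?S = "\<Union>(insert {v} (P A \<union> P B))"
  have "openin X (?S \<inter> U)" using oS chartD(1)[OF U(1)] by (rule openin_Int)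
  then have "open (\<phi> ` (?S \<inter> U))" by (rule chartD(7)[OF U(1)]) blast
  moreover have "\<phi> v \<in> \<phi> ` (?S \<inter> U)" using U(2) by blast
  ultimately obtain d where d: "d > 0" "ball (\<phi> v) d \<subseteq> \<phi> ` (?S \<inter> U)" by (meson open_contains_ball)
  \<comment> \<open>This punctured disc is connected, but will be covered by the disjoint open
    images of the two partial stars, each of which meets it.\<close>
  let ?D = "ball (\<phi> v) d - {\<phi> v}"
  have opA: "open (\<phi> ` (\<Union>(P A) \<inter> U))" "open (\<phi> ` (\<Union>(P B) \<inter> U))"
    using oA oB chartD(1)[OF U(1)] by (blast intro: chartD(7)[OF U(1)] openin_Int)+
  have inj: "inj_on \<phi> U" by (rule chartD(3)[OF U(1)])
  have D: "?D \<subseteq> \<phi> ` (\<Union>(P A) \<inter> U) \<union> \<phi> ` (\<Union>(P B) \<inter> U)"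
  proof
    fix z assume z: "z \<in> ?D"
    then obtain x where x: "x \<in> ?S \<inter> U" "z = \<phi> x" using d(2) by blast
    then have "x \<noteq> v" using z by blast
    then show "z \<in> \<phi> ` (\<Union>(P A) \<inter> U) \<union> \<phi> ` (\<Union>(P B) \<inter> U)" using x by blast
  qed
  have "\<phi> ` (\<Union>(P A) \<inter> U) \<inter> \<phi> ` (\<Union>(P B) \<inter> U) = {}"
  proof -
    have "\<phi> ` (\<Union>(P A) \<inter> U) \<inter> \<phi> ` (\<Union>(P B) \<inter> U) = \<phi> ` ((\<Union>(P A) \<inter> U) \<inter> (\<Union>(P B) \<inter> U))"
      by (rule inj_on_image_Int[OF inj, symmetric]) auto
    moreover have "(\<Union>(P A) \<inter> U) \<inter> (\<Union>(P B) \<inter> U) = {}" using disj by blast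
    ultimately show ?thesis by simp
  qed
  then have D': "\<phi> ` (\<Union>(P A) \<inter> U) \<inter> \<phi> ` (\<Union>(P B) \<inter> U) \<inter> ?D = {}" by blast
  \<comment> \<open>Each tile of \<open>D\<close> has \<open>v\<close> in its closure and hence
    points in every chart disc around \<open>v\<close>.\<close>
  have meets: "\<phi> ` (\<Union>(P D) \<inter> U) \<inter> ?D \<noteq> {}" if D: "a \<in> D" "D \<subseteq> A \<union> B" for a D
  proof -
    have a: "a \<in> F" "v \<in> cl a" using D AB(1) by blast+
    have ac: "a \<in> cells" using a by (simp add: cells_def)
    have "a \<noteq> {v}" using cells_disjoint(2)[OF v a(1)] by blast
    then have aP: "a \<in> P D" using ac a fcl[OF a(1)] D(1) unfolding P_def by blast
    define N where "N = {x \<in> topspace (subtopology X U). \<phi> x \<in> ball (\<phi> v) d}"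
    have "openin (subtopology X U) N"
      unfolding N_def by (rule openin_continuous_map_preimage[OF chartD(5)[OF U(1)]]) simp
    then have "openin X N" using openin_open_subtopology[OF chartD(1)[OF U(1)]] by blast
    moreover have "v \<in> N" using U(2) d(1) \<open>v \<in> topspace X\<close> by (simp add: N_def)
    ultimately obtain x where x: "x \<in> a" "x \<in> N" using a(2) unfolding in_closure_of by blast
    have xU: "x \<in> U" "\<phi> x \<in> ball (\<phi> v) d" using x(2) by (auto simp: N_def)
    have "x \<noteq> v" using cells_disjoint(2)[OF v a(1)] x(1) by blast
    then have "\<phi> x \<noteq> \<phi> v" using inj_onD[OF inj _ xU(1) U(2)] by blast
    then have "\<phi> x \<in> ?D" using xU(2) by simp
    moreover have "\<phi> x \<in> \<phi> ` (\<Union>(P D) \<inter> U)" using aP x(1) xU(1) by blast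
    ultimately show ?thesis by blast
  qed
  obtain a b where "a \<in> A" "b \<in> B" using AB(3,4) by blast
  then have "\<phi> ` (\<Union>(P A) \<inter> U) \<inter> ?D \<noteq> {}" "\<phi> ` (\<Union>(P B) \<inter> U) \<inter> ?D \<noteq> {}"
    using meets[of a A] meets[of b B] by blast+
  moreover have "connected ?D" by (rule connected_punctured_ball) simp
  ultimately show False using connectedD[OF _ opA D' D] by blast
qed

text \<open>Without such an edge, the closed tiles of the two families share no cell at all, a
  common vertex being excluded by \<open>link_connected\<close>. The surface would then fall apart
  into two open sets.\<close>

lemma faces_connected:
  assumes A: "A \<subset> F" "A \<noteq> {}"
  shows "\<exists>e\<in>E. \<exists>a\<in>A. \<exists>b\<in>F - A. e \<subseteq> cl a \<and> e \<subseteq> cl b"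
proof (rule ccontr)
  assume none: "\<not> ?thesis"
  define B where "B = F - A"
  have AB: "A \<union> B = F" "A \<inter> B = {}" "B \<noteq> {}" using A by (auto simp: B_def)
  define P where "P D = {c \<in> cells. \<exists>a\<in>D. c \<subseteq> cl a}" for D
  have fcl: "f \<subseteq> cl f" if "f \<in> F" for f
    using that cells_cover by (intro closure_of_subset) blast
  have cover: "c \<in> P A \<union> P B" if c: "c \<in> cells" for c
  proof -
    obtain f where "f \<in> F" "c \<subseteq> cl f"
      using c edge_in_some_face vertex_in_some_face fcl unfolding cells_def by blast
    then show ?thesis using AB(1) c unfolding P_def by blast
  qed
  have excl: "c \<notin> P B" if "c \<in> P A" for c
  proof
    assume "c \<in> P B"
    then obtain a b where ab: "a \<in> A" "b \<in> B" "c \<subseteq> cl a" "c \<subseteq> cl b" and c: "c \<in> cells"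
      using \<open>c \<in> P A\<close> unfolding P_def by blast
    consider v where "v \<in> V" "c = {v}" | "c \<in> E" | "c \<in> F" using c unfolding cells_def by blast
    then show False
    proof cases
      case 1
      show False
      proof (rule link_connected[OF 1(1), of "{a \<in> A. v \<in> cl a}" "{b \<in> B. v \<in> cl b}"])
        show "{a \<in> A. v \<in> cl a} \<union> {b \<in> B. v \<in> cl b} = {f \<in> F. v \<in> cl f}" using AB(1) by blast
        show "{a \<in> A. v \<in> cl a} \<inter> {b \<in> B. v \<in> cl b} = {}" using AB(2) by blast
        show "{a \<in> A. v \<in> cl a} \<noteq> {}" "{b \<in> B. v \<in> cl b} \<noteq> {}" using 1(2) ab by blast+
        show "False" if "e \<in> E" "a \<in> {a \<in> A. v \<in> cl a}" "b \<in> {b \<in> B. v \<in> cl b}" "e \<subseteq> cl a" "e \<subseteq> cl b" for e a b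
          using none that unfolding B_def by blast
      qed
    next
      case 2
      then show False using none ab unfolding B_def by blast
    next
      case 3
      have "a \<in> cells" "b \<in> cells" using ab AB(1) unfolding cells_def by blast+
      then have "a = c" "b = c" using face_maximal[OF 3] ab by blast+
      then show False using ab AB(2) by blast
    qed
  qed
  have down: "c \<in> P D" if cP: "c' \<in> P D" and "c \<in> cells" "c \<subseteq> cl c'" for c c' D
  proof -
    obtain a where a: "a \<in> D" "c' \<subseteq> cl a" using cP unfolding P_def by blast
    then have "cl c' \<subseteq> cl a" using closure_of_mono[of c' "cl a" X] by simp
    then show ?thesis using that a unfolding P_def by blast
  qed
  have upA: "c' \<in> P A" if "c \<in> P A" "c' \<in> cells" "c \<subseteq> cl c'" for c c'
    using cover[of c'] down[of c' B c] excl[of c] that unfolding P_def by blast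
  have upB: "c' \<in> P B" if "c \<in> P B" "c' \<in> cells" "c \<subseteq> cl c'" for c c'
    using cover[of c'] down[of c' A c] excl[of c] that unfolding P_def by blast
  have oA: "openin X (\<Union>(P A))" by (rule open_upset[OF _ upA]) (auto simp: P_def)
  have oB: "openin X (\<Union>(P B))" by (rule open_upset[OF _ upB]) (auto simp: P_def)
  have cov: "topspace X \<subseteq> \<Union>(P A) \<union> \<Union>(P B)" using cover Union_cells by blast
  have dis: "\<Union>(P A) \<inter> \<Union>(P B) = {}"
  proof (rule ccontr)
    assume "\<not> ?thesis"
    then obtain p c d where pcd: "p \<in> c" "p \<in> d" "c \<in> P A" "d \<in> P B" by blast
    then have "c = d" using cells_partition[of c d p] unfolding P_def by blast
    then show False using excl pcd by blast
  qed
  have ne: "\<Union>(P D) \<noteq> {}" if D: "D \<subseteq> F" "D \<noteq> {}" for D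
  proof -
    obtain a where a: "a \<in> D" using D by blast
    then have "a \<in> P D" using D fcl[of a] unfolding P_def cells_def by blast
    then show ?thesis using face_nonempty[of a] a D by blast
  qed
  have sub: "A \<subseteq> F" "B \<subseteq> F" using A(1) AB(1) by blast+
  have nonempty: "\<Union>(P A) \<noteq> {}" "\<Union>(P B) \<noteq> {}"
    by (rule ne[OF sub(1) A(2)], rule ne[OF sub(2) AB(3)])
  have "\<exists>S S'. openin X S \<and> openin X S' \<and> topspace X \<subseteq> S \<union> S' \<and> S \<inter> S' = {} \<and> S \<noteq> {} \<and> S' \<noteq> {}"
    by (intro exI[of _ "\<Union>(P A)"] exI[of _ "\<Union>(P B)"] conjI oA oB cov dis nonempty)
  then show False using surface_facts(2) unfolding connected_space_def by (rule_tac notE)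
qed

end

section \<open>The incidence theorem\<close>

text \<open>By commutativity the first letter can be moved next to its partner and cancels with it;
  the remaining word is again closed under \<open>\<alpha>\<close>.\<close>

lemma prod_list_involution:
  fixes \<nu> :: "'l \<Rightarrow> 'd::division_ring"
  assumes comm: "\<forall>x y :: 'd. x * y = y * x" and \<alpha>: "\<And>d. \<alpha> (\<alpha> d) = d" "\<And>d. \<alpha> d \<noteq> d"
    and \<nu>: "\<And>d. d \<in> set w \<Longrightarrow> \<nu> d \<noteq> 0 \<and> \<nu> (\<alpha> d) = inverse (\<nu> d)"
    and w: "distinct w" "\<And>d. d \<in> set w \<Longrightarrow> \<alpha> d \<in> set w"
  shows "prod_list (map \<nu> w) = 1"
  using \<nu> w
proof (induction "length w" arbitrary: w rule: less_induct)
  case less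
  show ?case
  proof (cases w)
    case (Cons d v)
    have "\<alpha> d \<in> set v" using less.prems(3)[of d] Cons \<alpha>(2)[of d] by simp
    then obtain p q where v: "v = p @ \<alpha> d # q" by (meson split_list)
    have sub: "set (p @ q) \<subseteq> set w" using Cons v by auto
    have pq: "prod_list (map \<nu> (p @ q)) = 1"
    proof (rule less.hyps)
      show "length (p @ q) < length w" using Cons v by simp
      show "\<nu> c \<noteq> 0 \<and> \<nu> (\<alpha> c) = inverse (\<nu> c)" if "c \<in> set (p @ q)" for c
        using less.prems(1) sub that by blast
      show "distinct (p @ q)" using less.prems(2) Cons v by simp
      show "\<alpha> c \<in> set (p @ q)" if c: "c \<in> set (p @ q)" for c
      proof -
        have "c \<noteq> d" "c \<noteq> \<alpha> d" using less.prems(2) c unfolding Cons v by auto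
        then have "\<alpha> c \<noteq> d" "\<alpha> c \<noteq> \<alpha> d" using \<alpha>(1) by metis+
        moreover have "\<alpha> c \<in> set w" using less.prems(3) sub c by blast
        ultimately show ?thesis unfolding Cons v by auto
      qed
    qed
    have \<nu>d: "\<nu> d \<noteq> 0" "\<nu> (\<alpha> d) = inverse (\<nu> d)" using less.prems(1)[of d] Cons by auto
    have "prod_list (map \<nu> w) = \<nu> d * (prod_list (map \<nu> p) * \<nu> (\<alpha> d)) * prod_list (map \<nu> q)"
      by (simp add: Cons v mult.assoc)
    also have "prod_list (map \<nu> p) * \<nu> (\<alpha> d) = \<nu> (\<alpha> d) * prod_list (map \<nu> p)" using comm by blast
    also have "\<nu> d * (\<nu> (\<alpha> d) * prod_list (map \<nu> p)) * prod_list (map \<nu> q) =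
        (\<nu> d * inverse (\<nu> d)) * prod_list (map \<nu> (p @ q))"
      unfolding \<nu>d(2) map_append prod_list.append by (simp only: mult.assoc)
    finally show ?thesis using \<nu>d(1) pq by simp
  qed simp
qed

text \<open>For \<open>p\<close>, \<open>q\<close>, \<open>r\<close>, \<open>t\<close> the pairings
  of \<open>a\<^sub>1\<close> with \<open>l\<^sub>1\<close>, \<open>a\<^sub>2\<close> with
  \<open>l\<^sub>1\<close>, \<open>a\<^sub>2\<close> with \<open>l\<^sub>2\<close> and
  \<open>a\<^sub>1\<close> with \<open>l\<^sub>2\<close>, the right-hand side is the criterion of
  \<open>coherent_iff\<close>. The two words are the boundary of a tile read from a black and from a
  white corner.\<close>

lemma word_eq_1_iff:
  fixes p q r t :: "'d::division_ring"
  assumes "p \<noteq> 0" "q \<noteq> 0" "r \<noteq> 0" "t \<noteq> 0"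
  shows "p * (inverse q * (r * inverse t)) = 1 \<longleftrightarrow> q * inverse p = r * inverse t"
    "inverse p * (t * (inverse r * q)) = 1 \<longleftrightarrow> q * inverse p = r * inverse t"
proof -
  have cl: "z * u = v \<longleftrightarrow> u = inverse z * v" if "z \<noteq> 0" for z u v :: 'd
    using that by (auto simp: mult.assoc[symmetric])
  have cr: "u * z = v \<longleftrightarrow> u = v * inverse z" if "z \<noteq> 0" for z u v :: 'd
    using that by (auto simp: mult.assoc)
  have nz: "inverse p \<noteq> 0" "inverse q \<noteq> 0" "inverse r \<noteq> 0" using assms by simp_all
  show "p * (inverse q * (r * inverse t)) = 1 \<longleftrightarrow> q * inverse p = r * inverse t"
    unfolding cl[OF assms(1)] cl[OF nz(2)] using assms by auto
  show "inverse p * (t * (inverse r * q)) = 1 \<longleftrightarrow> q * inverse p = r * inverse t"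
    unfolding cl[OF nz(1), of "t * _"] cl[OF assms(4)] cl[OF nz(3)] cr[OF nz(1)] using assms by (simp add: mult.assoc)
qed

locale oriented_quad = quad_surface +
  fixes A :: "('a set \<times> ('a \<Rightarrow> complex)) set"
  assumes atlas: "oriented_atlas X A"
begin

section \<open>Darts and positively oriented boundary words\<close>

definition H :: "'a set \<Rightarrow> complex \<Rightarrow> 'a" where
  "H f = (SOME h. pos_pmap A f h)"

definition vt :: "'a set \<Rightarrow> nat \<Rightarrow> 'a" where
  "vt f j = H f (cis (ang j))"

definition ed :: "'a set \<Rightarrow> nat \<Rightarrow> 'a set" where
  "ed f j = H f ` side j"

text \<open>A dart is an edge with a direction, \<open>True\<close> being from black to white.\<close>

definition dart :: "'a set \<Rightarrow> nat \<Rightarrow> 'a set \<times> bool" where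
  "dart f j = (ed f j, vt f j \<in> black T)"

definition bd :: "'a set \<Rightarrow> ('a set \<times> bool) list" where
  "bd f = [dart f 0, dart f 1, dart f 2, dart f 3]"

text \<open>Every edge has exactly one black and one white end, so the direction of a dart is enough
  to single out its initial vertex.\<close>

definition org :: "'a set \<times> bool \<Rightarrow> 'a" where
  "org d = (THE v. v \<in> vertices_of T (fst d) \<and> (v \<in> black T \<longleftrightarrow> snd d))"

abbreviation "rv \<equiv> apsnd Not :: 'a set \<times> bool \<Rightarrow> 'a set \<times> bool"

lemma H: "f \<in> F \<Longrightarrow> pos_pmap A f (H f)" "f \<in> F \<Longrightarrow> pmap f (H f)"
proof -
  show "pos_pmap A f (H f)" if "f \<in> F" for f
    unfolding H_def using pos_pmap_exists[OF atlas that] by (rule someI_ex)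
  then show "f \<in> F \<Longrightarrow> pmap f (H f)" unfolding pos_pmap_def by blast
qed

lemma colours: "black T \<union> white T = V" "black T \<inter> white T = {}"
  "e \<in> E \<Longrightarrow> \<exists>b\<in>black T. \<exists>w\<in>white T. vertices_of T e = {b, w}"
  using tiling unfolding quadrilateral_tiling_def by auto

lemma ed_in: "f \<in> F \<Longrightarrow> j < 4 \<Longrightarrow> ed f j \<in> E"
  unfolding ed_def by (rule pmapD(7)[OF H(2)])

lemma ed_subset: "f \<in> F \<Longrightarrow> ed f j \<subseteq> cl f"
  unfolding ed_def by (rule pmap_edge_subset[OF H(2)])

lemma ed_inj: "f \<in> F \<Longrightarrow> i < 4 \<Longrightarrow> j < 4 \<Longrightarrow> ed f i = ed f j \<Longrightarrow> i = j"
  unfolding ed_def by (rule pmap_edge_inj[OF H(2)])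

lemma vt_inj: "f \<in> F \<Longrightarrow> i < 4 \<Longrightarrow> j < 4 \<Longrightarrow> vt f i = vt f j \<Longrightarrow> i = j"
  unfolding vt_def by (rule pmap_vertex_inj[OF H(2)])

lemma vertices_ed: "f \<in> F \<Longrightarrow> j < 4 \<Longrightarrow> vertices_of T (ed f j) = {vt f j, vt f (Suc j)}"
  unfolding ed_def vt_def by (rule vertices_of_pmap_edge[OF H(2)])

lemma vertices_f: "f \<in> F \<Longrightarrow> vertices_of T f = vt f ` {..<4}"
  unfolding vt_def[abs_def] by (rule vertices_of_face[OF H(2)])

lemma edge_ed: "f \<in> F \<Longrightarrow> e \<in> E \<Longrightarrow> e \<subseteq> cl f \<Longrightarrow> \<exists>j<4. e = ed f j"
  unfolding ed_def using edge_face_arc[OF _ _ H(2)] by metis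

lemma vt_mod: "j < 4 \<Longrightarrow> vt f (Suc j mod 4) = vt f (Suc j)"
proof (cases "Suc j = 4")
  case True
  then show ?thesis by (simp add: vt_def ang_simps)
qed simp

lemma alternate:
  assumes "f \<in> F" "j < 4"
  shows "vt f (Suc j) \<in> black T \<longleftrightarrow> vt f j \<notin> black T"
proof -
  obtain b w where bw: "b \<in> black T" "w \<in> white T" "vertices_of T (ed f j) = {b, w}"
    using colours(3)[OF ed_in[OF assms]] by blast
  have "w \<notin> black T" using bw colours(2) by blast
  moreover have "{vt f j, vt f (Suc j)} = {b, w}" using bw(3) vertices_ed[OF assms] by simp
  ultimately show ?thesis using bw(1) by (auto simp: doubleton_eq_iff)
qed

lemma org_eq:
  assumes "vertices_of T e = {b, w}" "b \<in> black T" "w \<notin> black T"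
  shows "org (e, True) = b" "org (e, False) = w"
  using assms unfolding org_def by (auto intro!: the_equality)

lemma org_dart:
  assumes f: "f \<in> F" "j < 4"
  shows "org (dart f j) = vt f j" "org (rv (dart f j)) = vt f (Suc j)"
proof -
  note v = vertices_ed[OF f] and a = alternate[OF f]
  show "org (dart f j) = vt f j" "org (rv (dart f j)) = vt f (Suc j)"
    using v a org_eq[of "ed f j" "vt f j" "vt f (Suc j)"] org_eq[of "ed f j" "vt f (Suc j)" "vt f j"]
    by (cases "vt f j \<in> black T"; simp add: dart_def insert_commute)+
qed

lemma set_bd: "d \<in> set (bd f) \<longleftrightarrow> (\<exists>j<4. d = dart f j)"
proof -
  have "j < 4 \<longleftrightarrow> j = 0 \<or> j = 1 \<or> j = 2 \<or> j = 3" for j :: nat by auto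
  then show ?thesis unfolding bd_def by auto
qed

lemma cyc_bd: "(d, d') \<in> cyc (bd f) \<longleftrightarrow> (\<exists>j<4. d = dart f j \<and> d' = dart f (Suc j mod 4))"
proof -
  have "j < 4 \<longleftrightarrow> j = 0 \<or> j = 1 \<or> j = 2 \<or> j = 3" for j :: nat by auto
  then have ex: "(\<exists>j<4. Q j) \<longleftrightarrow> Q 0 \<or> Q 1 \<or> Q 2 \<or> Q 3" for Q :: "nat \<Rightarrow> bool" by metis
  have cyc: "cyc (bd f) = {(dart f 0, dart f 1), (dart f 1, dart f 2), (dart f 2, dart f 3), (dart f 3, dart f 0)}"
    by (simp add: cyc_def bd_def)
  have m: "Suc 0 mod 4 = 1" "Suc 1 mod 4 = 2" "Suc 2 mod 4 = 3" "Suc 3 mod 4 = 0" by simp_all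
  show ?thesis unfolding ex cyc m insert_iff empty_iff prod.inject simp_thms ..
qed

lemma distinct_bd: "f \<in> F \<Longrightarrow> distinct (bd f)"
  unfolding bd_def dart_def using ed_inj[of f 0 1] ed_inj[of f 0 2] ed_inj[of f 0 3] ed_inj[of f 1 2] ed_inj[of f 1 3] ed_inj[of f 2 3]
  by auto

text \<open>\<open>edge_opposite\<close> excludes equal starting corners, and an edge has just two
  ends, so these must be exchanged.\<close>

lemma dart_opposite:
  assumes f: "f \<in> F" "f' \<in> F" "f \<noteq> f'" and j: "i < 4" "j < 4" and e: "ed f i = ed f' j"
  shows "dart f' j = rv (dart f i)" "vt f' j = vt f (Suc i)" "vt f' (Suc j) = vt f i"
proof -
  have "vt f i \<noteq> vt f' j"
    unfolding vt_def by (rule edge_opposite[OF atlas H(1) H(1) f(3) j e[unfolded ed_def]]) (rule f)+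
  moreover have "{vt f i, vt f (Suc i)} = {vt f' j, vt f' (Suc j)}"
    using vertices_ed[OF f(1) j(1)] vertices_ed[OF f(2) j(2)] e by simp
  ultimately show 1: "vt f' j = vt f (Suc i)" and "vt f' (Suc j) = vt f i" by (auto simp: doubleton_eq_iff)
  show "dart f' j = rv (dart f i)" unfolding dart_def using e 1 alternate[OF f(1) j(1)] by simp
qed

text \<open>The two tiles at an edge contribute its two opposite darts, and there is no third
  tile.\<close>

lemma dart_cover:
  assumes e: "fst d \<in> E"
  shows "\<exists>!f. f \<in> F \<and> d \<in> set (bd f)"
proof -
  obtain f1 f2 where f: "f1 \<in> F" "f2 \<in> F" "f1 \<noteq> f2" "fst d \<subseteq> cl f1" "fst d \<subseteq> cl f2"
    "\<forall>f\<in>F. fst d \<subseteq> cl f \<longrightarrow> f = f1 \<or> f = f2"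
    by (rule edge_two_faces[OF e])
  obtain j1 where j1: "j1 < 4" "fst d = ed f1 j1" using edge_ed[OF f(1) e f(4)] by blast
  obtain j2 where j2: "j2 < 4" "fst d = ed f2 j2" using edge_ed[OF f(2) e f(5)] by blast
  have opp: "dart f2 j2 = rv (dart f1 j1)" using j1 j2 by (intro dart_opposite(1)[OF f(1-3)]) simp_all
  have only: "dart f j = d \<longrightarrow> f = f1 \<and> j = j1 \<or> f = f2 \<and> j = j2" if "f \<in> F" "j < 4" for f j
  proof
    assume "dart f j = d"
    then have ej: "fst d = ed f j" by (auto simp: dart_def)
    then have "f = f1 \<or> f = f2" using f(6) ed_subset[OF \<open>f \<in> F\<close>] that(1) by blast
    then show "f = f1 \<and> j = j1 \<or> f = f2 \<and> j = j2"
      using ej j1 j2 ed_inj[OF f(1) that(2) j1(1)] ed_inj[OF f(2) that(2) j2(1)] by auto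
  qed
  have d: "fst (dart f1 j1) = fst d" using j1(2) by (simp add: dart_def)
  show ?thesis
  proof (cases "d = dart f1 j1")
    case True
    then have "d \<noteq> dart f2 j2" unfolding opp by (auto simp: prod_eq_iff)
    then show ?thesis using True only f(1) j1(1) unfolding set_bd by metis
  next
    case False
    then have "d = dart f2 j2" unfolding opp using d by (auto simp: prod_eq_iff)
    then show ?thesis using False only f(2) j2(1) unfolding set_bd by metis
  qed
qed

text \<open>The hypothesis says that \<open>u\<close> does not change from one tile to the next
  around a vertex. Sorting the tiles at \<open>v\<close> by whether their dart leaving
  \<open>v\<close> has the value \<open>u d1\<close> then contradicts
  \<open>link_connected\<close>.\<close>

lemma dart_link:
  fixes u :: "'a set \<times> bool \<Rightarrow> 'b"
  assumes u: "\<And>f d d'. f \<in> F \<Longrightarrow> (rv d, d') \<in> cyc (bd f) \<Longrightarrow> u d' = u d"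
    and d: "fst d1 \<in> E" "fst d2 \<in> E" "org d1 = org d2"
  shows "u d1 = u d2"
proof (rule ccontr)
  assume ne: "u d1 \<noteq> u d2"
  obtain f1 j1 where f1: "f1 \<in> F" "j1 < 4" "d1 = dart f1 j1" using dart_cover[OF d(1)] unfolding set_bd by blast
  obtain f2 j2 where f2: "f2 \<in> F" "j2 < 4" "d2 = dart f2 j2" using dart_cover[OF d(2)] unfolding set_bd by blast
  define v where "v = org d1"
  have v1: "vt f1 j1 = v" "vt f2 j2 = v" using org_dart(1) f1 f2 d(3) by (simp_all add: v_def)
  have vV: "v \<in> V" and vcl: "v \<in> cl f1" "v \<in> cl f2"
  proof -
    have "v \<in> vertices_of T f1" unfolding vertices_f[OF f1(1)] v1(1)[symmetric] using f1(2) by simp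
    moreover have "v \<in> vertices_of T f2" unfolding vertices_f[OF f2(1)] v1(2)[symmetric] using f2(2) by simp
    ultimately show "v \<in> V" "v \<in> cl f1" "v \<in> cl f2" by (simp_all add: vertices_of_def)
  qed
  have corner: "\<exists>j<4. vt f j = v" if "f \<in> F" "v \<in> cl f" for f
    using vertices_f[OF that(1)] that(2) vV unfolding vertices_of_def by force
  define S where "S f = (\<forall>j<4. vt f j = v \<longrightarrow> u (dart f j) = u d1)" for f
  have S: "S f \<longleftrightarrow> u (dart f j) = u d1" if "f \<in> F" "j < 4" "vt f j = v" for f j
    unfolding S_def using vt_inj[OF that(1)] that(2,3) by blast
  \<comment> \<open>The reverse of a dart lies on the boundary of the neighbouring tile, and the
    dart following it there starts at the same vertex as the original dart.\<close>
  have key: "u (dart b (Suc j mod 4)) = u (dart a i)"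
    if "a \<in> F" "b \<in> F" "a \<noteq> b" "i < 4" "j < 4" "ed a i = ed b j" for a b i j
  proof -
    have "(rv (dart a i), dart b (Suc j mod 4)) \<in> cyc (bd b)"
      unfolding cyc_bd using dart_opposite(1)[OF that] that(5) by auto
    then show ?thesis by (rule u[OF that(2)])
  qed
  have mod4: "Suc j mod 4 < 4" for j :: nat by simp
  show False
  proof (rule link_connected[OF vV, of "{f \<in> F. v \<in> cl f \<and> S f}" "{f \<in> F. v \<in> cl f \<and> \<not> S f}"])
    show "{f \<in> F. v \<in> cl f \<and> S f} \<noteq> {}" using f1 vcl(1) S[OF f1(1,2) v1(1)] by auto
    show "{f \<in> F. v \<in> cl f \<and> \<not> S f} \<noteq> {}" using f2 vcl(2) S[OF f2(1,2) v1(2)] ne by auto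
    fix e a b assume e: "e \<in> E" "v \<in> cl e" and a: "a \<in> {f \<in> F. v \<in> cl f \<and> S f}"
      and b: "b \<in> {f \<in> F. v \<in> cl f \<and> \<not> S f}" and sub: "e \<subseteq> cl a" "e \<subseteq> cl b"
    have ab: "a \<in> F" "b \<in> F" "a \<noteq> b" "S a" "\<not> S b" using a b by auto
    obtain i where i: "i < 4" "e = ed a i" using edge_ed[OF ab(1) e(1) sub(1)] by blast
    obtain j where j: "j < 4" "e = ed b j" using edge_ed[OF ab(2) e(1) sub(2)] by blast
    have ij: "ed a i = ed b j" using i j by simp
    note opp = dart_opposite[OF ab(1-3) i(1) j(1) ij]
    have "v \<in> vertices_of T e" using e(2) vV by (simp add: vertices_of_def)
    then have "v = vt a i \<or> v = vt a (Suc i)" using vertices_ed[OF ab(1) i(1)] i(2) by auto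
    then show False
    proof
      assume v: "v = vt a i"
      have "vt b (Suc j mod 4) = v" using vt_mod[OF j(1)] opp(3) v by simp
      then have "S b \<longleftrightarrow> u (dart b (Suc j mod 4)) = u d1" by (intro S[OF ab(2) mod4])
      then show False using ab(4,5) S[OF ab(1) i(1) v[symmetric]] key[OF ab(1-3) i(1) j(1) ij] by simp
    next
      assume v: "v = vt a (Suc i)"
      have va: "vt a (Suc i mod 4) = v" using vt_mod[OF i(1)] v by simp
      have vb: "vt b j = v" using opp(2) v by simp
      show False
        using ab(4,5) S[OF ab(1) mod4 va] S[OF ab(2) j(1) vb]
          key[OF ab(2,1) ab(3)[symmetric] j(1) i(1) ij[symmetric]] by simp
    qed
  qed blast+
qed

text \<open>On an edge leading out of \<open>S\<close>, the reversed dart belongs to the tile beyond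
  the edge and, by \<open>dart_cover\<close>, to no other.\<close>

lemma dart_connected:
  assumes "S \<subset> F" "S \<noteq> {}"
  shows "\<exists>f\<in>S. \<exists>d\<in>set (bd f). \<forall>f'\<in>S. rv d \<notin> set (bd f')"
proof -
  obtain e a b where e: "e \<in> E" "a \<in> S" "b \<in> F - S" "e \<subseteq> cl a" "e \<subseteq> cl b"
    using faces_connected[OF assms] by blast
  have aF: "a \<in> F" and bF: "b \<in> F" and ne: "a \<noteq> b" using e assms(1) by blast+
  obtain i where i: "i < 4" "e = ed a i" using edge_ed[OF aF e(1,4)] by blast
  obtain j where j: "j < 4" "e = ed b j" using edge_ed[OF bF e(1,5)] by blast
  have "rv (dart a i) \<in> set (bd b)"
    unfolding set_bd using dart_opposite(1)[OF aF bF ne i(1) j(1)] i j by metis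
  moreover have "fst (rv (dart a i)) \<in> E" using i e(1) by (simp add: dart_def)
  ultimately have "rv (dart a i) \<notin> set (bd f')" if "f' \<in> S" for f'
    using dart_cover[of "rv (dart a i)"] that e(3) assms(1) bF by blast
  then show ?thesis using e(2) i(1) set_bd by blast
qed

lemma vertex_edge:
  assumes "v \<in> V"
  shows "\<exists>e\<in>E. v \<in> vertices_of T e"
proof -
  obtain f where f: "f \<in> F" "v \<in> cl f" using vertex_in_some_face[OF assms] by blast
  then obtain j where "j < 4" "vt f j = v" using vertices_f[OF f(1)] assms unfolding vertices_of_def by force
  then show ?thesis using ed_in[OF f(1)] vertices_ed[OF f(1)] by blast
qed

lemma face_exists: "F \<noteq> {}"
proof
  assume "F = {}"
  then have "V = {}" "E = {}" using vertex_in_some_face edge_in_some_face by blast+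
  then have "topspace X = {}" using cells_cover \<open>F = {}\<close> by simp
  then show False using surf unfolding closed_connected_surface_def by blast
qed

section \<open>Labels of darts and coherence of tiles\<close>

definition lab :: "('a \<Rightarrow> 'd::division_ring ^ 'm) \<Rightarrow> ('a \<Rightarrow> 'd ^ 'm) \<Rightarrow> 'a set \<times> bool \<Rightarrow> 'd" where
  "lab a l d = (if snd d then pair (a (org (fst d, True))) (l (org (fst d, False)))
     else inverse (pair (a (org (fst d, True))) (l (org (fst d, False)))))"

lemma coherent_tile_iff:
  fixes a l :: "'a \<Rightarrow> 'd::division_ring ^ 'm::finite"
  assumes P: "\<And>b. b \<in> black T \<Longrightarrow> P b = left_span {a b}" and L: "\<And>w. w \<in> white T \<Longrightarrow> L w = ker_hyperplane (l w)"
    and nz: "\<And>d. fst d \<in> E \<Longrightarrow> lab a l d \<noteq> 0" and f: "f \<in> F"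
  shows "coherent_tile T P L f \<longleftrightarrow> prod_list (map (lab a l) (bd f)) = 1"
proof -
  \<comment> \<open>\<open>coherent_tile\<close> leaves the naming of the corners open, so the
    condition must be invariant under exchanging the two points and the two hyperplanes.\<close>
  define C where "C b\<^sub>1 b\<^sub>2 w\<^sub>1 w\<^sub>2 \<longleftrightarrow> P b\<^sub>1 = P b\<^sub>2 \<or> L w\<^sub>1 = L w\<^sub>2 \<or>
         proj_meets (proj_join (P b\<^sub>1) (P b\<^sub>2)) (L w\<^sub>1 \<inter> L w\<^sub>2)" for b\<^sub>1 b\<^sub>2 w\<^sub>1 w\<^sub>2
  have Csym: "C b\<^sub>1 b\<^sub>2 w\<^sub>1 w\<^sub>2 \<longleftrightarrow> C b\<^sub>2 b\<^sub>1 w\<^sub>1 w\<^sub>2" "C b\<^sub>1 b\<^sub>2 w\<^sub>1 w\<^sub>2 \<longleftrightarrow> C b\<^sub>1 b\<^sub>2 w\<^sub>2 w\<^sub>1" for b\<^sub>1 b\<^sub>2 w\<^sub>1 w\<^sub>2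
    unfolding C_def proj_join_def by (simp_all add: Un_commute Int_commute eq_commute)
  have coh: "coherent_tile T P L f \<longleftrightarrow> C b\<^sub>1 b\<^sub>2 w\<^sub>1 w\<^sub>2"
    if hb: "vertices_of T f \<inter> black T = {b\<^sub>1, b\<^sub>2}" and hw: "vertices_of T f \<inter> white T = {w\<^sub>1, w\<^sub>2}" for b\<^sub>1 b\<^sub>2 w\<^sub>1 w\<^sub>2
  proof
    assume "coherent_tile T P L f"
    then have "\<exists>c\<^sub>1 c\<^sub>2 u\<^sub>1 u\<^sub>2. {b\<^sub>1, b\<^sub>2} = {c\<^sub>1, c\<^sub>2} \<and> {w\<^sub>1, w\<^sub>2} = {u\<^sub>1, u\<^sub>2} \<and> C c\<^sub>1 c\<^sub>2 u\<^sub>1 u\<^sub>2"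
      unfolding coherent_tile_def hb hw C_def .
    then obtain c\<^sub>1 c\<^sub>2 u\<^sub>1 u\<^sub>2 where "{b\<^sub>1, b\<^sub>2} = {c\<^sub>1, c\<^sub>2}" "{w\<^sub>1, w\<^sub>2} = {u\<^sub>1, u\<^sub>2}" "C c\<^sub>1 c\<^sub>2 u\<^sub>1 u\<^sub>2"
      by (elim exE conjE)
    then show "C b\<^sub>1 b\<^sub>2 w\<^sub>1 w\<^sub>2" using Csym[of c\<^sub>1 c\<^sub>2 u\<^sub>1 u\<^sub>2] Csym[of c\<^sub>2 c\<^sub>1 u\<^sub>1 u\<^sub>2]
      unfolding doubleton_eq_iff by blast
  next
    assume C: "C b\<^sub>1 b\<^sub>2 w\<^sub>1 w\<^sub>2"
    have "\<exists>c\<^sub>1 c\<^sub>2 u\<^sub>1 u\<^sub>2. {b\<^sub>1, b\<^sub>2} = {c\<^sub>1, c\<^sub>2} \<and> {w\<^sub>1, w\<^sub>2} = {u\<^sub>1, u\<^sub>2} \<and> C c\<^sub>1 c\<^sub>2 u\<^sub>1 u\<^sub>2"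
      using C by blast
    then show "coherent_tile T P L f" unfolding coherent_tile_def hb hw C_def .
  qed
  have four: "{..<4::nat} = {0, 1, 2, 3}" by auto
  have vf: "vertices_of T f = {vt f 0, vt f 1, vt f 2, vt f 3}" unfolding vertices_f[OF f] four by simp
  have s: "Suc 0 = 1" "Suc 1 = 2" "Suc 2 = 3" "Suc 3 = 4" by simp_all
  have v4: "vt f 4 = vt f 0" using vt_mod[of 3 f] by simp
  note alt = alternate[OF f, of 0, unfolded s] alternate[OF f, of 1, unfolded s] alternate[OF f, of 2, unfolded s]
  have white: "v \<in> white T \<longleftrightarrow> v \<notin> black T" if "v \<in> vertices_of T f" for v
    using that colours(1,2) unfolding vertices_of_def by blast
  note wv = white[unfolded vf]
  note od0 = org_dart[OF f, of 0, unfolded s] and od1 = org_dart[OF f, of 1, unfolded s]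
    and od2 = org_dart[OF f, of 2, unfolded s] and od3 = org_dart[OF f, of 3, unfolded s v4]
  have nzd: "lab a l (dart f j) \<noteq> 0" if "j < 4" for j using nz ed_in[OF f that] by (simp add: dart_def)
  show ?thesis
  \<comment> \<open>The boundary word may start at a corner of either colour; the two cases
    correspond to the two forms of \<open>word_eq_1_iff\<close>.\<close>
  proof (cases "vt f 0 \<in> black T")
    case True
    then have b: "vt f 1 \<notin> black T" "vt f 2 \<in> black T" "vt f 3 \<notin> black T" using alt by simp_all
    have "vertices_of T f \<inter> black T = {vt f 0, vt f 2}" "vertices_of T f \<inter> white T = {vt f 1, vt f 3}"
      using True b wv unfolding vf by auto
    then have "coherent_tile T P L f \<longleftrightarrow> C (vt f 0) (vt f 2) (vt f 1) (vt f 3)" by (rule coh)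
    also have "\<dots> \<longleftrightarrow> left_span {a (vt f 0)} = left_span {a (vt f 2)} \<or> ker_hyperplane (l (vt f 1)) = ker_hyperplane (l (vt f 3)) \<or>
      proj_meets (proj_join (left_span {a (vt f 0)}) (left_span {a (vt f 2)})) (ker_hyperplane (l (vt f 1)) \<inter> ker_hyperplane (l (vt f 3)))"
      using True b wv P L unfolding C_def by simp
    finally have c: "coherent_tile T P L f \<longleftrightarrow> \<dots>" .
    have lab: "lab a l (dart f 0) = pair (a (vt f 0)) (l (vt f 1))" "lab a l (dart f 1) = inverse (pair (a (vt f 2)) (l (vt f 1)))"
      "lab a l (dart f 2) = pair (a (vt f 2)) (l (vt f 3))" "lab a l (dart f 3) = inverse (pair (a (vt f 0)) (l (vt f 3)))"
      using od0 od1 od2 od3 True b unfolding lab_def dart_def by simp_all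
    have n: "pair (a (vt f 0)) (l (vt f 1)) \<noteq> 0" "pair (a (vt f 0)) (l (vt f 3)) \<noteq> 0"
      "pair (a (vt f 2)) (l (vt f 1)) \<noteq> 0" "pair (a (vt f 2)) (l (vt f 3)) \<noteq> 0"
      using nzd[of 0] nzd[of 1] nzd[of 2] nzd[of 3] unfolding lab by simp_all
    show ?thesis
      unfolding c coherent_iff[OF n] bd_def using word_eq_1_iff(1)[OF n(1,3,4,2)] lab by simp
  next
    case False
    then have b: "vt f 1 \<in> black T" "vt f 2 \<notin> black T" "vt f 3 \<in> black T" using alt by simp_all
    have "vertices_of T f \<inter> black T = {vt f 1, vt f 3}" "vertices_of T f \<inter> white T = {vt f 0, vt f 2}"
      using False b wv unfolding vf by auto
    then have "coherent_tile T P L f \<longleftrightarrow> C (vt f 1) (vt f 3) (vt f 0) (vt f 2)" by (rule coh)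
    also have "\<dots> \<longleftrightarrow> left_span {a (vt f 1)} = left_span {a (vt f 3)} \<or> ker_hyperplane (l (vt f 0)) = ker_hyperplane (l (vt f 2)) \<or>
      proj_meets (proj_join (left_span {a (vt f 1)}) (left_span {a (vt f 3)})) (ker_hyperplane (l (vt f 0)) \<inter> ker_hyperplane (l (vt f 2)))"
      using False b wv P L unfolding C_def by simp
    finally have c: "coherent_tile T P L f \<longleftrightarrow> \<dots>" .
    have lab: "lab a l (dart f 0) = inverse (pair (a (vt f 1)) (l (vt f 0)))" "lab a l (dart f 1) = pair (a (vt f 1)) (l (vt f 2))"
      "lab a l (dart f 2) = inverse (pair (a (vt f 3)) (l (vt f 2)))" "lab a l (dart f 3) = pair (a (vt f 3)) (l (vt f 0))"
      using od0 od1 od2 od3 False b unfolding lab_def dart_def by simp_all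
    have n: "pair (a (vt f 1)) (l (vt f 0)) \<noteq> 0" "pair (a (vt f 1)) (l (vt f 2)) \<noteq> 0"
      "pair (a (vt f 3)) (l (vt f 0)) \<noteq> 0" "pair (a (vt f 3)) (l (vt f 2)) \<noteq> 0"
      using nzd[of 0] nzd[of 1] nzd[of 2] nzd[of 3] unfolding lab by simp_all
    show ?thesis
      unfolding c coherent_iff[OF n] bd_def using word_eq_1_iff(2)[OF n(1,3,4,2)] lab by simp
  qed
qed

lemma commutative_imp_incidence_theorem:
  assumes comm: "\<forall>x y :: 'd::division_ring. x * y = y * x"
  shows "incidence_theorem TYPE('d ^ 'm::finite) T"
  unfolding incidence_theorem_def
proof (intro allI impI ballI)
  fix P L :: "'a \<Rightarrow> ('d ^ 'm) set" and f0
  assume real: "realization T P L" and f0: "f0 \<in> F" and coh: "\<forall>f'\<in>F - {f0}. coherent_tile T P L f'"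
  have "\<forall>b\<in>black T. \<exists>a. P b = left_span {a}" "\<forall>w\<in>white T. \<exists>l. L w = ker_hyperplane l"
    using real unfolding realization_def proj_point_iff proj_hyperplane_iff by blast+
  then obtain a l where P: "\<And>b. b \<in> black T \<Longrightarrow> P b = left_span {a b}" and L: "\<And>w. w \<in> white T \<Longrightarrow> L w = ker_hyperplane (l w)"
    by metis
  have nz: "lab a l d \<noteq> 0" if e: "fst d \<in> E" for d
  proof -
    obtain b w where bw: "b \<in> black T" "w \<in> white T" "vertices_of T (fst d) = {b, w}" using colours(3)[OF e] by blast
    then have "\<not> P b \<subseteq> L w" using real e unfolding realization_def by blast
    then have "pair (a b) (l w) \<noteq> 0" using P L bw incident_iff by metis
    moreover have "org (fst d, True) = b" "org (fst d, False) = w" using org_eq[OF bw(3,1)] bw(2) colours(2) by blast+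
    ultimately show ?thesis by (simp add: lab_def)
  qed
  obtain xs where xs: "set xs = F - {f0}" "distinct xs" using finite_cells(3) finite_distinct_list[of "F - {f0}"] by auto
  let ?W = "concat (map bd (f0 # xs))"
  have setF: "set (f0 # xs) = F" using xs f0 by auto
  have bd_disj: "f = f'" if "f \<in> F" "f' \<in> F" "d \<in> set (bd f)" "d \<in> set (bd f')" for f f' d
  proof -
    have "fst d \<in> E" using that(1,3) ed_in unfolding set_bd dart_def by auto
    then show ?thesis using dart_cover that by blast
  qed
  have setW: "set ?W = {d. fst d \<in> E}"
  proof -
    have "set ?W = (\<Union>f\<in>F. set (bd f))" using setF by auto
    also have "\<dots> = {d. fst d \<in> E}"
    proof
      show "(\<Union>f\<in>F. set (bd f)) \<subseteq> {d. fst d \<in> E}" using ed_in unfolding set_bd[abs_def] by (auto simp: set_bd dart_def)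
      show "{d. fst d \<in> E} \<subseteq> (\<Union>f\<in>F. set (bd f))" using dart_cover by blast
    qed
    finally show ?thesis .
  qed
  have "distinct ?W"
  proof (rule distinct_concat)
    have "inj_on bd F"
    proof (rule inj_onI)
      fix f f' assume "f \<in> F" "f' \<in> F" "bd f = bd f'"
      then show "f = f'" using bd_disj[of f f' "dart f 0"] by (simp add: bd_def)
    qed
    then show "distinct (map bd (f0 # xs))" using xs unfolding distinct_map setF by simp
    show "distinct ys" if "ys \<in> set (map bd (f0 # xs))" for ys using that distinct_bd xs f0 by auto
    show "set ys \<inter> set zs = {}" if "ys \<in> set (map bd (f0 # xs))" "zs \<in> set (map bd (f0 # xs))" "ys \<noteq> zs" for ys zs
      using that bd_disj unfolding set_map setF by blast
  qed
  then have one: "prod_list (map (lab a l) ?W) = 1"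
  proof (rule prod_list_involution[OF comm, where \<alpha> = rv, rotated 3])
    show "rv (rv d) = d" "rv d \<noteq> d" for d by (auto simp: prod_eq_iff)
    show "lab a l d \<noteq> 0 \<and> lab a l (rv d) = inverse (lab a l d)" if "d \<in> set ?W" for d
    proof -
      have "fst d \<in> E" using that setW by blast
      then show ?thesis using nz[of d] by (simp add: lab_def)
    qed
    show "rv d \<in> set ?W" if "d \<in> set ?W" for d using that unfolding setW by simp
  qed
  have "prod_list (map (lab a l) (concat (map bd ys))) = 1" if "set ys \<subseteq> F - {f0}" for ys
    using that
  proof (induction ys)
    case (Cons y ys)
    then have "prod_list (map (lab a l) (bd y)) = 1"
      using coh coherent_tile_iff[OF P L nz, of y] by simp
    then show ?case using Cons by simp
  qed simp
  then have "prod_list (map (lab a l) (concat (map bd xs))) = 1" using xs by simp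
  then have "prod_list (map (lab a l) (bd f0)) = 1" using one by simp
  then show "coherent_tile T P L f0" using coherent_tile_iff[OF P L nz f0] by simp
qed

text \<open>The vectors \<open>a b\<close> are fixed first, in general position. Each
  \<open>l w\<close> then solves a linear system of its own, with one equation for each black
  neighbour of \<open>w\<close>, hence at most \<open>CARD('m)\<close> equations.\<close>

lemma incidence_theorem_imp_commutative:
  fixes x y :: "'d::division_ring"
  assumes inc: "incidence_theorem TYPE('d ^ 'm::finite) T" and simple: "simple_tiling T"
    and euler: "euler_characteristic T \<le> 0" and deg: "\<And>w. w \<in> white T \<Longrightarrow> degree_of T w \<le> CARD('m)"
  shows "x * y = y * x"
proof (rule ccontr)
  assume xy: "x * y \<noteq> y * x"
  then have inf: "infinite (UNIV :: 'd set)" using wedderburn by blast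
  obtain f0 where f0: "f0 \<in> F" using face_exists by blast
  have "\<exists>\<nu> :: 'a set \<times> bool \<Rightarrow> 'd. (\<forall>d. \<nu> d \<noteq> 0 \<and> \<nu> (rv d) = inverse (\<nu> d)) \<and>
    (\<forall>f\<in>F - {f0}. prod_list (map \<nu> (bd f)) = 1) \<and> prod_list (map \<nu> (bd f0)) \<noteq> 1"
  proof (rule quadrilateral_labelling[where E = E and Vs = V and org = org, OF finite_cells(2,1,3)])
    show "length (bd f) = 4" for f by (simp add: bd_def)
    show "distinct (bd f)" if "f \<in> F" for f using that by (rule distinct_bd)
    show "fst d \<in> E" if "f \<in> F" "d \<in> set (bd f)" for f d using that ed_in unfolding set_bd dart_def by auto
    show "\<exists>!f. f \<in> F \<and> d \<in> set (bd f)" if "fst d \<in> E" for d using that by (rule dart_cover)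
    show "org d \<in> V" if e: "fst d \<in> E" for d
    proof -
      obtain f j where "f \<in> F" "j < 4" "d = dart f j" using dart_cover[OF e] unfolding set_bd by blast
      then show ?thesis using org_dart(1)[of f j] vertices_f[of f] unfolding vertices_of_def by auto
    qed
    show "org d' = org (rv d)" if "f \<in> F" "(d, d') \<in> cyc (bd f)" for f d d'
      using that org_dart vt_mod unfolding cyc_bd by auto
    show "u d = u d'" if "\<And>f d d'. f \<in> F \<Longrightarrow> (rv d, d') \<in> cyc (bd f) \<Longrightarrow> u d' = u d" "fst d \<in> E" "fst d' \<in> E" "org d = org d'"
      for u :: "'a set \<times> bool \<Rightarrow> bit" and d d' using that by (rule dart_link)
    show "\<exists>f\<in>S. \<exists>d\<in>set (bd f). \<forall>f'\<in>S. rv d \<notin> set (bd f')" if "S \<subset> F" "S \<noteq> {}" for S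
      using that by (rule dart_connected)
    show "card V + card F \<le> card E" using euler unfolding euler_characteristic_def by linarith
  qed (rule f0, rule xy)
  then obtain \<nu> :: "'a set \<times> bool \<Rightarrow> 'd" where n: "\<forall>d. \<nu> d \<noteq> 0 \<and> \<nu> (rv d) = inverse (\<nu> d)"
    "\<forall>f\<in>F - {f0}. prod_list (map \<nu> (bd f)) = 1" "prod_list (map \<nu> (bd f0)) \<noteq> 1"
    by (elim exE conjE)
  have \<nu>: "\<And>d. \<nu> d \<noteq> 0" "\<And>d. \<nu> (rv d) = inverse (\<nu> d)"
    "\<And>f. f \<in> F - {f0} \<Longrightarrow> prod_list (map \<nu> (bd f)) = 1" "prod_list (map \<nu> (bd f0)) \<noteq> 1"
    using n(1) n(1) n(2) n(3) by (blast, blast, blast, blast)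
  have VB: "black T \<subseteq> V" "white T \<subseteq> V" using colours(1) by blast+
  have "finite (black T)" using finite_cells(1) VB(1) finite_subset by blast
  then obtain a :: "'a \<Rightarrow> 'd ^ 'm" where
    a: "\<And>N z. N \<subseteq> black T \<Longrightarrow> card N \<le> CARD('m) \<Longrightarrow> \<exists>l. \<forall>b\<in>N. pair (a b) l = z b"
    using general_position[OF inf] by metis
  have "\<exists>l. \<forall>e\<in>E. \<forall>b\<in>black T. vertices_of T e = {b, w} \<longrightarrow> pair (a b) l = \<nu> (e, True)" if w: "w \<in> white T" for w
  proof -
    define N where "N = {b \<in> black T. \<exists>e\<in>E. vertices_of T e = {b, w}}"
    define D where "D = {e \<in> E. w \<in> vertices_of T e}"
    have wb: "w \<notin> black T" using w colours(2) by blast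
    have "N \<subseteq> (\<lambda>e. org (e, True)) ` D"
    proof
      fix b assume "b \<in> N"
      then obtain e where e: "b \<in> black T" "e \<in> E" "vertices_of T e = {b, w}" by (auto simp: N_def)
      then have "org (e, True) = b" using org_eq(1)[OF e(3,1) wb] by simp
      moreover have "e \<in> D" using e by (simp add: D_def)
      ultimately show "b \<in> (\<lambda>e. org (e, True)) ` D" by blast
    qed
    moreover have "finite D" using finite_cells(2) by (simp add: D_def)
    ultimately have "card N \<le> card D" by (meson card_image_le card_mono finite_imageI order.trans)
    then have "card N \<le> CARD('m)" using deg[OF w] unfolding degree_of_def D_def by simp
    moreover have "N \<subseteq> black T" by (auto simp: N_def)
    \<comment> \<open>The edge is recovered from its end points by \<open>SOME\<close>. Simplicity
      makes it unique, so no black neighbour is subject to two conflicting equations.\<close>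
    ultimately obtain l where l: "\<forall>b\<in>N. pair (a b) l = \<nu> (SOME e. e \<in> E \<and> vertices_of T e = {b, w}, True)"
      using a[of N "\<lambda>b. \<nu> (SOME e. e \<in> E \<and> vertices_of T e = {b, w}, True)"] by blast
    have "pair (a b) l = \<nu> (e, True)" if e: "e \<in> E" "b \<in> black T" "vertices_of T e = {b, w}" for e b
    proof -
      have "(SOME e. e \<in> E \<and> vertices_of T e = {b, w}) = e"
        using e simple unfolding simple_tiling_def by (intro some_equality) auto
      moreover have "b \<in> N" using e by (auto simp: N_def)
      ultimately show ?thesis using l by simp
    qed
    then show ?thesis by blast
  qed
  then obtain l where l: "\<And>w e b. w \<in> white T \<Longrightarrow> e \<in> E \<Longrightarrow> b \<in> black T \<Longrightarrow> vertices_of T e = {b, w} \<Longrightarrow> pair (a b) (l w) = \<nu> (e, True)"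
    by metis
  have lab: "lab a l d = \<nu> d" if e: "fst d \<in> E" for d
  proof -
    obtain b w where bw: "b \<in> black T" "w \<in> white T" "vertices_of T (fst d) = {b, w}" using colours(3)[OF e] by blast
    have o: "org (fst d, True) = b" "org (fst d, False) = w" using org_eq[OF bw(3,1)] bw(2) colours(2) by blast+
    have "pair (a b) (l w) = \<nu> (fst d, True)" using l[OF bw(2) e bw(1,3)] .
    moreover have "\<nu> (fst d, False) = inverse (\<nu> (fst d, True))" using \<nu>(2)[of "(fst d, True)"] by simp
    ultimately show ?thesis unfolding lab_def o by (cases d; cases "snd d") auto
  qed
  have edge_at: "\<exists>e\<in>E. \<exists>b\<in>black T. \<exists>w\<in>white T. vertices_of T e = {b, w} \<and> v \<in> {b, w}" if "v \<in> V" for v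
    using vertex_edge[OF that] colours(3) by metis
  \<comment> \<open>Every vertex lies on an edge, and a zero vector there would give this edge the
    label 0.\<close>
  have an: "a b \<noteq> 0" if b: "b \<in> black T" for b
  proof
    assume 0: "a b = 0"
    obtain e b' w where e: "e \<in> E" "b' \<in> black T" "w \<in> white T" "vertices_of T e = {b', w}" "b \<in> {b', w}"
      using edge_at[of b] b VB by blast
    then have "b = b'" using b colours(2) by blast
    then show False using l[OF e(3,1,2,4)] \<nu>(1) 0 by (metis pair_simps(4))
  qed
  have ln: "l w \<noteq> 0" if w: "w \<in> white T" for w
  proof
    assume 0: "l w = 0"
    obtain e b w' where e: "e \<in> E" "b \<in> black T" "w' \<in> white T" "vertices_of T e = {b, w'}" "w \<in> {b, w'}"
      using edge_at[of w] w VB by blast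
    then have "w = w'" using w colours(2) by blast
    then show False using l[OF e(3,1,2,4)] \<nu>(1) 0 by (metis pair_simps(5))
  qed
  define P where "P b = left_span {a b}" for b
  define L where "L w = ker_hyperplane (l w)" for w
  have "realization T P L"
    unfolding realization_def
  proof (intro conjI ballI impI)
    show "proj_point (P b)" if "b \<in> black T" for b using an[OF that] unfolding proj_point_iff P_def by blast
    show "proj_hyperplane (L w)" if "w \<in> white T" for w using ln[OF that] unfolding proj_hyperplane_iff L_def by blast
    show "\<not> P b \<subseteq> L w" if "e \<in> E" "b \<in> black T" "w \<in> white T" "vertices_of T e = {b, w}" for e b w
      unfolding P_def L_def incident_iff using l[OF that(3,1,2,4)] \<nu>(1) by metis
  qed
  moreover have coh: "coherent_tile T P L f \<longleftrightarrow> prod_list (map \<nu> (bd f)) = 1" if f: "f \<in> F" for f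
  proof -
    have "map (lab a l) (bd f) = map \<nu> (bd f)"
      using lab ed_in[OF f] by (intro map_cong) (auto simp: set_bd dart_def)
    moreover have "coherent_tile T P L f \<longleftrightarrow> prod_list (map (lab a l) (bd f)) = 1"
      using lab \<nu>(1) by (intro coherent_tile_iff[OF _ _ _ f]) (simp_all add: P_def L_def)
    ultimately show ?thesis by (simp only:)
  qed
  then have "\<forall>f\<in>F - {f0}. coherent_tile T P L f" using \<nu>(3) by blast
  ultimately have "coherent_tile T P L f0" using inc f0 unfolding incidence_theorem_def by blast
  then show False using coh[OF f0] \<nu>(4) by simp
qed

end

theorem theorem5p15:
  fixes T :: "'a tiling" and g n :: nat
  assumes "quadrilateral_tiling T" and "simple_tiling T"
    and "orientable (surface T)" and "has_genus T g" and "g > 0"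
    and "CARD('m::finite) = n + 1"
    and "n \<ge> Max (degree_of T ` white T) - 1"
  shows "incidence_theorem TYPE('d::division_ring ^ 'm) T \<longleftrightarrow> (\<forall>x y :: 'd. x * y = y * x)"
proof -
  interpret quad_surface T by unfold_locales (rule assms(1))
  obtain A where "oriented_atlas (surface T) A"
    using assms(3) unfolding orientable_def oriented_atlas_def by blast
  then interpret oriented_quad T A by unfold_locales
  have "finite (white T)" using finite_cells(1) colours(1) by (metis finite_Un)
  then have "degree_of T w \<le> Max (degree_of T ` white T)" if "w \<in> white T" for w using that by simp
  \<comment> \<open>Truncated subtraction does no harm: in every case the maximal degree is at most
    \<open>n + 1\<close>, which is \<open>CARD('m)\<close>.\<close>
  then have deg: "degree_of T w \<le> CARD('m)" if "w \<in> white T" for w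
    using that assms(6,7) by fastforce
  have "euler_characteristic T \<le> 0" using assms(4,5) unfolding has_genus_def by simp
  then show ?thesis
    using incidence_theorem_imp_commutative[OF _ assms(2) _ deg] commutative_imp_incidence_theorem by blast
qed

end
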